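(* Let $k$ be a fixed positive integer. There exists a randomized algorithm running in $\tilde{O}(mn + n^{k/2 + 1})$ time that, with high probability, computes a $\left(2 - \frac{1}{2k-1}, 1 - \frac{1}{2k-1}\right)$-approximation to the $k$-center of any unweighted, undirected graph with $n$ vertices and $m$ edges.
   Context: $G=(V,E)$ is an undirected unweighted graph with $n$ vertices and $m\ge n-1$ edges, $d$ its shortest-path distance. $R_k(G)=\min_{C\subseteq V,|C|=k}\max_{v\in V} d(v,C)$ with $d(v,C)=\min_{c\in C}d(v,c)$ (the $k$-radius). An $(\alpha,\beta)$-approximation to the $k$-center is a value $\tilde R$ (witnessed by $k$ vertices covering all vertices within distance $\tilde R$) with $R_k(G)\le \tilde R\le \alpha R_k(G)+\beta$. $\tilde O$ hides polylogarithmic factors; "with high probability" means with probability at least $1-1/n^{c}$ for a constant $c>0$. *)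

theory Defs
  imports "HOL-Probability.Probability" "HOL-Library.Log_Nat"
begin

section \<open>Graphs and the k-center problem\<close>

text \<open>Graphs have vertex set \<open>{..<n}\<close>; they need not be connected, so distances are extended
  naturals, with \<open>\<infinity>\<close> (the infimum of the empty set) between different components.\<close>

definition simple_graph :: "nat \<Rightarrow> nat set set \<Rightarrow> bool" where
  "simple_graph n E \<longleftrightarrow> (\<forall>e\<in>E. \<exists>u v. e = {u, v} \<and> u \<noteq> v \<and> u < n \<and> v < n)"

definition walk :: "nat set set \<Rightarrow> nat list \<Rightarrow> bool" where
  "walk E p \<longleftrightarrow> p \<noteq> [] \<and> successively (\<lambda>u v. {u, v} \<in> E) p"

definition gdist :: "nat set set \<Rightarrow> nat \<Rightarrow> nat \<Rightarrow> enat" where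
  "gdist E u v = (INF p\<in>{p. walk E p \<and> hd p = u \<and> last p = v}. enat (length p - 1))"

definition set_gdist :: "nat set set \<Rightarrow> nat \<Rightarrow> nat set \<Rightarrow> enat" where
  "set_gdist E v C = (INF c\<in>C. gdist E v c)"

definition k_radius :: "nat \<Rightarrow> nat set set \<Rightarrow> nat \<Rightarrow> enat" where
  "k_radius n E k = (INF C\<in>{C. C \<subseteq> {..<n} \<and> card C = k}. SUP v\<in>{..<n}. set_gdist E v C)"

definition k_center_approx ::
  "real \<Rightarrow> real \<Rightarrow> nat \<Rightarrow> nat set set \<Rightarrow> nat \<Rightarrow> enat \<Rightarrow> nat set \<Rightarrow> bool" where
  "k_center_approx \<alpha> \<beta> n E k R C \<longleftrightarrow>
     C \<subseteq> {..<n} \<and> card C = k \<and> (\<forall>v<n. set_gdist E v C \<le> R) \<and>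
     k_radius n E k \<le> R \<and>
     ereal_of_enat R \<le> ereal \<alpha> * ereal_of_enat (k_radius n E k) + ereal \<beta>"

section \<open>Randomized word RAM\<close>

text \<open>Programs act on registers and on a random-access memory, both holding \<open>w\<close>-bit words;
  arithmetic is modulo \<open>2 ^ w\<close>. Every instruction, and every evaluation of a branch or loop
  condition (register nonzero), takes one step.\<close>

datatype binop = OpAdd | OpSub | OpMul | OpDiv | OpMod | OpLess | OpEq

datatype instr =
    Const nat nat
  | Move nat nat
  | Bin binop nat nat nat
  | Load nat nat
  | Store nat nat
  | Rand nat
  | Cond nat "instr list" "instr list"
  | While nat "instr list"

record ram_state =
  reg :: "nat \<Rightarrow> nat"
  mem :: "nat \<Rightarrow> nat"

text \<open>A configuration consists of the instructions still to be executed and the state.\<close>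

type_synonym config = "instr list \<times> ram_state"

fun eval_op :: "nat \<Rightarrow> binop \<Rightarrow> nat \<Rightarrow> nat \<Rightarrow> nat" where
  "eval_op w OpAdd a b = (a + b) mod 2 ^ w"
| "eval_op w OpSub a b = nat ((int a - int b) mod 2 ^ w)"
| "eval_op w OpMul a b = (a * b) mod 2 ^ w"
| "eval_op w OpDiv a b = a div b"
| "eval_op w OpMod a b = a mod b"
| "eval_op w OpLess a b = of_bool (a < b)"
| "eval_op w OpEq a b = of_bool (a = b)"

definition set_reg :: "nat \<Rightarrow> nat \<Rightarrow> ram_state \<Rightarrow> ram_state" where
  "set_reg x a s = s\<lparr>reg := (reg s)(x := a)\<rparr>"

definition set_mem :: "nat \<Rightarrow> nat \<Rightarrow> ram_state \<Rightarrow> ram_state" where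
  "set_mem i a s = s\<lparr>mem := (mem s)(i := a)\<rparr>"

fun step :: "nat \<Rightarrow> config \<Rightarrow> config pmf" where
  "step w ([], s) = return_pmf ([], s)"
| "step w (Const x a # K, s) = return_pmf (K, set_reg x (a mod 2 ^ w) s)"
| "step w (Move x y # K, s) = return_pmf (K, set_reg x (reg s y) s)"
| "step w (Bin f x y z # K, s) = return_pmf (K, set_reg x (eval_op w f (reg s y) (reg s z)) s)"
| "step w (Load x y # K, s) = return_pmf (K, set_reg x (mem s (reg s y)) s)"
| "step w (Store x y # K, s) = return_pmf (K, set_mem (reg s x) (reg s y) s)"
| "step w (Rand x # K, s) = map_pmf (\<lambda>a. (K, set_reg x a s)) (pmf_of_set {..<2 ^ w})"
| "step w (Cond x A B # K, s) = return_pmf ((if reg s x \<noteq> 0 then A else B) @ K, s)"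
| "step w (While x A # K, s) = return_pmf (if reg s x \<noteq> 0 then A @ While x A # K else K, s)"

definition run :: "nat \<Rightarrow> nat \<Rightarrow> config \<Rightarrow> config pmf" where
  "run w t c = ((\<lambda>p. bind_pmf p (step w)) ^^ t) (return_pmf c)"

definition halted :: "config \<Rightarrow> bool" where
  "halted c \<longleftrightarrow> fst c = []"

section \<open>Input, output and running time\<close>

text \<open>The input is an arbitrary listing of the edges, each once and in arbitrary orientation.\<close>

definition edge_listing :: "nat set set \<Rightarrow> (nat \<times> nat) list \<Rightarrow> bool" where
  "edge_listing E es \<longleftrightarrow>
     distinct (map (\<lambda>(u, v). {u, v}) es) \<and> set (map (\<lambda>(u, v). {u, v}) es) = E"

definition input_state :: "nat \<Rightarrow> (nat \<times> nat) list \<Rightarrow> ram_state" where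
  "input_state n es =
     \<lparr>reg = (\<lambda>_. 0)(0 := n, 1 := length es),
      mem = (\<lambda>i. if i < 2 * length es
                  then (if even i then fst (es ! (i div 2)) else snd (es ! (i div 2))) else 0)\<rparr>"

text \<open>The output value is read off register 0, where the word \<open>0\<close> stands for \<open>\<infinity>\<close> and
  \<open>r + 1\<close> stands for \<open>r\<close>; the centers are read off the first \<open>k\<close> memory cells.\<close>

definition output_value :: "config \<Rightarrow> enat" where
  "output_value c = (case reg (snd c) 0 of 0 \<Rightarrow> \<infinity> | Suc r \<Rightarrow> enat r)"

definition output_centers :: "nat \<Rightarrow> config \<Rightarrow> nat set" where
  "output_centers k c = mem (snd c) ` {..<k}"

text \<open>The polylogarithmic factor is a power of \<open>1 + log 2 n\<close>, so that it does not vanish at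
  \<open>n = 1\<close>.\<close>

definition soft_O :: "(nat \<Rightarrow> nat \<Rightarrow> real) \<Rightarrow> (nat \<Rightarrow> nat \<Rightarrow> nat) set" where
  "soft_O f = {T. \<exists>a b::nat. \<forall>n\<ge>1. \<forall>m.
     real (T n m) \<le> real a * f n m * (1 + log 2 (real n)) ^ b}"

text \<open>The word length is \<open>\<kappa>\<close> times the bit length of \<open>n\<close>; for \<open>\<kappa> \<ge> 2\<close> all input
  words and input addresses fit. The time bound holds for every outcome of the random choices.\<close>

definition solves_k_center_whp ::
  "instr list \<Rightarrow> nat \<Rightarrow> (nat \<Rightarrow> nat \<Rightarrow> nat) \<Rightarrow> real \<Rightarrow> nat \<Rightarrow> real \<Rightarrow> real \<Rightarrow> bool" where
  "solves_k_center_whp P \<kappa> T c k \<alpha> \<beta> \<longleftrightarrow>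
     (\<forall>n E es. simple_graph n E \<and> k \<le> n \<and> n \<le> card E + 1 \<and> edge_listing E es \<longrightarrow>
        (let D = run (\<kappa> * floorlog 2 n) (T n (card E)) (P, input_state n es) in
           (\<forall>cf\<in>set_pmf D. halted cf) \<and>
           measure_pmf.prob D
             {cf. k_center_approx \<alpha> \<beta> n E k (output_value cf) (output_centers k cf)}
             \<ge> 1 - 1 / real n powr c))"

end

theory Submission imports Defs begin

text \<open>
The program is deterministic. It computes all distances by breadth-first search and keeps, for every
vertex \<open>v\<close>, the row \<open>N v\<close> of its \<open>q\<close> nearest vertices, where \<open>q\<close> is about \<open>sqrt n\<close>. A greedy set \<open>S\<close> of
about \<open>(n / q) * ln n\<close> vertices hits all these rows; hence a vertex \<open>v\<close> at distance more than \<open>r\<close> from \<open>S\<close> has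
its whole ball of radius \<open>r\<close> inside \<open>N v\<close>.

Binary search guesses the optimal radius \<open>R\<close>. Let \<open>gap = R div (2 * k - 1)\<close>, and let \<open>target = 2 * R - gap\<close> be
the radius aimed at. Centers \<open>X 0, X 1, \<dots>\<close> are chosen one after the other. If the optimal centers that are still
needed all lie within \<open>R - gap\<close> of \<open>S\<close>, they may be replaced by elements of \<open>S\<close>. Otherwise let \<open>c\<close> be one that
does not, covering a vertex \<open>v\<close> at distance more than \<open>target\<close> from the \<open>i\<close> vertices chosen so far. The point at
distance \<open>2 * i * gap\<close> from \<open>c\<close> on the way to \<open>v\<close> is not covered by the optimal centers already approximated, and
it is still far from \<open>S\<close>. So the vertex \<open>w\<close> that is farthest from \<open>S\<close> among the vertices at distance more than
\<open>R + (2 * i - 1) * gap\<close> from the chosen ones is covered by a new optimal center \<open>c'\<close>, and \<open>N w\<close> contains a vertex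
within \<open>(2 * i + 1) * gap\<close> of \<open>c'\<close>. In both cases \<open>S \<union> N w\<close>, of size about \<open>sqrt n\<close>, contains a suitable next
choice.

The last center is found in time about \<open>n * sqrt n\<close>. If some uncovered \<open>w\<close> is at distance more than
\<open>reach = (R - gap) div 2\<close> from \<open>S\<close>, then \<open>N w\<close> contains a good choice. Otherwise each uncovered vertex has a
representative in \<open>S\<close> within \<open>reach\<close>, and it suffices to test, for all vertices \<open>u\<close>, whether \<open>u\<close> is within
\<open>R + reach\<close> of these representatives.
\<close>

section \<open>Computations of the word RAM\<close>

text \<open>Otherwise step counts would be rewritten from numerals to successor form.\<close>

declare One_nat_def [simp del]

lemma run_0: "run w 0 c = return_pmf c"
  by (simp add: run_def)

lemma run_Suc: "run w (Suc t) c = bind_pmf (run w t c) (step w)"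
  by (simp add: run_def)

lemma run_add: "run w (a + b) c = bind_pmf (run w a c) (run w b)"
proof (induction b)
  case 0
  then show ?case by (simp add: run_0 bind_return_pmf')
next
  case (Suc b)
  have "run w (Suc b) = (\<lambda>c. bind_pmf (run w b c) (step w))"
    by (rule ext) (rule run_Suc)
  then show ?case
    using Suc by (simp add: run_Suc bind_assoc_pmf)
qed

lemma run_halted: "run w t ([], s) = return_pmf ([], s)"
  by (induction t) (simp_all add: run_0 run_Suc bind_return_pmf)

lemma set_reg_simps [simp]: "reg (set_reg x a s) = (reg s)(x := a)" "mem (set_reg x a s) = mem s"
  by (simp_all add: set_reg_def)

lemma set_mem_simps [simp]: "reg (set_mem i a s) = reg s" "mem (set_mem i a s) = (mem s)(i := a)"
  by (simp_all add: set_mem_def)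

definition reaches :: "nat \<Rightarrow> nat \<Rightarrow> config \<Rightarrow> config \<Rightarrow> bool" where
  "reaches w t c c' \<longleftrightarrow> run w t c = return_pmf c'"

lemma reaches_refl: "reaches w 0 c c"
  by (simp add: reaches_def run_0)

lemma reaches_step: "step w c = return_pmf c' \<Longrightarrow> reaches w 1 c c'"
  by (simp add: One_nat_def reaches_def run_Suc run_0 bind_return_pmf)

lemma reaches_trans: "reaches w a c c' \<Longrightarrow> reaches w b c' c'' \<Longrightarrow> reaches w (a + b) c c''"
  by (simp add: reaches_def run_add bind_return_pmf)

lemma run_reaches_halted:
  assumes "reaches w t c ([], s)" "t \<le> T"
  shows "run w T c = return_pmf ([], s)"
proof -
  have "run w (t + (T - t)) c = return_pmf ([], s)"
    using assms(1) by (simp only: run_add reaches_def bind_return_pmf run_halted)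
  then show ?thesis using assms(2) by simp
qed

section \<open>A while language with arrays\<close>

datatype ('v, 'a) expr =
    Lit nat
  | Var 'v
  | Len 'a
  | Elem 'a "('v, 'a) expr"  ("_\<langle>_\<rangle>" [1000, 0] 900)
  | Opr binop "('v, 'a) expr" "('v, 'a) expr"

datatype ('v, 'a) cmd =
    Skip
  | Assign 'v "('v, 'a) expr"  ("_ ::= _" [999, 61] 61)
  | Update 'a "('v, 'a) expr" "('v, 'a) expr"  ("_\<langle>_\<rangle> ::= _" [1000, 0, 61] 61)
  | Seq "('v, 'a) cmd" "('v, 'a) cmd"  (infixr ";;" 60)
  | Branch "('v, 'a) expr" "('v, 'a) cmd" "('v, 'a) cmd"  ("IF _ THEN _ ELSE _" [0, 61, 61] 61)
  | Loop "('v, 'a) expr" "('v, 'a) cmd"  ("WHILE _ DO _" [0, 61] 61)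

abbreviation add_expr (infixl "\<oplus>" 65) where "a \<oplus> b \<equiv> Opr OpAdd a b"
abbreviation sub_expr (infixl "\<ominus>" 65) where "a \<ominus> b \<equiv> Opr OpSub a b"
abbreviation mul_expr (infixl "\<otimes>" 70) where "a \<otimes> b \<equiv> Opr OpMul a b"
abbreviation div_expr (infixl "\<oslash>" 70) where "a \<oslash> b \<equiv> Opr OpDiv a b"
abbreviation less_expr (infix "\<lessdot>" 50) where "a \<lessdot> b \<equiv> Opr OpLess a b"
abbreviation eq_expr (infix "\<doteq>" 50) where "a \<doteq> b \<equiv> Opr OpEq a b"

definition For :: "'v \<Rightarrow> ('v, 'a) expr \<Rightarrow> ('v, 'a) cmd \<Rightarrow> ('v, 'a) cmd"  ("FOR _ < _ DO _" [999, 51, 61] 61) where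
  "FOR x < h DO c = x ::= Lit 0 ;; WHILE Var x \<lessdot> h DO (c ;; x ::= Var x \<oplus> Lit 1)"

definition Check :: "'v \<Rightarrow> 'v \<Rightarrow> ('v, 'a) expr \<Rightarrow> ('v, 'a) expr \<Rightarrow> ('v, 'a) cmd"
    ("_ ::= NONE _ < _ WITH _" [999, 999, 51, 61] 61) where
  "y ::= NONE x < h WITH e = y ::= Lit 1 ;; FOR x < h DO (IF e THEN y ::= Lit 0 ELSE Skip)"

subsection \<open>Compilation\<close>

text \<open>Registers \<open>0\<close> and \<open>1\<close> are kept free for the input and the output.\<close>

definition var_reg :: "'v :: countable \<Rightarrow> nat" where "var_reg x = 4 * to_nat x + 2"
definition base_reg :: "'a :: countable \<Rightarrow> nat" where "base_reg A = 4 * to_nat A + 3"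
definition len_reg :: "'a :: countable \<Rightarrow> nat" where "len_reg A = 4 * to_nat A + 4"
definition tmp_reg :: "nat \<Rightarrow> nat" where "tmp_reg i = 4 * i + 5"

lemmas reg_defs = var_reg_def base_reg_def len_reg_def tmp_reg_def

lemma reg_eq_iff [simp]:
  "var_reg x = var_reg y \<longleftrightarrow> x = y" "base_reg A = base_reg B \<longleftrightarrow> A = B"
  "len_reg A = len_reg B \<longleftrightarrow> A = B" "tmp_reg i = tmp_reg j \<longleftrightarrow> i = j"
  by (auto simp: reg_defs)

lemma reg_neq [simp]:
  "var_reg x \<noteq> base_reg A" "var_reg x \<noteq> len_reg A" "var_reg x \<noteq> tmp_reg i"
  "base_reg A \<noteq> var_reg x" "base_reg A \<noteq> len_reg B" "base_reg A \<noteq> tmp_reg i"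
  "len_reg A \<noteq> var_reg x" "len_reg A \<noteq> base_reg B" "len_reg A \<noteq> tmp_reg i"
  "tmp_reg i \<noteq> var_reg x" "tmp_reg i \<noteq> base_reg A" "tmp_reg i \<noteq> len_reg A"
  unfolding reg_defs by presburger+

fun compile_expr :: "('v :: countable, 'a :: countable) expr \<Rightarrow> nat \<Rightarrow> instr list" where
  "compile_expr (Lit a) i = [Const (tmp_reg i) a]"
| "compile_expr (Var x) i = [Move (tmp_reg i) (var_reg x)]"
| "compile_expr (Len A) i = [Move (tmp_reg i) (len_reg A)]"
| "compile_expr (A\<langle>e\<rangle>) i =
     compile_expr e i @ [Bin OpAdd (tmp_reg i) (base_reg A) (tmp_reg i), Load (tmp_reg i) (tmp_reg i)]"
| "compile_expr (Opr f a b) i =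
     compile_expr a i @ compile_expr b (Suc i) @ [Bin f (tmp_reg i) (tmp_reg i) (tmp_reg (Suc i))]"

fun compile :: "('v :: countable, 'a :: countable) cmd \<Rightarrow> instr list" where
  "compile Skip = []"
| "compile (x ::= e) = compile_expr e 0 @ [Move (var_reg x) (tmp_reg 0)]"
| "compile (A\<langle>a\<rangle> ::= e) = compile_expr a 0 @ compile_expr e 1 @
     [Bin OpAdd (tmp_reg 0) (base_reg A) (tmp_reg 0), Store (tmp_reg 0) (tmp_reg 1)]"
| "compile (c ;; c') = compile c @ compile c'"
| "compile (IF e THEN c ELSE c') = compile_expr e 0 @ [Cond (tmp_reg 0) (compile c) (compile c')]"
| "compile (WHILE e DO c) = compile_expr e 0 @ [While (tmp_reg 0) (compile c @ compile_expr e 0)]"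

subsection \<open>Semantics with running times\<close>

fun cost :: "('v, 'a) expr \<Rightarrow> nat" where
  "cost (Lit a) = 1"
| "cost (Var x) = 1"
| "cost (Len A) = 1"
| "cost (A\<langle>e\<rangle>) = cost e + 2"
| "cost (Opr f a b) = cost a + cost b + 1"

text \<open>On \<open>nat\<close>, subtraction is truncated; \<open>no_overflow\<close> demands that this makes no difference.\<close>

fun apply_op :: "binop \<Rightarrow> nat \<Rightarrow> nat \<Rightarrow> nat" where
  "apply_op OpAdd a b = a + b"
| "apply_op OpSub a b = a - b"
| "apply_op OpMul a b = a * b"
| "apply_op OpDiv a b = a div b"
| "apply_op OpMod a b = a mod b"
| "apply_op OpLess a b = of_bool (a < b)"
| "apply_op OpEq a b = of_bool (a = b)"

fun no_overflow :: "nat \<Rightarrow> binop \<Rightarrow> nat \<Rightarrow> nat \<Rightarrow> bool" where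
  "no_overflow w OpAdd a b \<longleftrightarrow> a + b < 2 ^ w"
| "no_overflow w OpSub a b \<longleftrightarrow> b \<le> a \<and> a < 2 ^ w"
| "no_overflow w OpMul a b \<longleftrightarrow> a * b < 2 ^ w"
| "no_overflow w _ a b \<longleftrightarrow> True"

lemma eval_op_no_overflow:
  assumes "no_overflow w f a b"
  shows "eval_op w f a b = apply_op f a b"
proof (cases f)
  case OpSub
  then have "b \<le> a" "a < 2 ^ w" using assms by auto
  then have "int (a - b) < int (2 ^ w)" by (simp only: of_nat_less_iff)
  then have "int (a - b) mod 2 ^ w = int (a - b)" by (intro mod_pos_pos_trivial) auto
  then show ?thesis using \<open>b \<le> a\<close> by (simp only: OpSub eval_op.simps apply_op.simps of_nat_diff[symmetric] nat_int)
qed (use assms in simp_all)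

type_synonym 'v store = "'v \<Rightarrow> nat"
type_synonym 'a arrays = "'a \<Rightarrow> nat \<Rightarrow> nat"

fun val :: "('a \<Rightarrow> nat) \<Rightarrow> ('v, 'a) expr \<Rightarrow> 'v store \<Rightarrow> 'a arrays \<Rightarrow> nat" where
  "val len (Lit a) \<sigma> \<mu> = a"
| "val len (Var x) \<sigma> \<mu> = \<sigma> x"
| "val len (Len A) \<sigma> \<mu> = len A"
| "val len (A\<langle>e\<rangle>) \<sigma> \<mu> = \<mu> A (val len e \<sigma> \<mu>)"
| "val len (Opr f a b) \<sigma> \<mu> = apply_op f (val len a \<sigma> \<mu>) (val len b \<sigma> \<mu>)"

fun safe :: "nat \<Rightarrow> ('a \<Rightarrow> nat) \<Rightarrow> ('v, 'a) expr \<Rightarrow> 'v store \<Rightarrow> 'a arrays \<Rightarrow> bool" where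
  "safe w len (Lit a) \<sigma> \<mu> \<longleftrightarrow> a < 2 ^ w"
| "safe w len (Var x) \<sigma> \<mu> \<longleftrightarrow> True"
| "safe w len (Len A) \<sigma> \<mu> \<longleftrightarrow> True"
| "safe w len (A\<langle>e\<rangle>) \<sigma> \<mu> \<longleftrightarrow> safe w len e \<sigma> \<mu> \<and> val len e \<sigma> \<mu> < len A"
| "safe w len (Opr f a b) \<sigma> \<mu> \<longleftrightarrow> safe w len a \<sigma> \<mu> \<and> safe w len b \<sigma> \<mu> \<and>
     no_overflow w f (val len a \<sigma> \<mu>) (val len b \<sigma> \<mu>)"

fun writes :: "('v, 'a) cmd \<Rightarrow> 'v set" where
  "writes Skip = {}"
| "writes (x ::= e) = {x}"
| "writes (A\<langle>a\<rangle> ::= e) = {}"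
| "writes (c ;; c') = writes c \<union> writes c'"
| "writes (IF e THEN c ELSE c') = writes c \<union> writes c'"
| "writes (WHILE e DO c) = writes c"

fun stores :: "('v, 'a) cmd \<Rightarrow> 'a set" where
  "stores Skip = {}"
| "stores (x ::= e) = {}"
| "stores (A\<langle>a\<rangle> ::= e) = {A}"
| "stores (c ;; c') = stores c \<union> stores c'"
| "stores (IF e THEN c ELSE c') = stores c \<union> stores c'"
| "stores (WHILE e DO c) = stores c"

lemma writes_For [simp]: "writes (FOR x < h DO c) = insert x (writes c)"
  by (auto simp: For_def)

lemma stores_For [simp]: "stores (FOR x < h DO c) = stores c"
  by (simp add: For_def)

lemma writes_Check [simp]: "writes (y ::= NONE x < h WITH e) = {x, y}"
  by (auto simp: Check_def)

lemma stores_Check [simp]: "stores (y ::= NONE x < h WITH e) = {}"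
  by (simp add: Check_def)

inductive exec :: "nat \<Rightarrow> ('a \<Rightarrow> nat) \<Rightarrow> ('v, 'a) cmd \<Rightarrow> 'v store \<Rightarrow> 'a arrays \<Rightarrow> nat \<Rightarrow>
    'v store \<Rightarrow> 'a arrays \<Rightarrow> bool" for w len where
  Skip: "exec w len Skip \<sigma> \<mu> 0 \<sigma> \<mu>"
| Assign: "safe w len e \<sigma> \<mu> \<Longrightarrow> exec w len (x ::= e) \<sigma> \<mu> (cost e + 1) (\<sigma>(x := val len e \<sigma> \<mu>)) \<mu>"
| Update: "safe w len a \<sigma> \<mu> \<Longrightarrow> safe w len e \<sigma> \<mu> \<Longrightarrow> val len a \<sigma> \<mu> < len A \<Longrightarrow>
    exec w len (A\<langle>a\<rangle> ::= e) \<sigma> \<mu> (cost a + cost e + 2) \<sigma> (\<mu>(A := (\<mu> A)(val len a \<sigma> \<mu> := val len e \<sigma> \<mu>)))"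
| Seq: "exec w len c \<sigma> \<mu> t \<sigma>' \<mu>' \<Longrightarrow> exec w len c' \<sigma>' \<mu>' t' \<sigma>'' \<mu>'' \<Longrightarrow>
    exec w len (c ;; c') \<sigma> \<mu> (t + t') \<sigma>'' \<mu>''"
| Branch: "safe w len e \<sigma> \<mu> \<Longrightarrow> exec w len (if val len e \<sigma> \<mu> \<noteq> 0 then c else c') \<sigma> \<mu> t \<sigma>' \<mu>' \<Longrightarrow>
    exec w len (IF e THEN c ELSE c') \<sigma> \<mu> (cost e + 1 + t) \<sigma>' \<mu>'"
| Loop_exit: "safe w len e \<sigma> \<mu> \<Longrightarrow> val len e \<sigma> \<mu> = 0 \<Longrightarrow> exec w len (WHILE e DO c) \<sigma> \<mu> (cost e + 1) \<sigma> \<mu>"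
| Loop_step: "safe w len e \<sigma> \<mu> \<Longrightarrow> val len e \<sigma> \<mu> \<noteq> 0 \<Longrightarrow> exec w len c \<sigma> \<mu> t \<sigma>' \<mu>' \<Longrightarrow>
    exec w len (WHILE e DO c) \<sigma>' \<mu>' t' \<sigma>'' \<mu>'' \<Longrightarrow>
    exec w len (WHILE e DO c) \<sigma> \<mu> (cost e + 1 + (t + t')) \<sigma>'' \<mu>''"

lemma exec_frame:
  assumes "exec w len c \<sigma> \<mu> t \<sigma>' \<mu>'"
  shows "(\<forall>x. x \<notin> writes c \<longrightarrow> \<sigma>' x = \<sigma> x) \<and> (\<forall>A. A \<notin> stores c \<longrightarrow> \<mu>' A = \<mu> A)"
  using assms by (induction rule: exec.induct) (auto split: if_splits)

subsection \<open>Correctness of the compiler\<close>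

locale array_layout =
  fixes w :: nat and base len :: "'a :: countable \<Rightarrow> nat"
  assumes base_inj: "i < len A \<Longrightarrow> j < len B \<Longrightarrow> base A + i = base B + j \<Longrightarrow> A = B"
    and base_less: "i < len A \<Longrightarrow> base A + i < 2 ^ w"
begin

definition represents :: "ram_state \<Rightarrow> ('v :: countable) store \<Rightarrow> 'a arrays \<Rightarrow> bool" where
  "represents s \<sigma> \<mu> \<longleftrightarrow> (\<forall>x. reg s (var_reg x) = \<sigma> x) \<and>
     (\<forall>A. reg s (base_reg A) = base A \<and> reg s (len_reg A) = len A) \<and>
     (\<forall>A. \<forall>i<len A. mem s (base A + i) = \<mu> A i)"

lemma represents_set_tmp: "represents s \<sigma> \<mu> \<Longrightarrow> represents (set_reg (tmp_reg i) a s) \<sigma> \<mu>"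
  by (simp add: represents_def)

lemma represents_set_var: "represents s \<sigma> \<mu> \<Longrightarrow> represents (set_reg (var_reg x) a s) (\<sigma>(x := a)) \<mu>"
  by (simp add: represents_def)

lemma represents_set_mem:
  assumes "represents s \<sigma> \<mu>" "i < len A"
  shows "represents (set_mem (base A + i) a s) \<sigma> (\<mu>(A := (\<mu> A)(i := a)))"
proof -
  have "base B + j \<noteq> base A + i" if "j < len B" "B \<noteq> A" for B j
    using base_inj[OF that(1) assms(2)] that(2) by blast
  then show ?thesis using assms by (auto simp: represents_def)
qed

text \<open>Temporary registers below \<open>i\<close> hold intermediate results.\<close>

definition evaluates :: "ram_state \<Rightarrow> ('v :: countable) store \<Rightarrow> 'a arrays \<Rightarrow> ('v, 'a) expr \<Rightarrow> nat \<Rightarrow> bool" where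
  "evaluates s \<sigma> \<mu> e i \<longleftrightarrow> (\<forall>K. \<exists>s'. represents s' \<sigma> \<mu> \<and> reg s' (tmp_reg i) = val len e \<sigma> \<mu> \<and>
     (\<forall>j<i. reg s' (tmp_reg j) = reg s (tmp_reg j)) \<and> reaches w (cost e) (compile_expr e i @ K, s) (K, s'))"

lemma evaluatesE:
  assumes "evaluates s \<sigma> \<mu> e i"
  obtains s' where "represents s' \<sigma> \<mu>" "reg s' (tmp_reg i) = val len e \<sigma> \<mu>"
    "\<forall>j<i. reg s' (tmp_reg j) = reg s (tmp_reg j)" "reaches w (cost e) (compile_expr e i @ K, s) (K, s')"
  using assms unfolding evaluates_def by blast

lemma evaluates_atomic:
  assumes "represents s \<sigma> \<mu>" "cost e = 1"
    and "\<And>K. step w (compile_expr e i @ K, s) = return_pmf (K, set_reg (tmp_reg i) (val len e \<sigma> \<mu>) s)"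
  shows "evaluates s \<sigma> \<mu> e i"
  unfolding evaluates_def
proof
  fix K
  let ?s = "set_reg (tmp_reg i) (val len e \<sigma> \<mu>) s"
  have "reaches w (cost e) (compile_expr e i @ K, s) (K, ?s)"
    unfolding assms(2) by (rule reaches_step[OF assms(3)])
  then show "\<exists>s'. represents s' \<sigma> \<mu> \<and> reg s' (tmp_reg i) = val len e \<sigma> \<mu> \<and>
      (\<forall>j<i. reg s' (tmp_reg j) = reg s (tmp_reg j)) \<and> reaches w (cost e) (compile_expr e i @ K, s) (K, s')"
    using represents_set_tmp[OF assms(1)] by (intro exI[of _ ?s]) simp
qed

lemma evaluates_Elem:
  assumes "evaluates s \<sigma> \<mu> e i" "val len e \<sigma> \<mu> < len A"
  shows "evaluates s \<sigma> \<mu> (A\<langle>e\<rangle>) i"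
  unfolding evaluates_def
proof
  fix K
  let ?a = "val len e \<sigma> \<mu>" and ?r = "tmp_reg i"
  let ?Load = "Load ?r ?r # K"
  let ?K = "Bin OpAdd ?r (base_reg A) ?r # ?Load"
  obtain s1 where s1: "represents s1 \<sigma> \<mu>" "reg s1 ?r = ?a" "\<forall>j<i. reg s1 (tmp_reg j) = reg s (tmp_reg j)"
    and reaches_index: "reaches w (cost e) (compile_expr e i @ ?K, s) (?K, s1)"
    using assms(1) by (rule evaluatesE)
  define s2 where "s2 = set_reg ?r (base A + ?a) s1"
  define s3 where "s3 = set_reg ?r (\<mu> A ?a) s2"
  have s2: "represents s2 \<sigma> \<mu>" "reg s2 ?r = base A + ?a"
    using represents_set_tmp[OF s1(1)] by (simp_all add: s2_def)
  have "reaches w 1 (?K, s1) (?Load, s2)"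
    using s1(1,2) base_less[OF assms(2)] by (intro reaches_step) (simp add: s2_def represents_def)
  moreover have "reaches w 1 (?Load, s2) (K, s3)"
    using s2 assms(2) by (intro reaches_step) (simp add: s3_def represents_def)
  ultimately have "reaches w (cost e + (1 + 1)) (compile_expr e i @ ?K, s) (K, s3)"
    using reaches_index by (blast intro: reaches_trans)
  then show "\<exists>s'. represents s' \<sigma> \<mu> \<and> reg s' ?r = val len (A\<langle>e\<rangle>) \<sigma> \<mu> \<and>
      (\<forall>j<i. reg s' (tmp_reg j) = reg s (tmp_reg j)) \<and> reaches w (cost (A\<langle>e\<rangle>)) (compile_expr (A\<langle>e\<rangle>) i @ K, s) (K, s')"
    using s1(3) represents_set_tmp[OF s2(1)] by (intro exI[of _ s3]) (simp add: s2_def s3_def)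
qed

lemma evaluates_Opr:
  assumes "evaluates s \<sigma> \<mu> a i" "\<And>s'. represents s' \<sigma> \<mu> \<Longrightarrow> evaluates s' \<sigma> \<mu> b (Suc i)"
    and "no_overflow w f (val len a \<sigma> \<mu>) (val len b \<sigma> \<mu>)"
  shows "evaluates s \<sigma> \<mu> (Opr f a b) i"
  unfolding evaluates_def
proof
  fix K
  let ?va = "val len a \<sigma> \<mu>" and ?vb = "val len b \<sigma> \<mu>"
  let ?K = "Bin f (tmp_reg i) (tmp_reg i) (tmp_reg (Suc i)) # K"
  obtain s1 where s1: "represents s1 \<sigma> \<mu>" "reg s1 (tmp_reg i) = ?va" "\<forall>j<i. reg s1 (tmp_reg j) = reg s (tmp_reg j)"
    and reaches_a: "reaches w (cost a) (compile_expr a i @ compile_expr b (Suc i) @ ?K, s) (compile_expr b (Suc i) @ ?K, s1)"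
    using assms(1) by (rule evaluatesE)
  obtain s2 where s2: "represents s2 \<sigma> \<mu>" "reg s2 (tmp_reg (Suc i)) = ?vb"
      "\<forall>j<Suc i. reg s2 (tmp_reg j) = reg s1 (tmp_reg j)"
    and reaches_b: "reaches w (cost b) (compile_expr b (Suc i) @ ?K, s1) (?K, s2)"
    using assms(2)[OF s1(1)] by (rule evaluatesE)
  define s3 where "s3 = set_reg (tmp_reg i) (apply_op f ?va ?vb) s2"
  have "reaches w 1 (?K, s2) (K, s3)"
    using s1(2) s2(2,3) eval_op_no_overflow[OF assms(3)] by (intro reaches_step) (simp add: s3_def)
  then have "reaches w (cost a + (cost b + 1)) (compile_expr a i @ compile_expr b (Suc i) @ ?K, s) (K, s3)"
    using reaches_a reaches_b by (blast intro: reaches_trans)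
  then show "\<exists>s'. represents s' \<sigma> \<mu> \<and> reg s' (tmp_reg i) = val len (Opr f a b) \<sigma> \<mu> \<and>
      (\<forall>j<i. reg s' (tmp_reg j) = reg s (tmp_reg j)) \<and> reaches w (cost (Opr f a b)) (compile_expr (Opr f a b) i @ K, s) (K, s')"
    using s1(3) s2(3) represents_set_tmp[OF s2(1)] by (intro exI[of _ s3]) (simp add: s3_def add.assoc)
qed

lemma evaluates_compile_expr: "represents s \<sigma> \<mu> \<Longrightarrow> safe w len e \<sigma> \<mu> \<Longrightarrow> evaluates s \<sigma> \<mu> e i"
proof (induction e arbitrary: s i)
  case (Elem A e)
  then show ?case by (intro evaluates_Elem) simp_all
next
  case (Opr f a b)
  then show ?case by (intro evaluates_Opr) simp_all
qed (auto simp: represents_def intro!: evaluates_atomic)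

lemma reaches_compile_expr:
  assumes "represents s \<sigma> \<mu>" "safe w len e \<sigma> \<mu>"
  obtains s' where "represents s' \<sigma> \<mu>" "reg s' (tmp_reg i) = val len e \<sigma> \<mu>"
    "\<forall>j<i. reg s' (tmp_reg j) = reg s (tmp_reg j)" "reaches w (cost e) (compile_expr e i @ K, s) (K, s')"
  using evaluates_compile_expr[OF assms] by (rule evaluatesE)

lemma reaches_compile_branch:
  assumes "represents s \<sigma> \<mu>" "safe w len e \<sigma> \<mu>"
    and "\<And>s'. reg s' (tmp_reg 0) = val len e \<sigma> \<mu> \<Longrightarrow> step w (I # K, s') = return_pmf (K', s')"
  shows "\<exists>s'. represents s' \<sigma> \<mu> \<and> reaches w (cost e + 1) (compile_expr e 0 @ I # K, s) (K', s')"
proof -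
  obtain s' where s': "represents s' \<sigma> \<mu>" "reg s' (tmp_reg 0) = val len e \<sigma> \<mu>"
      "reaches w (cost e) (compile_expr e 0 @ I # K, s) (I # K, s')"
    using reaches_compile_expr[OF assms(1,2), of 0 "I # K"] by blast
  have "reaches w 1 (I # K, s') (K', s')"
    by (rule reaches_step) (rule assms(3)[OF s'(2)])
  from reaches_trans[OF s'(3) this] show ?thesis using s'(1) by blast
qed

lemma reaches_compile_Assign:
  assumes "represents s \<sigma> \<mu>" "safe w len e \<sigma> \<mu>"
  shows "\<exists>s'. represents s' (\<sigma>(x := val len e \<sigma> \<mu>)) \<mu> \<and> reaches w (cost e + 1) (compile (x ::= e) @ K, s) (K, s')"
proof -
  let ?Move = "Move (var_reg x) (tmp_reg 0) # K"
  obtain s1 where s1: "represents s1 \<sigma> \<mu>" "reg s1 (tmp_reg 0) = val len e \<sigma> \<mu>"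
    and reaches_e: "reaches w (cost e) (compile_expr e 0 @ ?Move, s) (?Move, s1)"
    using reaches_compile_expr[OF assms, of 0 ?Move] by blast
  have "reaches w 1 (?Move, s1) (K, set_reg (var_reg x) (val len e \<sigma> \<mu>) s1)"
    using s1 by (intro reaches_step) simp
  from reaches_trans[OF reaches_e this] show ?thesis
    using represents_set_var[OF s1(1)] by (intro exI conjI) (assumption | simp)+
qed

lemma reaches_compile_Update:
  assumes "represents s \<sigma> \<mu>" "safe w len a \<sigma> \<mu>" "safe w len e \<sigma> \<mu>" "val len a \<sigma> \<mu> < len A"
  shows "\<exists>s'. represents s' \<sigma> (\<mu>(A := (\<mu> A)(val len a \<sigma> \<mu> := val len e \<sigma> \<mu>))) \<and>
    reaches w (cost a + cost e + 2) (compile (A\<langle>a\<rangle> ::= e) @ K, s) (K, s')"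
proof -
  let ?i = "val len a \<sigma> \<mu>" and ?x = "val len e \<sigma> \<mu>" and ?Store = "Store (tmp_reg 0) (tmp_reg 1) # K"
  let ?K = "Bin OpAdd (tmp_reg 0) (base_reg A) (tmp_reg 0) # ?Store"
  obtain s1 where s1: "represents s1 \<sigma> \<mu>" "reg s1 (tmp_reg 0) = ?i"
    and reaches_a: "reaches w (cost a) (compile_expr a 0 @ compile_expr e 1 @ ?K, s) (compile_expr e 1 @ ?K, s1)"
    using reaches_compile_expr[OF assms(1,2), of 0 "compile_expr e 1 @ ?K"] by blast
  obtain s2 where s2: "represents s2 \<sigma> \<mu>" "reg s2 (tmp_reg 1) = ?x" "reg s2 (tmp_reg 0) = ?i"
    and reaches_e: "reaches w (cost e) (compile_expr e 1 @ ?K, s1) (?K, s2)"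
    using reaches_compile_expr[OF s1(1) assms(3), of 1 ?K] s1(2) less_one by metis
  define s3 where "s3 = set_reg (tmp_reg 0) (base A + ?i) s2"
  have "represents s3 \<sigma> \<mu>" using represents_set_tmp[OF s2(1)] by (simp add: s3_def)
  then have final: "represents (set_mem (base A + ?i) ?x s3) \<sigma> (\<mu>(A := (\<mu> A)(?i := ?x)))"
    by (rule represents_set_mem) (rule assms(4))
  have reaches_address: "reaches w 1 (?K, s2) (?Store, s3)"
    using s2 base_less[OF assms(4)] by (intro reaches_step) (simp add: s3_def represents_def)
  have "reaches w 1 (?Store, s3) (K, set_mem (base A + ?i) ?x s3)"
    using s2 by (intro reaches_step) (simp add: s3_def)
  with reaches_address have "reaches w (1 + 1) (?K, s2) (K, set_mem (base A + ?i) ?x s3)"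
    by (rule reaches_trans)
  from reaches_trans[OF reaches_a reaches_trans[OF reaches_e this]] show ?thesis
    using final by (intro exI conjI) (simp_all add: add.assoc)
qed

theorem reaches_compile:
  assumes "exec w len c \<sigma> \<mu> t \<sigma>' \<mu>'" "represents s \<sigma> \<mu>"
  shows "\<exists>s'. represents s' \<sigma>' \<mu>' \<and> reaches w t (compile c @ K, s) (K, s')"
  using assms
proof (induction arbitrary: s K rule: exec.induct)
  case (Skip \<sigma> \<mu>)
  then show ?case by (auto intro: reaches_refl)
next
  case (Assign e \<sigma> \<mu> x)
  then show ?case by (intro reaches_compile_Assign)
next
  case (Update a \<sigma> \<mu> e A)
  then show ?case by (intro reaches_compile_Update)
next
  case (Seq c \<sigma> \<mu> t \<sigma>' \<mu>' c' t' \<sigma>'' \<mu>'')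
  obtain s1 where s1: "represents s1 \<sigma>' \<mu>'" "reaches w t (compile c @ compile c' @ K, s) (compile c' @ K, s1)"
    using Seq.IH(1)[OF Seq.prems] by blast
  obtain s2 where s2: "represents s2 \<sigma>'' \<mu>''" "reaches w t' (compile c' @ K, s1) (K, s2)"
    using Seq.IH(2)[OF s1(1)] by blast
  show ?case using reaches_trans[OF s1(2) s2(2)] s2(1) by auto
next
  case (Branch e \<sigma> \<mu> c c' t \<sigma>' \<mu>')
  let ?c = "if val len e \<sigma> \<mu> \<noteq> 0 then c else c'"
  obtain s1 where s1: "represents s1 \<sigma> \<mu>"
    and reaches_e: "reaches w (cost e + 1) (compile (IF e THEN c ELSE c') @ K, s) (compile ?c @ K, s1)"
    using reaches_compile_branch[OF Branch.prems Branch.hyps(1),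
        of "Cond (tmp_reg 0) (compile c) (compile c')" K "compile ?c @ K"] by force
  obtain s2 where s2: "represents s2 \<sigma>' \<mu>'" "reaches w t (compile ?c @ K, s1) (K, s2)"
    using Branch.IH[OF s1(1)] by blast
  show ?case using reaches_trans[OF reaches_e s2(2)] s2(1) by blast
next
  case (Loop_exit e \<sigma> \<mu> c)
  then show ?case using reaches_compile_branch[OF Loop_exit.prems Loop_exit.hyps(1),
        of "While (tmp_reg 0) (compile c @ compile_expr e 0)" K K] Loop_exit.hyps(2) by auto
next
  case (Loop_step e \<sigma> \<mu> c t \<sigma>' \<mu>' t' \<sigma>'' \<mu>'')
  let ?loop = "compile (WHILE e DO c) @ K"
  obtain s1 where s1: "represents s1 \<sigma> \<mu>" "reaches w (cost e + 1) (?loop, s) (compile c @ ?loop, s1)"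
    using reaches_compile_branch[OF Loop_step.prems Loop_step.hyps(1),
        of "While (tmp_reg 0) (compile c @ compile_expr e 0)" K "compile c @ ?loop"] Loop_step.hyps(2) by auto
  obtain s2 where s2: "represents s2 \<sigma>' \<mu>'" "reaches w t (compile c @ ?loop, s1) (?loop, s2)"
    using Loop_step.IH(1)[OF s1(1)] by blast
  obtain s3 where s3: "represents s3 \<sigma>'' \<mu>''" "reaches w t' (?loop, s2) (K, s3)"
    using Loop_step.IH(2)[OF s2(1)] by blast
  show ?case using reaches_trans[OF s1(2) reaches_trans[OF s2(2) s3(2)]] s3(1) by blast
qed

end

subsection \<open>A program logic with step budgets\<close>

text \<open>Passing the unused part of the budget \<open>T\<close> to the postcondition makes budgets compose along \<open>Seq\<close>.\<close>

definition wp :: "nat \<Rightarrow> ('a \<Rightarrow> nat) \<Rightarrow> ('v, 'a) cmd \<Rightarrow> (nat \<Rightarrow> 'v store \<Rightarrow> 'a arrays \<Rightarrow> bool) \<Rightarrow>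
    nat \<Rightarrow> 'v store \<Rightarrow> 'a arrays \<Rightarrow> bool" where
  "wp w len c Q T \<sigma> \<mu> \<longleftrightarrow> (\<exists>t \<sigma>' \<mu>'. exec w len c \<sigma> \<mu> t \<sigma>' \<mu>' \<and> t \<le> T \<and> Q (T - t) \<sigma>' \<mu>')"

lemma wpI: "exec w len c \<sigma> \<mu> t \<sigma>' \<mu>' \<Longrightarrow> t \<le> T \<Longrightarrow> Q (T - t) \<sigma>' \<mu>' \<Longrightarrow> wp w len c Q T \<sigma> \<mu>"
  unfolding wp_def by blast

lemma wp_Skip: "Q T \<sigma> \<mu> \<Longrightarrow> wp w len Skip Q T \<sigma> \<mu>"
  by (rule wpI[OF exec.Skip]) simp_all

lemma wp_Assign:
  assumes "safe w len e \<sigma> \<mu>" "cost e < T" "Q (T - (cost e + 1)) (\<sigma>(x := val len e \<sigma> \<mu>)) \<mu>"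
  shows "wp w len (x ::= e) Q T \<sigma> \<mu>"
  by (rule wpI[OF exec.Assign]) (use assms in simp_all)

lemma wp_Update:
  assumes "safe w len a \<sigma> \<mu>" "safe w len e \<sigma> \<mu>" "val len a \<sigma> \<mu> < len A" "cost a + cost e + 1 < T"
    and "Q (T - (cost a + cost e + 2)) \<sigma> (\<mu>(A := (\<mu> A)(val len a \<sigma> \<mu> := val len e \<sigma> \<mu>)))"
  shows "wp w len (A\<langle>a\<rangle> ::= e) Q T \<sigma> \<mu>"
  by (rule wpI[OF exec.Update]) (use assms in simp_all)

lemma wp_Seq:
  assumes "wp w len c (wp w len c' Q) T \<sigma> \<mu>"
  shows "wp w len (c ;; c') Q T \<sigma> \<mu>"
proof -
  obtain t \<sigma>' \<mu>' where first: "exec w len c \<sigma> \<mu> t \<sigma>' \<mu>'" "t \<le> T" and "wp w len c' Q (T - t) \<sigma>' \<mu>'"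
    using assms unfolding wp_def[of w len c] by blast
  then obtain t' \<sigma>'' \<mu>'' where second: "exec w len c' \<sigma>' \<mu>' t' \<sigma>'' \<mu>''" "t' \<le> T - t" "Q (T - t - t') \<sigma>'' \<mu>''"
    unfolding wp_def by blast
  show ?thesis
    using first(2) second(2,3) by (intro wpI[OF exec.Seq[OF first(1) second(1)]]) simp_all
qed

lemma wp_Branch:
  assumes "safe w len e \<sigma> \<mu>" "cost e < T"
    and "val len e \<sigma> \<mu> \<noteq> 0 \<Longrightarrow> wp w len c Q (T - (cost e + 1)) \<sigma> \<mu>"
    and "val len e \<sigma> \<mu> = 0 \<Longrightarrow> wp w len c' Q (T - (cost e + 1)) \<sigma> \<mu>"
  shows "wp w len (IF e THEN c ELSE c') Q T \<sigma> \<mu>"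
proof -
  have "wp w len (if val len e \<sigma> \<mu> \<noteq> 0 then c else c') Q (T - (cost e + 1)) \<sigma> \<mu>"
    using assms(3,4) by simp
  then obtain t \<sigma>' \<mu>' where t: "exec w len (if val len e \<sigma> \<mu> \<noteq> 0 then c else c') \<sigma> \<mu> t \<sigma>' \<mu>'"
      "t \<le> T - (cost e + 1)" "Q (T - (cost e + 1) - t) \<sigma>' \<mu>'"
    unfolding wp_def by blast
  show ?thesis
    by (rule wpI[OF exec.Branch[OF assms(1) t(1)]]) (use t(2,3) assms(2) in simp_all)
qed

lemma wp_call:
  assumes "wp w len c (\<lambda>_. Q) C \<sigma> \<mu>" "C \<le> T"
    and "\<And>t \<sigma>' \<mu>'. T - C \<le> t \<Longrightarrow> (\<And>x. x \<notin> writes c \<Longrightarrow> \<sigma>' x = \<sigma> x) \<Longrightarrow>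
      (\<And>A. A \<notin> stores c \<Longrightarrow> \<mu>' A = \<mu> A) \<Longrightarrow> Q \<sigma>' \<mu>' \<Longrightarrow> Q' t \<sigma>' \<mu>'"
  shows "wp w len c Q' T \<sigma> \<mu>"
proof -
  obtain t \<sigma>' \<mu>' where t: "exec w len c \<sigma> \<mu> t \<sigma>' \<mu>'" "t \<le> C" "Q \<sigma>' \<mu>'"
    using assms(1) unfolding wp_def by blast
  have "Q' (T - t) \<sigma>' \<mu>'"
    using t assms(2) exec_frame[OF t(1)] by (intro assms(3)) auto
  then show ?thesis using t(1,2) assms(2) by (intro wpI[OF t(1)]) simp_all
qed

lemma wp_Loop:
  assumes "I \<sigma> \<mu>" "\<Phi> \<sigma> \<mu> + cost e < T"
    and test: "\<And>\<sigma>' \<mu>'. (\<And>x. x \<notin> writes c \<Longrightarrow> \<sigma>' x = \<sigma> x) \<Longrightarrow> (\<And>A. A \<notin> stores c \<Longrightarrow> \<mu>' A = \<mu> A) \<Longrightarrow>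
      I \<sigma>' \<mu>' \<Longrightarrow> safe w len e \<sigma>' \<mu>'"
    and body: "\<And>\<sigma>' \<mu>'. (\<And>x. x \<notin> writes c \<Longrightarrow> \<sigma>' x = \<sigma> x) \<Longrightarrow> (\<And>A. A \<notin> stores c \<Longrightarrow> \<mu>' A = \<mu> A) \<Longrightarrow>
      I \<sigma>' \<mu>' \<Longrightarrow> val len e \<sigma>' \<mu>' \<noteq> 0 \<Longrightarrow>
      cost e < \<Phi> \<sigma>' \<mu>' \<and> wp w len c (\<lambda>t \<sigma>'' \<mu>''. I \<sigma>'' \<mu>'' \<and> \<Phi> \<sigma>'' \<mu>'' \<le> t) (\<Phi> \<sigma>' \<mu>' - (cost e + 1)) \<sigma>' \<mu>'"
    and exit: "\<And>\<sigma>' \<mu>'. (\<And>x. x \<notin> writes c \<Longrightarrow> \<sigma>' x = \<sigma> x) \<Longrightarrow> (\<And>A. A \<notin> stores c \<Longrightarrow> \<mu>' A = \<mu> A) \<Longrightarrow>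
      I \<sigma>' \<mu>' \<Longrightarrow> val len e \<sigma>' \<mu>' = 0 \<Longrightarrow> Q \<sigma>' \<mu>'"
  shows "wp w len (WHILE e DO c) (\<lambda>_. Q) T \<sigma> \<mu>"
proof -
  have "\<exists>t \<sigma>'' \<mu>''. exec w len (WHILE e DO c) \<sigma>' \<mu>' t \<sigma>'' \<mu>'' \<and> t \<le> \<Phi> \<sigma>' \<mu>' + (cost e + 1) \<and> Q \<sigma>'' \<mu>''"
    if "\<forall>x. x \<notin> writes c \<longrightarrow> \<sigma>' x = \<sigma> x" "\<forall>A. A \<notin> stores c \<longrightarrow> \<mu>' A = \<mu> A" "I \<sigma>' \<mu>'" for \<sigma>' \<mu>'
    using that
  proof (induction "\<Phi> \<sigma>' \<mu>'" arbitrary: \<sigma>' \<mu>' rule: less_induct)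
    case less
    have safe: "safe w len e \<sigma>' \<mu>'" using less.prems test by blast
    show ?case
    proof (cases "val len e \<sigma>' \<mu>' = 0")
      case True
      then have "Q \<sigma>' \<mu>'" using less.prems exit by blast
      with exec.Loop_exit[OF safe True] show ?thesis by fastforce
    next
      case False
      then have "cost e < \<Phi> \<sigma>' \<mu>'"
        and "wp w len c (\<lambda>t \<sigma>'' \<mu>''. I \<sigma>'' \<mu>'' \<and> \<Phi> \<sigma>'' \<mu>'' \<le> t) (\<Phi> \<sigma>' \<mu>' - (cost e + 1)) \<sigma>' \<mu>'"
        using less.prems body by blast+
      then obtain t \<sigma>1 \<mu>1 where once: "exec w len c \<sigma>' \<mu>' t \<sigma>1 \<mu>1" "I \<sigma>1 \<mu>1" "\<Phi> \<sigma>1 \<mu>1 + (t + (cost e + 1)) \<le> \<Phi> \<sigma>' \<mu>'"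
        unfolding wp_def by auto
      have "\<forall>x. x \<notin> writes c \<longrightarrow> \<sigma>1 x = \<sigma> x" "\<forall>A. A \<notin> stores c \<longrightarrow> \<mu>1 A = \<mu> A"
        using exec_frame[OF once(1)] less.prems by auto
      then obtain t' \<sigma>2 \<mu>2 where loop: "exec w len (WHILE e DO c) \<sigma>1 \<mu>1 t' \<sigma>2 \<mu>2"
          "t' \<le> \<Phi> \<sigma>1 \<mu>1 + (cost e + 1)" "Q \<sigma>2 \<mu>2"
        using less.hyps[of \<sigma>1 \<mu>1] once(2,3) by fastforce
      have "cost e + 1 + (t + t') \<le> \<Phi> \<sigma>' \<mu>' + (cost e + 1)" using once(3) loop(2) by linarith
      with exec.Loop_step[OF safe False once(1) loop(1)] loop(3) show ?thesis by blast
    qed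
  qed
  from this[of \<sigma> \<mu>] assms(1) obtain t \<sigma>' \<mu>' where "exec w len (WHILE e DO c) \<sigma> \<mu> t \<sigma>' \<mu>'"
      "t \<le> \<Phi> \<sigma> \<mu> + (cost e + 1)" "Q \<sigma>' \<mu>'" by blast
  moreover from this(2) have "t \<le> T" using assms(2) by linarith
  ultimately show ?thesis by (intro wpI)
qed

lemma wp_For:
  assumes bound: "\<And>\<sigma>' \<mu>'. (\<And>y. y \<noteq> x \<Longrightarrow> y \<notin> writes c \<Longrightarrow> \<sigma>' y = \<sigma> y) \<Longrightarrow>
      safe w len h \<sigma>' \<mu>' \<and> val len h \<sigma>' \<mu>' = N"
    and "N < 2 ^ w" "x \<notin> writes c"
    and stable: "\<And>j \<sigma>' \<mu>' a. I j \<sigma>' \<mu>' \<Longrightarrow> I j (\<sigma>'(x := a)) \<mu>'"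
    and init: "I 0 \<sigma> \<mu>"
    and body: "\<And>j \<sigma>' \<mu>'. j < N \<Longrightarrow> \<sigma>' x = j \<Longrightarrow> (\<And>y. y \<noteq> x \<Longrightarrow> y \<notin> writes c \<Longrightarrow> \<sigma>' y = \<sigma> y) \<Longrightarrow>
      (\<And>A. A \<notin> stores c \<Longrightarrow> \<mu>' A = \<mu> A) \<Longrightarrow> I j \<sigma>' \<mu>' \<Longrightarrow> wp w len c (\<lambda>_. I (Suc j)) C \<sigma>' \<mu>'"
    and budget: "N * (C + cost h + 7) + cost h + 5 \<le> T"
  shows "wp w len (FOR x < h DO c) (\<lambda>_. I N) T \<sigma> \<mu>"
  unfolding For_def
proof (intro wp_Seq wp_Assign)
  let ?step = "C + cost h + 7" and ?test = "Var x \<lessdot> h" and ?incr = "x ::= Var x \<oplus> Lit 1"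
  let ?I = "\<lambda>\<sigma>' \<mu>'. \<sigma>' x \<le> N \<and> I (\<sigma>' x) \<sigma>' \<mu>'"
  let ?\<Phi> = "\<lambda>\<sigma>' \<mu>'. (N - \<sigma>' x) * ?step"
  let ?\<sigma> = "\<sigma>(x := val len (Lit 0) \<sigma> \<mu>)"
  show "wp w len (WHILE ?test DO (c ;; ?incr)) (\<lambda>_. I N) (T - (cost (Lit 0) + 1)) ?\<sigma> \<mu>"
  proof (rule wp_Loop[where I = ?I and \<Phi> = ?\<Phi>])
    fix \<sigma>' \<mu>'
    assume "\<And>y. y \<notin> writes (c ;; ?incr) \<Longrightarrow> \<sigma>' y = ?\<sigma> y"
    then have frame: "\<And>y. y \<noteq> x \<Longrightarrow> y \<notin> writes c \<Longrightarrow> \<sigma>' y = \<sigma> y" by simp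
    then have bound_value: "safe w len h \<sigma>' \<mu>'" "val len h \<sigma>' \<mu>' = N" using bound by blast+
    then show "safe w len ?test \<sigma>' \<mu>'" by simp
    assume inv: "?I \<sigma>' \<mu>'"
    then show "I N \<sigma>' \<mu>'" if "val len ?test \<sigma>' \<mu>' = 0"
      using that bound_value by (auto simp: not_less)
    assume "\<And>A. A \<notin> stores (c ;; ?incr) \<Longrightarrow> \<mu>' A = \<mu> A"
    then have frame_arrays: "\<And>A. A \<notin> stores c \<Longrightarrow> \<mu>' A = \<mu> A" by simp
    assume "val len ?test \<sigma>' \<mu>' \<noteq> 0"
    then have less: "\<sigma>' x < N" using bound_value by (simp split: if_splits)
    then have potential: "?\<Phi> \<sigma>' \<mu>' = ?step + (N - Suc (\<sigma>' x)) * ?step"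
      by (metis Suc_diff_Suc mult_Suc)
    have "wp w len c (wp w len ?incr (\<lambda>t \<sigma>'' \<mu>''. ?I \<sigma>'' \<mu>'' \<and> ?\<Phi> \<sigma>'' \<mu>'' \<le> t)) (?\<Phi> \<sigma>' \<mu>' - (cost ?test + 1)) \<sigma>' \<mu>'"
    proof (rule wp_call)
      show "wp w len c (\<lambda>_. I (Suc (\<sigma>' x))) C \<sigma>' \<mu>'" using less frame frame_arrays inv by (intro body) auto
      show "C \<le> ?\<Phi> \<sigma>' \<mu>' - (cost ?test + 1)" unfolding potential by simp
      fix t \<sigma>'' \<mu>''
      assume left: "?\<Phi> \<sigma>' \<mu>' - (cost ?test + 1) - C \<le> t" and "\<And>y. y \<notin> writes c \<Longrightarrow> \<sigma>'' y = \<sigma>' y"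
        and post: "I (Suc (\<sigma>' x)) \<sigma>'' \<mu>''"
      then have x: "\<sigma>'' x = \<sigma>' x" using assms(3) by blast
      have "I (Suc (\<sigma>' x)) (\<sigma>''(x := Suc (\<sigma>' x))) \<mu>''" by (rule stable[OF post])
      then show "wp w len ?incr (\<lambda>t \<sigma>'' \<mu>''. ?I \<sigma>'' \<mu>'' \<and> ?\<Phi> \<sigma>'' \<mu>'' \<le> t) t \<sigma>'' \<mu>''"
        using less assms(2) left x unfolding potential by (intro wp_Assign) (simp_all add: Suc_eq_plus1)
    qed
    then show "cost ?test < ?\<Phi> \<sigma>' \<mu>' \<and>
        wp w len (c ;; ?incr) (\<lambda>t \<sigma>'' \<mu>''. ?I \<sigma>'' \<mu>'' \<and> ?\<Phi> \<sigma>'' \<mu>'' \<le> t) (?\<Phi> \<sigma>' \<mu>' - (cost ?test + 1)) \<sigma>' \<mu>'"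
      by (intro conjI wp_Seq) (simp_all only: potential cost.simps)
  qed (use stable[OF init, of 0] budget in simp_all)
qed (use budget in simp_all)

lemma wp_Check:
  assumes bound: "\<And>\<sigma>' \<mu>'. (\<And>z. z \<noteq> x \<Longrightarrow> z \<noteq> y \<Longrightarrow> \<sigma>' z = \<sigma> z) \<Longrightarrow> safe w len h \<sigma>' \<mu>' \<and> val len h \<sigma>' \<mu>' = N"
    and "N < 2 ^ w" "1 < (2::nat) ^ w" "x \<noteq> y"
    and test: "\<And>j \<sigma>'. j < N \<Longrightarrow> \<sigma>' x = j \<Longrightarrow> (\<And>z. z \<noteq> x \<Longrightarrow> z \<noteq> y \<Longrightarrow> \<sigma>' z = \<sigma> z) \<Longrightarrow>
      safe w len e \<sigma>' \<mu> \<and> (val len e \<sigma>' \<mu> = 0 \<longleftrightarrow> \<not> P j)"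
    and budget: "N * (cost e + cost h + 10) + cost h + 7 \<le> T"
  shows "wp w len (y ::= NONE x < h WITH e) (\<lambda>_ \<sigma>' \<mu>'. \<sigma>' y = of_bool (\<forall>j<N. \<not> P j)) T \<sigma> \<mu>"
  unfolding Check_def
proof (intro wp_Seq wp_Assign)
  let ?c = "IF e THEN y ::= Lit 0 ELSE Skip"
  let ?I = "\<lambda>j (\<sigma>' :: 'a store) (\<mu>' :: 'b arrays). \<sigma>' y = of_bool (\<forall>i<j. \<not> P i)"
  let ?\<sigma> = "\<sigma>(y := val len (Lit 1) \<sigma> \<mu>)"
  show "wp w len (FOR x < h DO ?c) (\<lambda>_. ?I N) (T - (cost (Lit 1 :: ('a, 'b) expr) + 1)) ?\<sigma> \<mu>"
  proof (rule wp_For[where I = ?I and N = N])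
    fix j \<sigma>' \<mu>'
    assume j: "j < N" "\<sigma>' x = j" "\<And>z. z \<noteq> x \<Longrightarrow> z \<notin> writes ?c \<Longrightarrow> \<sigma>' z = ?\<sigma> z"
      and "\<And>A. A \<notin> stores ?c \<Longrightarrow> \<mu>' A = \<mu> A" and inv: "?I j \<sigma>' \<mu>'"
    then have "\<mu>' = \<mu>" by auto
    moreover have "safe w len e \<sigma>' \<mu>" "val len e \<sigma>' \<mu> = 0 \<longleftrightarrow> \<not> P j"
      using test[of j \<sigma>'] j by auto
    ultimately show "wp w len ?c (\<lambda>_. ?I (Suc j)) (cost e + 3) \<sigma>' \<mu>'"
      using inv by (intro wp_Branch wp_Assign wp_Skip) (auto simp: less_Suc_eq)
  qed (use assms in \<open>auto simp: algebra_simps\<close>)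
qed (use budget assms(3) in simp_all)

section \<open>Graph distances\<close>

lemma gdist_attained:
  assumes "gdist E u v = enat r"
  obtains p where "walk E p" "hd p = u" "last p = v" "length p = Suc r"
proof -
  let ?lengths = "(\<lambda>p. enat (length p - 1)) ` {p. walk E p \<and> hd p = u \<and> last p = v}"
  have Inf_eq: "Inf ?lengths = enat r" using assms by (simp add: gdist_def)
  then have "?lengths \<noteq> {}" unfolding Inf_enat_def by (metis enat.distinct(1))
  then have "Inf ?lengths \<in> ?lengths"
    unfolding Inf_enat_def by (metis (mono_tags, lifting) LeastI ex_in_conv)
  then obtain p where p: "walk E p" "hd p = u" "last p = v" "length p - 1 = r"
    using Inf_eq by auto
  then have "length p = Suc r" by (cases p) (auto simp: walk_def)
  with p that show thesis by blast
qed

lemma gdist_le_walk: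
  assumes "walk E p" "hd p = u" "last p = v"
  shows "gdist E u v \<le> enat (length p - 1)"
  unfolding gdist_def by (rule INF_lower) (use assms in auto)

lemma gdist_refl [simp]: "gdist E u u = 0"
  using gdist_le_walk[of E "[u]" u u] by (simp add: walk_def flip: zero_enat_def)

lemma gdist_eq_0: "gdist E u v = 0 \<Longrightarrow> v = u"
  unfolding zero_enat_def by (elim gdist_attained) (auto simp: length_Suc_conv)

lemma gdist_commute_le: "gdist E u v \<le> gdist E v u"
proof (cases "gdist E v u")
  case (enat r)
  then obtain p where p: "walk E p" "hd p = v" "last p = u" "length p = Suc r"
    by (rule gdist_attained)
  have "walk E (rev p)"
    using p(1) by (auto simp: walk_def successively_rev insert_commute)
  then show ?thesis
    using gdist_le_walk[of E "rev p" u v] p enat by (simp add: hd_rev last_rev walk_def)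
qed simp

lemma gdist_commute: "gdist E u v = gdist E v u"
  by (rule antisym; rule gdist_commute_le)

lemma gdist_triangle: "gdist E u x \<le> gdist E u v + gdist E v x"
proof (cases "gdist E u v"; cases "gdist E v x")
  fix a b assume finite: "gdist E u v = enat a" "gdist E v x = enat b"
  obtain p where p: "walk E p" "hd p = u" "last p = v" "length p = Suc a"
    using finite(1) by (rule gdist_attained)
  obtain p' where p': "walk E p'" "hd p' = v" "last p' = x" "length p' = Suc b"
    using finite(2) by (rule gdist_attained)
  obtain p'' where p'': "p' = v # p''" using p' by (cases p') (auto simp: walk_def)
  have "walk E (p @ p'')" "hd (p @ p'') = u" "last (p @ p'') = x"
    using p p' by (auto simp: p'' walk_def successively_append_iff successively_Cons split: if_splits)
  then show ?thesis
    using gdist_le_walk[of E "p @ p''" u x] p p' finite by (simp add: p'')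
qed simp_all

lemma gdist_edge: "{u, v} \<in> E \<Longrightarrow> gdist E u v \<le> 1"
  using gdist_le_walk[of E "[u, v]" u v] by (simp add: walk_def one_enat_def One_nat_def)

lemma gdist_eq_1_edge:
  assumes "gdist E u v = enat 1"
  shows "{u, v} \<in> E"
proof -
  obtain p where p: "walk E p" "hd p = u" "last p = v" "length p = 2"
    using gdist_attained[OF assms] by (auto simp: numeral_2_eq_2 One_nat_def)
  then obtain a b where "p = [a, b]" by (auto simp: length_Suc_conv numeral_2_eq_2)
  with p show ?thesis by (simp add: walk_def)
qed

locale finite_graph =
  fixes n :: nat and E :: "nat set set"
  assumes simple: "simple_graph n E" and n_pos: "1 \<le> n"
begin

lemma edge_less: "{u, v} \<in> E \<Longrightarrow> u < n" "{u, v} \<in> E \<Longrightarrow> v < n"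
  using simple by (auto simp: simple_graph_def doubleton_eq_iff)

lemma walk_last_less:
  assumes "walk E p" "hd p < n"
  shows "last p < n"
proof (cases p rule: rev_cases)
  case (snoc p' v)
  then show ?thesis
    using assms edge_less by (cases "p' = []") (auto simp: walk_def successively_append_iff)
qed (use assms in \<open>simp add: walk_def\<close>)

lemma gdist_geodesic:
  assumes "u < n" "gdist E u v = enat r" "y \<le> r"
  obtains x where "x < n" "gdist E u x = enat y" "gdist E x v = enat (r - y)"
proof -
  obtain p where p: "walk E p" "hd p = u" "last p = v" "length p = Suc r"
    using assms by (elim gdist_attained)
  define x where "x = p ! y"
  have prefix: "walk E (take (Suc y) p)" "hd (take (Suc y) p) = u" "last (take (Suc y) p) = x"
  proof -
    show "walk E (take (Suc y) p)" "hd (take (Suc y) p) = u"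
      using p by (auto simp: walk_def successively_conv_nth)
    show "last (take (Suc y) p) = x"
      using p assms(3) by (simp add: x_def take_Suc_conv_app_nth)
  qed
  have suffix: "walk E (drop y p)" "hd (drop y p) = x" "last (drop y p) = v"
    using p assms(3) by (auto simp: walk_def successively_conv_nth x_def hd_drop_conv_nth)
  have prefix_le: "gdist E u x \<le> enat y"
    using gdist_le_walk[OF prefix] p assms(3) by simp
  have suffix_le: "gdist E x v \<le> enat (r - y)"
    using gdist_le_walk[OF suffix] p by simp
  obtain a b where finite: "gdist E u x = enat a" "gdist E x v = enat b"
    using prefix_le suffix_le by (cases "gdist E u x"; cases "gdist E x v") auto
  moreover have "r \<le> a + b" using gdist_triangle[of E u v x] assms(2) finite by simp
  moreover have "x < n" using walk_last_less[OF prefix(1)] prefix(2,3) assms(1) by simp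
  ultimately show thesis
    using prefix_le suffix_le assms(3) by (intro that[of x]) auto
qed

lemma gdist_finite_less:
  assumes "u < n" "gdist E u v = enat r"
  shows "r < n"
proof -
  have "\<forall>y\<in>{..r}. \<exists>x. x < n \<and> gdist E u x = enat y"
    using assms by (auto elim: gdist_geodesic)
  then obtain f where f: "\<And>y. y \<le> r \<Longrightarrow> f y < n \<and> gdist E u (f y) = enat y"
    by (metis atMost_iff)
  have "inj_on f {..r}"
    by (rule inj_onI) (metis f atMost_iff enat.inject)
  moreover have "f ` {..r} \<subseteq> {..<n}" using f by auto
  ultimately have "card {..r} \<le> card {..<n}" by (metis card_inj_on_le finite_lessThan)
  then show ?thesis by simp
qed

text \<open>The value \<open>2 * n\<close> stands for \<open>\<infinity>\<close>; it is large enough to keep the triangle inequality.\<close>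

definition d :: "nat \<Rightarrow> nat \<Rightarrow> nat" where
  "d u v = (case gdist E u v of enat r \<Rightarrow> r | \<infinity> \<Rightarrow> 2 * n)"

lemma d_self [simp]: "d u u = 0"
  by (simp add: d_def zero_enat_def)

lemma d_eq_0: "d u v = 0 \<Longrightarrow> v = u"
  using n_pos by (auto simp: d_def zero_enat_def intro: gdist_eq_0 split: enat.splits)

lemma d_commute: "d u v = d v u"
  by (simp add: d_def gdist_commute)

lemma d_less_or_inf: "u < n \<Longrightarrow> d u v < n \<or> d u v = 2 * n"
  by (cases "gdist E u v") (auto simp: d_def dest: gdist_finite_less)

lemma d_le_inf: "u < n \<Longrightarrow> d u v \<le> 2 * n"
  using d_less_or_inf[of u v] by auto

lemma d_triangle: "u < n \<Longrightarrow> d u x \<le> d u v + d v x"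
  using gdist_triangle[of E u x v] d_le_inf[of u x]
  by (auto simp: d_def split: enat.splits)

lemma d_le_iff_gdist_le: "r < 2 * n \<Longrightarrow> d u v \<le> r \<longleftrightarrow> gdist E u v \<le> enat r"
  by (auto simp: d_def split: enat.splits)

lemma d_geodesic:
  assumes "u < n" "d u v < 2 * n" "y \<le> d u v"
  shows "\<exists>x<n. d u x = y \<and> d x v = d u v - y"
proof (cases "gdist E u v")
  case (enat r)
  then have "y \<le> r" using assms(3) by (simp add: d_def)
  from gdist_geodesic[OF assms(1) enat this] obtain x
    where "x < n" "gdist E u x = enat y" "gdist E x v = enat (r - y)" .
  then show ?thesis using enat by (intro exI[of _ x]) (simp_all add: d_def)
qed (use assms in \<open>simp add: d_def\<close>)

lemma d_edge: "{u, v} \<in> E \<Longrightarrow> d u v \<le> 1"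
  using gdist_edge[of u v E] by (auto simp: d_def one_enat_def split: enat.splits)

lemma d_predecessor:
  assumes "u < n" "d u v = Suc r" "Suc r < 2 * n"
  obtains x where "x < n" "d u x = r" "{x, v} \<in> E"
proof -
  obtain x where x: "x < n" "d u x = r" "d x v = 1"
    using d_geodesic[of u v r] assms by (auto simp: One_nat_def)
  have "gdist E x v = enat 1"
    using x d_less_or_inf[OF x(1), of v] by (cases "gdist E x v") (auto simp: d_def)
  then show thesis using that x gdist_eq_1_edge by blast
qed

lemma set_gdist_le_iff:
  assumes "r < 2 * n" "finite C"
  shows "set_gdist E v C \<le> enat r \<longleftrightarrow> (\<exists>c\<in>C. d v c \<le> r)"
proof
  assume "set_gdist E v C \<le> enat r"
  then have "set_gdist E v C < enat (Suc r)" by (simp add: order_le_less_trans)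
  then obtain c where c: "c \<in> C" "gdist E v c < enat (Suc r)"
    unfolding set_gdist_def INF_less_iff by blast
  then have "gdist E v c \<le> enat r" by (cases "gdist E v c") auto
  then show "\<exists>c\<in>C. d v c \<le> r" using c(1) d_le_iff_gdist_le[OF assms(1)] by blast
next
  assume "\<exists>c\<in>C. d v c \<le> r"
  then show "set_gdist E v C \<le> enat r"
    unfolding set_gdist_def using d_le_iff_gdist_le[OF assms(1)] by (auto intro: INF_lower2)
qed

lemma k_radius_le_iff:
  assumes "r < 2 * n"
  shows "k_radius n E k \<le> enat r \<longleftrightarrow> (\<exists>C\<subseteq>{..<n}. card C = k \<and> (\<forall>v<n. \<exists>c\<in>C. d v c \<le> r))"
proof
  let ?radius = "\<lambda>C. SUP v\<in>{..<n}. set_gdist E v C"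
  assume "k_radius n E k \<le> enat r"
  then have "k_radius n E k < enat (Suc r)" by (simp add: order_le_less_trans)
  then obtain C where C: "C \<subseteq> {..<n}" "card C = k" "?radius C < enat (Suc r)"
    unfolding k_radius_def INF_less_iff by blast
  have "?radius C \<le> enat r" using C(3) by (cases "?radius C") auto
  then have "\<forall>v<n. set_gdist E v C \<le> enat r" by (auto simp: SUP_le_iff)
  then show "\<exists>C\<subseteq>{..<n}. card C = k \<and> (\<forall>v<n. \<exists>c\<in>C. d v c \<le> r)"
    using C(1,2) set_gdist_le_iff[OF assms] finite_subset[OF C(1)] by blast
next
  assume "\<exists>C\<subseteq>{..<n}. card C = k \<and> (\<forall>v<n. \<exists>c\<in>C. d v c \<le> r)"
  then obtain C where C: "C \<subseteq> {..<n}" "card C = k" "\<forall>v<n. \<exists>c\<in>C. d v c \<le> r" by blast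
  then have "(SUP v\<in>{..<n}. set_gdist E v C) \<le> enat r"
    using set_gdist_le_iff[OF assms] finite_subset[OF C(1)] by (intro SUP_least) auto
  then show "k_radius n E k \<le> enat r"
    unfolding k_radius_def using C(1,2) by (intro INF_lower2[of C]) auto
qed

lemma k_radius_less_or_inf: "k_radius n E k \<le> enat (n - 1) \<or> k_radius n E k = \<infinity>"
proof (cases "k_radius n E k")
  case (enat r)
  then have "k_radius n E k < \<infinity>" by simp
  then obtain C where C: "C \<subseteq> {..<n}" "card C = k" "(SUP v\<in>{..<n}. set_gdist E v C) < \<infinity>"
    unfolding k_radius_def INF_less_iff by blast
  have "\<exists>c\<in>C. d v c \<le> n - 1" if "v < n" for v
  proof -
    have "set_gdist E v C \<le> (SUP v\<in>{..<n}. set_gdist E v C)" using that by (intro SUP_upper) simp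
    then have "set_gdist E v C < \<infinity>" using C(3) by (rule le_less_trans)
    then obtain c where c: "c \<in> C" "gdist E v c < \<infinity>" unfolding set_gdist_def INF_less_iff by blast
    then obtain j where j: "gdist E v c = enat j" by (cases "gdist E v c") auto
    have "j < n" using gdist_finite_less[OF that j] .
    then show ?thesis using c(1) j by (intro bexI[of _ c]) (auto simp: d_def)
  qed
  then show ?thesis using k_radius_le_iff[of "n - 1"] C(1,2) n_pos by auto
qed simp

end

section \<open>The search tree\<close>

text \<open>\<open>S\<close> is the hitting set, \<open>N v\<close> a set of vertices near \<open>v\<close>, and \<open>dS\<close> the distance to \<open>S\<close>.\<close>

locale center_search = finite_graph +
  fixes k :: nat and S :: "nat set" and N :: "nat \<Rightarrow> nat set" and dS :: "nat \<Rightarrow> nat" and R :: nat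
  assumes k_pos: "1 \<le> k" and R_less: "R < n"
    and N_nonempty: "\<And>v. v < n \<Longrightarrow> N v \<noteq> {}"
    and dS_le: "\<And>v s. v < n \<Longrightarrow> s \<in> S \<Longrightarrow> dS v \<le> d v s"
    and dS_le_inf: "\<And>v. v < n \<Longrightarrow> dS v \<le> 2 * n"
    and dS_attained: "\<And>v. v < n \<Longrightarrow> dS v < 2 * n \<Longrightarrow> \<exists>s\<in>S. d v s = dS v"
    and ball_subset_N: "\<And>v r x. v < n \<Longrightarrow> r < 2 * n \<Longrightarrow> r < dS v \<Longrightarrow> x < n \<Longrightarrow> d v x \<le> r \<Longrightarrow> x \<in> N v"
    and dS_1_center: "\<And>v. v < n \<Longrightarrow> k = 1 \<Longrightarrow> dS v = 0"
begin

lemma dS_triangle: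
  assumes "u < n" "v < n"
  shows "dS u \<le> d u v + dS v"
proof (cases "dS v < 2 * n")
  case True
  then obtain s where "s \<in> S" "d v s = dS v" using dS_attained assms(2) by blast
  then show ?thesis using dS_le[OF assms(1), of s] d_triangle[OF assms(1), of s v] by simp
next
  case False
  then show ?thesis using dS_le_inf[OF assms(1)] by simp
qed

definition "gap = R div (2 * k - 1)"
definition "target = 2 * R - gap"
definition "reach = (R - gap) div 2"
definition "threshold i = R + 2 * i * gap - gap"

lemma gap_bound:
  assumes "i < k"
  shows "2 * i * gap + gap \<le> R"
proof -
  have "2 * i + 1 \<le> 2 * k - 1" using assms by simp
  then have "(2 * i + 1) * gap \<le> (2 * k - 1) * gap" by (rule mult_le_mono1)
  also have "\<dots> \<le> R" by (simp add: gap_def)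
  finally show ?thesis by (simp add: algebra_simps)
qed

lemma gap_le: "gap \<le> R"
  using gap_bound[of 0] k_pos by simp

lemma threshold_le_target: "i < k \<Longrightarrow> threshold i \<le> target"
  using gap_bound[of i] by (simp add: threshold_def target_def)

lemma reach_le: "reach \<le> R"
  unfolding reach_def using div_le_dividend[of "R - gap" 2] by linarith

definition uncovered :: "nat \<Rightarrow> nat \<Rightarrow> (nat \<Rightarrow> nat) \<Rightarrow> nat \<Rightarrow> bool" where
  "uncovered t i X v \<longleftrightarrow> (\<forall>l<i. t < d (X l) v)"

lemma uncovered_Suc: "uncovered t (Suc i) X v \<longleftrightarrow> uncovered t i X v \<and> t < d (X i) v"
  by (auto simp: uncovered_def less_Suc_eq)

lemma uncovered_upd [simp]: "uncovered t i (X(i := x)) v \<longleftrightarrow> uncovered t i X v"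
  by (auto simp: uncovered_def)

lemma uncovered_mono: "uncovered t' i X v \<Longrightarrow> t \<le> t' \<Longrightarrow> uncovered t i X v"
  using le_less_trans by (auto simp: uncovered_def)

definition covers_rest :: "nat \<Rightarrow> nat \<Rightarrow> (nat \<Rightarrow> nat) \<Rightarrow> nat set \<Rightarrow> bool" where
  "covers_rest t i X C \<longleftrightarrow> (\<forall>v<n. uncovered t i X v \<longrightarrow> (\<exists>c\<in>C. d v c \<le> R))"

lemma covers_rest_extend:
  assumes "covers_rest t i X C" "t \<le> t'"
  shows "covers_rest t' (Suc i) (X(i := x)) C"
  using assms uncovered_mono by (auto simp: covers_rest_def uncovered_Suc)

lemma covers_rest_replace:
  assumes "covers_rest t i X C" "t \<le> t'" and close: "\<And>v. v < n \<Longrightarrow> d v c \<le> R \<Longrightarrow> d x v \<le> t'"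
  shows "covers_rest t' (Suc i) (X(i := x)) (C - {c})"
  unfolding covers_rest_def
proof (intro allI impI)
  fix v assume v: "v < n" "uncovered t' (Suc i) (X(i := x)) v"
  then obtain c' where c': "c' \<in> C" "d v c' \<le> R"
    using covers_rest_extend[OF assms(1,2)] unfolding covers_rest_def by blast
  moreover have "c' \<noteq> c" using close[OF v(1)] c'(2) v(2) by (auto simp: uncovered_Suc)
  ultimately show "\<exists>c\<in>C - {c}. d v c \<le> R" by blast
qed

text \<open>The prefix \<open>X 0, \<dots>, X (i - 1)\<close> can be completed: in the first case the missing centers need
  only be looked up in \<open>S\<close>, in the second they are still arbitrary.\<close>

definition near_completable :: "nat \<Rightarrow> (nat \<Rightarrow> nat) \<Rightarrow> bool" where
  "near_completable i X \<longleftrightarrow> (\<exists>C\<subseteq>{..<n}. card C \<le> k - i \<and> covers_rest target i X C \<and>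
     (Suc i < k \<longrightarrow> (\<forall>c\<in>C. dS c \<le> R - gap)))"

definition far_completable :: "nat \<Rightarrow> (nat \<Rightarrow> nat) \<Rightarrow> bool" where
  "far_completable i X \<longleftrightarrow> (\<exists>C\<subseteq>{..<n}. card C \<le> k - i \<and> covers_rest (threshold i) i X C)"

definition completable :: "nat \<Rightarrow> (nat \<Rightarrow> nat) \<Rightarrow> bool" where
  "completable i X \<longleftrightarrow> near_completable i X \<or> far_completable i X"

lemma completable_cong:
  assumes "\<And>l. l < i \<Longrightarrow> X l = Y l"
  shows "completable i X \<longleftrightarrow> completable i Y"
proof -
  have "uncovered t i X = uncovered t i Y" for t
    using assms by (simp add: uncovered_def fun_eq_iff)
  then show ?thesis
    by (simp add: completable_def near_completable_def far_completable_def covers_rest_def)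
qed

lemma completable_0:
  assumes "k_radius n E k \<le> enat R"
  shows "completable 0 X"
proof -
  obtain C where "C \<subseteq> {..<n}" "card C = k" "\<forall>v<n. \<exists>c\<in>C. d v c \<le> R"
    using assms R_less k_radius_le_iff[of R k] by auto
  then show ?thesis by (auto simp: completable_def far_completable_def covers_rest_def)
qed

lemma near_completable_step:
  assumes "near_completable i X" "Suc i < k" "w < n"
  shows "\<exists>x\<in>S \<union> N w. near_completable (Suc i) (X(i := x))"
proof -
  obtain C where C: "C \<subseteq> {..<n}" "card C \<le> k - i" "covers_rest target i X C" "\<forall>c\<in>C. dS c \<le> R - gap"
    using assms(1,2) unfolding near_completable_def by blast
  show ?thesis
  proof (cases "C = {}")
    case True
    obtain x where "x \<in> N w" using N_nonempty assms(3) by blast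
    moreover have "near_completable (Suc i) (X(i := x))"
      using covers_rest_extend[OF C(3) order_refl] True by (auto simp: near_completable_def)
    ultimately show ?thesis by blast
  next
    case False
    then obtain c where c: "c \<in> C" by blast
    then have c_near: "c < n" "dS c \<le> R - gap" using C by auto
    then obtain s where s: "s \<in> S" "d c s = dS c" using dS_attained R_less by fastforce
    have "d s v \<le> target" if "v < n" "d v c \<le> R" for v
      using d_triangle[OF that(1), of s c] that(2) s(2) c_near(2) gap_le
      by (simp add: target_def d_commute[of s v])
    then have "covers_rest target (Suc i) (X(i := s)) (C - {c})"
      by (rule covers_rest_replace[OF C(3) order_refl])
    moreover have "C - {c} \<subseteq> {..<n}" "card (C - {c}) \<le> k - Suc i" "\<forall>c'\<in>C - {c}. dS c' \<le> R - gap"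
      using C c by (auto simp: card_Diff_singleton_if)
    ultimately show ?thesis using s(1) unfolding near_completable_def by blast
  qed
qed

text \<open>\<open>b = 0\<close> tells that no vertex is uncovered.\<close>

definition farthest :: "nat \<Rightarrow> nat \<Rightarrow> (nat \<Rightarrow> nat) \<Rightarrow> nat \<Rightarrow> nat \<Rightarrow> bool" where
  "farthest t i X b w \<longleftrightarrow> w < n \<and> (\<forall>z<n. uncovered t i X z \<longrightarrow> dS z < b) \<and>
     (b \<noteq> 0 \<longrightarrow> b = Suc (dS w) \<and> uncovered t i X w)"

text \<open>The point at distance \<open>2 * i * gap\<close> on the way from \<open>c\<close> to a vertex that it has to cover.\<close>

lemma uncovered_point_far_from_S:
  assumes c: "c < n" "R - gap < dS c" and v: "uncovered target i X v" "d v c \<le> R"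
    and "i < k" "\<forall>l<i. X l < n"
  shows "\<exists>x<n. uncovered (threshold i) i X x \<and> R - gap < 2 * i * gap + dS x"
proof -
  let ?y = "min (2 * i * gap) (d c v)"
  obtain x where x: "x < n" "d c x = ?y" "d x v = d c v - ?y"
    using d_geodesic[OF c(1), of v ?y] v(2) R_less by (auto simp: d_commute)
  have "threshold i < d (X l) x" if "l < i" for l
  proof -
    have "target < d (X l) x + d x v"
      using v(1) that assms(6) d_triangle[of "X l" v x] less_le_trans by (auto simp: uncovered_def)
    then show ?thesis
      using x(3) v(2) gap_bound[OF assms(5)]
      by (auto simp: target_def threshold_def d_commute[of v c] min_def split: if_splits)
  qed
  moreover have "R - gap < 2 * i * gap + dS x" using dS_triangle[OF c(1) x(1)] c(2) x(2) by simp
  ultimately show ?thesis using x(1) by (auto simp: uncovered_def)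
qed

lemma N_approximates_center:
  assumes "w < n" "R - gap < 2 * i * gap + dS w" "d w c \<le> R" "i < k"
  shows "\<exists>a\<in>N w. a < n \<and> d a c \<le> 2 * i * gap + gap"
proof -
  let ?y = "min (R - gap - 2 * i * gap) (d w c)"
  obtain a where a: "a < n" "d w a = ?y" "d a c = d w c - ?y"
    using d_geodesic[OF assms(1), of c ?y] assms(3) R_less by auto
  have "a \<in> N w"
    using gap_bound[OF assms(4)] assms(2) R_less a(1,2)
    by (intro ball_subset_N[OF assms(1), of "R - gap - 2 * i * gap"]) auto
  moreover have "d a c \<le> 2 * i * gap + gap"
    using a(3) assms(3) gap_bound[OF assms(4)] by (auto simp: min_def)
  ultimately show ?thesis using a(1) by blast
qed

lemma far_completable_replace:
  assumes C: "C \<subseteq> {..<n}" "card C \<le> k - i" "covers_rest (threshold i) i X C"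
    and c: "c \<in> C" and a: "a < n" "d a c \<le> 2 * i * gap + gap"
  shows "far_completable (Suc i) (X(i := a))"
proof -
  have "threshold i \<le> threshold (Suc i)" by (simp add: threshold_def)
  moreover have "d a v \<le> threshold (Suc i)" if "d v c \<le> R" for v
    using d_triangle[OF a(1), of v c] a(2) that by (simp add: threshold_def d_commute[of c v])
  ultimately have "covers_rest (threshold (Suc i)) (Suc i) (X(i := a)) (C - {c})"
    by (intro covers_rest_replace[OF C(3)])
  moreover have "C - {c} \<subseteq> {..<n}" "card (C - {c}) \<le> k - Suc i"
    using C c by (auto simp: card_Diff_singleton_if)
  ultimately show ?thesis unfolding far_completable_def by blast
qed

lemma far_completable_step:
  assumes "far_completable i X" "Suc i < k" "farthest (threshold i) i X b w" "\<forall>l<i. X l < n"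
  shows "\<exists>x\<in>S \<union> N w. completable (Suc i) (X(i := x))"
proof -
  have i: "i < k" using assms(2) by simp
  have w: "w < n" using assms(3) by (simp add: farthest_def)
  obtain C where C: "C \<subseteq> {..<n}" "card C \<le> k - i" "covers_rest (threshold i) i X C"
    using assms(1) unfolding far_completable_def by blast
  \<comment> \<open>Centers that cover nothing new can be dropped.\<close>
  define needed where "needed = {c\<in>C. \<exists>v<n. uncovered target i X v \<and> d v c \<le> R}"
  show ?thesis
  proof (cases "\<forall>c\<in>needed. dS c \<le> R - gap")
    case True
    have "covers_rest target i X needed"
      using C(3) uncovered_mono[OF _ threshold_le_target[OF i]]
      unfolding covers_rest_def needed_def by blast
    moreover have "needed \<subseteq> {..<n}" "card needed \<le> k - i"
      using C(1,2) card_mono[of C needed] finite_subset[OF C(1)] by (auto simp: needed_def)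
    ultimately have "near_completable i X" using True unfolding near_completable_def by blast
    from near_completable_step[OF this assms(2) w] show ?thesis by (auto simp: completable_def)
  next
    case False
    then obtain c v where "c \<in> C" "R - gap < dS c" "uncovered target i X v" "d v c \<le> R"
      by (auto simp: needed_def not_le)
    then obtain x where x: "x < n" "uncovered (threshold i) i X x" "R - gap < 2 * i * gap + dS x"
      using uncovered_point_far_from_S[of c i X v] C(1) i assms(4) by auto
    then have "dS x \<le> dS w" and w_uncovered: "uncovered (threshold i) i X w"
      using assms(3) by (auto simp: farthest_def)
    then have w_far: "R - gap < 2 * i * gap + dS w" using x(3) by simp
    obtain c' where c': "c' \<in> C" "d w c' \<le> R"
      using C(3) w w_uncovered unfolding covers_rest_def by blast
    obtain a where "a \<in> N w" "a < n" "d a c' \<le> 2 * i * gap + gap"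
      using N_approximates_center[OF w w_far c'(2) i] by blast
    with far_completable_replace[OF C c'(1)] show ?thesis by (auto simp: completable_def)
  qed
qed

lemma completable_step:
  assumes "completable i X" "Suc i < k" "farthest (threshold i) i X b w" "\<forall>l<i. X l < n"
  shows "\<exists>x\<in>S \<union> N w. completable (Suc i) (X(i := x))"
  using assms far_completable_step near_completable_step
  unfolding completable_def farthest_def by blast

lemma completable_leaf:
  assumes "completable i X" "Suc i = k"
  shows "\<exists>c<n. \<forall>v<n. uncovered target i X v \<longrightarrow> d v c \<le> R"
proof -
  obtain C where C: "C \<subseteq> {..<n}" "card C \<le> k - i" "covers_rest target i X C"
    using assms(1) unfolding completable_def
  proof
    assume "far_completable i X"
    then obtain C where C: "C \<subseteq> {..<n}" "card C \<le> k - i" "covers_rest (threshold i) i X C"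
      unfolding far_completable_def by blast
    have "covers_rest target i X C"
      using C(3) uncovered_mono[OF _ threshold_le_target[of i]] assms(2) by (auto simp: covers_rest_def)
    with C(1,2) that show thesis by blast
  qed (auto simp: near_completable_def intro: that)
  have "card C \<le> 1" using C(2) assms(2) by simp
  then consider "C = {}" | c where "C = {c}"
    using finite_subset[OF C(1)] by (cases "card C = 0") (auto simp: card_1_singleton_iff One_nat_def le_Suc_eq)
  then show ?thesis
  proof cases
    case 1
    then show ?thesis using C(3) n_pos by (intro exI[of _ 0]) (simp add: covers_rest_def)
  next
    case 2
    then show ?thesis using C(1,3) by (intro exI[of _ c]) (simp add: covers_rest_def)
  qed
qed

lemma leaf_near_complete:
  assumes "c < n" "\<forall>v<n. uncovered target i X v \<longrightarrow> d v c \<le> R"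
    and "z < n" "uncovered target i X z" "d z s \<le> reach"
  shows "d c s \<le> R + reach"
  using d_triangle[OF assms(1), of s z] assms d_commute[of c z] by fastforce

lemma leaf_near_sound:
  assumes "z < n" "d z s \<le> reach" "d u s \<le> R + reach"
  shows "d u z \<le> target"
  using d_triangle[OF assms(1), of u s] assms gap_le
  by (auto simp: target_def reach_def d_commute[of s u] d_commute[of u z])

lemma leaf_far_complete:
  assumes c: "\<forall>v<n. uncovered target i X v \<longrightarrow> d v c \<le> R"
    and w: "w < n" "uncovered target i X w" "reach < dS w"
  shows "\<exists>u\<in>N w. \<forall>z<n. uncovered target i X z \<longrightarrow> d u z \<le> target"
proof -
  have "k \<noteq> 1" using dS_1_center[OF w(1)] w(3) by auto
  then have "gap \<le> reach" using gap_bound[of 1] k_pos by (simp add: reach_def)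
  have "d w c \<le> R" using c w by blast
  then obtain u where u: "u < n" "d w u = min reach (d w c)" "d u c = d w c - min reach (d w c)"
    using d_geodesic[OF w(1), of c "min reach (d w c)"] R_less by auto
  have "u \<in> N w"
    using ball_subset_N[OF w(1) _ w(3) u(1)] u(2) reach_le R_less by simp
  moreover have "d u z \<le> target" if "z < n" "uncovered target i X z" for z
  proof -
    have "d z c \<le> R" using c that by blast
    then show ?thesis
      using d_triangle[OF u(1), of z c] u(3) \<open>d w c \<le> R\<close> \<open>gap \<le> reach\<close> gap_le
      by (auto simp: target_def d_commute[of c z] min_def split: if_splits)
  qed
  ultimately show ?thesis by blast
qed

end

section \<open>Breadth-first search\<close>

context finite_graph begin

text \<open>\<open>qu\<close> is the queue, filled up to position \<open>qt\<close>, and \<open>lab\<close> the distance labels so far.\<close>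

definition bfs_queue :: "nat \<Rightarrow> nat \<Rightarrow> (nat \<Rightarrow> nat) \<Rightarrow> (nat \<Rightarrow> nat) \<Rightarrow> bool" where
  "bfs_queue s qt qu lab \<longleftrightarrow> 1 \<le> qt \<and> inj_on qu {..<qt} \<and>
     (\<forall>i<qt. qu i < n \<and> d s (qu i) < 2 * n) \<and> qu 0 = s \<and>
     (\<forall>i j. i < j \<longrightarrow> j < qt \<longrightarrow> d s (qu i) \<le> d s (qu j)) \<and>
     (\<forall>u<n. lab u = (if u \<in> qu ` {..<qt} then d s u else 2 * n))"

definition bfs_head :: "nat \<Rightarrow> nat \<Rightarrow> nat \<Rightarrow> (nat \<Rightarrow> nat) \<Rightarrow> bool" where
  "bfs_head s qh qt qu \<longleftrightarrow> (\<forall>i<qh. \<forall>u. {qu i, u} \<in> E \<longrightarrow> u \<in> qu ` {..<qt}) \<and>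
     (qh < qt \<longrightarrow> (\<forall>i<qt. d s (qu i) \<le> d s (qu qh) + 1) \<and>
       (\<forall>x<n. d s x \<le> d s (qu qh) \<longrightarrow> x \<in> qu ` {..<qt}))"

lemma bfs_queue_le: "bfs_queue s qt qu lab \<Longrightarrow> qt \<le> n"
  using card_inj_on_le[of qu "{..<qt}" "{..<n}"] by (auto simp: bfs_queue_def)

lemma bfs_init:
  assumes "s < n" "qu 0 = s" "\<And>u. u < n \<Longrightarrow> lab u = (if u = s then 0 else 2 * n)"
  shows "bfs_queue s 1 qu lab" "bfs_head s 0 1 qu"
  using assms d_eq_0[of s] by (auto simp: bfs_queue_def bfs_head_def lessThan_Suc One_nat_def)

lemma bfs_push:
  assumes queue: "bfs_queue s qt qu lab" and head: "bfs_head s qh qt qu" and "qh < qt" "s < n"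
    and u: "{qu qh, u} \<in> E" "u \<notin> qu ` {..<qt}"
  shows "bfs_queue s (Suc qt) (qu(qt := u)) (lab(u := lab (qu qh) + 1))"
    "bfs_head s qh (Suc qt) (qu(qt := u))"
proof -
  have "u < n" using u edge_less by blast
  have finite: "d s (qu qh) < n" using assms(3,4) queue d_less_or_inf[of s "qu qh"] by (auto simp: bfs_queue_def)
  have label: "lab (qu qh) = d s (qu qh)" using assms(3) queue by (auto simp: bfs_queue_def)
  have "\<not> d s u \<le> d s (qu qh)" using head assms(3) u \<open>u < n\<close> by (auto simp: bfs_head_def)
  moreover have "d s u \<le> d s (qu qh) + 1"
    using d_triangle[OF assms(4), of u "qu qh"] d_edge[OF u(1)] by simp
  ultimately have d_u: "d s u = d s (qu qh) + 1" by simp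
  have visited: "(qu(qt := u)) ` {..<Suc qt} = insert u (qu ` {..<qt})"
    by (auto simp: lessThan_Suc)
  have "inj_on (qu(qt := u)) {..<Suc qt}"
    using queue u by (auto simp: bfs_queue_def inj_on_def less_Suc_eq)
  moreover have "\<forall>i<qt. d s (qu i) \<le> d s (qu qh) + 1" using head assms(3) by (auto simp: bfs_head_def)
  moreover have "0 < qt" using assms(3) by simp
  ultimately show "bfs_queue s (Suc qt) (qu(qt := u)) (lab(u := lab (qu qh) + 1))"
    unfolding bfs_queue_def visited label
    using queue \<open>u < n\<close> d_u finite by (auto simp: bfs_queue_def less_Suc_eq)
  show "bfs_head s qh (Suc qt) (qu(qt := u))"
    unfolding bfs_head_def visited using head assms(3) d_u by (auto simp: bfs_head_def less_Suc_eq)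
qed

lemma bfs_advance:
  assumes queue: "bfs_queue s qt qu lab" and head: "bfs_head s qh qt qu" and "qh < qt" "s < n"
    and neighbors: "\<And>u. {qu qh, u} \<in> E \<Longrightarrow> u \<in> qu ` {..<qt}"
  shows "bfs_head s (Suc qh) qt qu"
  unfolding bfs_head_def
proof (intro conjI impI allI)
  show closed: "u \<in> qu ` {..<qt}" if "i < Suc qh" "{qu i, u} \<in> E" for i u
    using head neighbors that by (auto simp: bfs_head_def less_Suc_eq)
  assume next_less: "Suc qh < qt"
  have sorted: "d s (qu qh) \<le> d s (qu (Suc qh))" using queue next_less by (auto simp: bfs_queue_def)
  show "d s (qu i) \<le> d s (qu (Suc qh)) + 1" if "i < qt" for i
    using head assms(3) sorted that by (fastforce simp: bfs_head_def)
  fix x assume x: "x < n" "d s x \<le> d s (qu (Suc qh))"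
  show "x \<in> qu ` {..<qt}"
  proof (cases "d s x \<le> d s (qu qh)")
    case True
    then show ?thesis using head assms(3) x by (auto simp: bfs_head_def)
  next
    case False
    moreover have "d s (qu (Suc qh)) \<le> d s (qu qh) + 1" using head next_less by (auto simp: bfs_head_def)
    ultimately have level: "d s x = Suc (d s (qu qh))" "d s (qu (Suc qh)) = Suc (d s (qu qh))" using x by auto
    have "d s (qu (Suc qh)) < 2 * n" using queue next_less by (auto simp: bfs_queue_def)
    then obtain y where y: "y < n" "d s y = d s (qu qh)" "{y, x} \<in> E"
      using d_predecessor[OF assms(4) level(1)] level by auto
    then obtain i where i: "i < qt" "y = qu i" using head assms(3) by (auto simp: bfs_head_def)
    have "i < Suc qh"
    proof (rule ccontr)
      assume "\<not> i < Suc qh"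
      then have "d s (qu (Suc qh)) \<le> d s (qu i)" using queue i by (auto simp: bfs_queue_def not_less le_less)
      then show False using y(2) i(2) level by simp
    qed
    then show ?thesis using closed y(3) i(2) by blast
  qed
qed

lemma bfs_complete:
  assumes queue: "bfs_queue s qt qu lab" and head: "bfs_head s qt qt qu" and "s < n" "u < n" "d s u < 2 * n"
  shows "u \<in> qu ` {..<qt}"
  using assms(4,5)
proof (induction "d s u" arbitrary: u)
  case 0
  then have "u = s" using d_eq_0[of s u] by simp
  then show ?case using queue by (auto simp: bfs_queue_def)
next
  case (Suc r)
  then obtain x where x: "x < n" "d s x = r" "{x, u} \<in> E"
    using d_predecessor[OF assms(3), of u r] by metis
  then have "x \<in> qu ` {..<qt}" using Suc by auto
  then show ?case using head x by (auto simp: bfs_head_def)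
qed

lemma bfs_labels:
  assumes "bfs_queue s qt qu lab" "bfs_head s qt qt qu" "s < n" "u < n"
  shows "lab u = d s u"
  using bfs_complete[OF assms] assms(1,4) d_le_inf[OF assms(3), of u]
  by (cases "d s u < 2 * n") (auto simp: bfs_queue_def)

text \<open>The first \<open>q\<close> entries of \<open>rw\<close> are vertices nearest to \<open>s\<close>; \<open>full\<close> tells whether there are that many.\<close>

definition nearest_row :: "nat \<Rightarrow> nat \<Rightarrow> (nat \<Rightarrow> nat) \<Rightarrow> bool \<Rightarrow> bool" where
  "nearest_row q s rw full \<longleftrightarrow> rw 0 = s \<and> (q = 1 \<longrightarrow> full) \<and>
     (if full then inj_on rw {..<q} \<and> (\<forall>i<q. \<forall>x<n. d s x < d s (rw i) \<longrightarrow> x \<in> rw ` {..<q})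
      else \<forall>x<n. d s x < 2 * n \<longrightarrow> x \<in> rw ` {..<q})"

lemma nearest_row_cong:
  assumes "\<And>i. i < q \<Longrightarrow> rw i = rw' i" "1 \<le> q"
  shows "nearest_row q s rw full \<longleftrightarrow> nearest_row q s rw' full"
proof -
  have "rw ` {..<q} = rw' ` {..<q}" "inj_on rw {..<q} = inj_on rw' {..<q}" "rw 0 = rw' 0"
    using assms by (auto intro!: image_cong inj_on_cong)
  then show ?thesis using assms(1) by (simp add: nearest_row_def)
qed

lemma bfs_nearest_row:
  assumes queue: "bfs_queue s qt qu lab" and head: "bfs_head s qt qt qu" and "s < n"
  shows "nearest_row q s qu (q \<le> qt)"
proof -
  have "x \<in> qu ` {..<q}" if "q \<le> qt" "i < q" and x: "x < n" "d s x < d s (qu i)" for i x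
  proof -
    have "d s x < 2 * n" using that queue by (auto simp: bfs_queue_def intro: less_trans)
    then obtain j where j: "j < qt" "x = qu j" using bfs_complete[OF queue head assms(3) x(1)] by auto
    have "d s (qu i) \<le> d s (qu j)" if "i < j" using queue j(1) that by (auto simp: bfs_queue_def)
    then have "\<not> i < j" using j(2) x(2) by auto
    then show ?thesis using j(2) \<open>i < q\<close> by auto
  qed
  moreover have "inj_on qu {..<q}" if "q \<le> qt"
    using queue that by (auto simp: bfs_queue_def intro: inj_on_subset)
  moreover have "x \<in> qu ` {..<q}" if "qt < q" "x < n" "d s x < 2 * n" for x
    using bfs_complete[OF queue head assms(3) that(2,3)] that(1) by auto
  ultimately show ?thesis
    using queue by (auto simp: nearest_row_def bfs_queue_def not_le)
qed

lemma ball_subset_nearest_row: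
  assumes "nearest_row q s rw full" "full \<Longrightarrow> \<exists>i<q. r < d s (rw i)" "r < 2 * n" "x < n" "d s x \<le> r"
  shows "x \<in> rw ` {..<q}"
proof (cases full)
  case True
  then obtain i where "i < q" "d s x < d s (rw i)" using assms(2,5) by auto
  then show ?thesis using assms(1,4) True by (auto simp: nearest_row_def)
qed (use assms in \<open>auto simp: nearest_row_def\<close>)

end

section \<open>Occurrences in sequences\<close>

definition occurrences :: "(nat \<Rightarrow> 'b) \<Rightarrow> nat \<Rightarrow> 'b \<Rightarrow> nat" where
  "occurrences f j v = (\<Sum>i<j. of_bool (f i = v))"

lemma occurrences_0 [simp]: "occurrences f 0 v = 0"
  by (simp add: occurrences_def)

lemma occurrences_Suc [simp]: "occurrences f (Suc j) v = occurrences f j v + of_bool (f j = v)"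
  by (simp add: occurrences_def)

lemma occurrences_le: "occurrences f j v \<le> j"
  by (induction j) auto

lemma sum_occurrences:
  fixes n :: nat
  assumes "\<And>i. i < j \<Longrightarrow> f i < n"
  shows "(\<Sum>v<n. occurrences f j v) = j"
  using assms
proof (induction j)
  case (Suc j)
  have "(\<Sum>v<n. of_bool (f j = v)) = (1::nat)" using Suc.prems[of j] by (simp add: of_bool_def)
  then show ?case using Suc by (simp add: sum.distrib)
qed simp

lemma occurrences_inj_on: "inj_on f {..<j} \<Longrightarrow> occurrences f j v = of_bool (v \<in> f ` {..<j})"
proof (induction j)
  case (Suc j)
  then show ?case by (auto simp: lessThan_Suc)
qed simp

text \<open>One more than the position of the last occurrence, and \<open>0\<close> if there is none.\<close>

fun last_occurrence :: "(nat \<Rightarrow> 'b) \<Rightarrow> nat \<Rightarrow> 'b \<Rightarrow> nat" where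
  "last_occurrence f 0 v = 0"
| "last_occurrence f (Suc j) v = (if f j = v then Suc j else last_occurrence f j v)"

lemma last_occurrence_le: "last_occurrence f j v \<le> j"
  by (induction j) auto

lemma occurrences_last_occurrence: "occurrences f (last_occurrence f j v) v = occurrences f j v"
  by (induction j) auto

lemma last_occurrence_eq_Suc: "last_occurrence f j v = Suc e \<Longrightarrow> f e = v"
  by (induction j) (auto split: if_splits)

lemma last_occurrence_last: "last_occurrence f j v \<le> e \<Longrightarrow> e < j \<Longrightarrow> f e \<noteq> v"
  by (induction j) (auto simp: less_Suc_eq split: if_splits)

section \<open>Greedy hitting sets\<close>

definition hits :: "(nat \<Rightarrow> nat \<Rightarrow> nat) \<Rightarrow> nat \<Rightarrow> nat set \<Rightarrow> nat \<Rightarrow> nat" where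
  "hits rw q U u = (\<Sum>v\<in>U. occurrences (rw v) q u)"

lemma hits_empty [simp]: "hits rw q {} u = 0"
  by (simp add: hits_def)

lemma hits_insert [simp]: "finite U \<Longrightarrow> v \<notin> U \<Longrightarrow> hits rw q (insert v U) u = hits rw q U u + occurrences (rw v) q u"
  by (simp add: hits_def)

lemma hits_le: "hits rw q U u \<le> card U * q"
  using sum_mono[of U "\<lambda>v. occurrences (rw v) q u" "\<lambda>_. q"] by (simp add: hits_def occurrences_le)

lemma hits_eq_card:
  assumes "finite U" "\<And>v. v \<in> U \<Longrightarrow> inj_on (rw v) {..<q}"
  shows "hits rw q U u = card {v\<in>U. u \<in> rw v ` {..<q}}"
  using assms by (simp add: hits_def occurrences_inj_on of_bool_def sum.If_cases Int_def)

lemma card_mult_le_max_hits: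
  assumes "\<And>v i. v \<in> U \<Longrightarrow> i < q \<Longrightarrow> rw v i < n" "\<And>u. u < n \<Longrightarrow> hits rw q U u \<le> b"
  shows "card U * q \<le> n * b"
proof -
  have "card U * q = (\<Sum>v\<in>U. \<Sum>u<n. occurrences (rw v) q u)"
    using assms(1) by (simp add: sum_occurrences)
  also have "\<dots> = (\<Sum>u<n. hits rw q U u)" unfolding hits_def by (rule sum.swap)
  also have "\<dots> \<le> (\<Sum>u<n. b)" by (intro sum_mono assms(2)) simp
  finally show ?thesis by simp
qed

text \<open>Each greedy choice shrinks the number \<open>u\<close> of rows not yet hit by the factor \<open>1 - q / n\<close>.\<close>

definition greedy_potential :: "nat \<Rightarrow> nat \<Rightarrow> nat \<Rightarrow> real" where
  "greedy_potential n q u = (if u = 0 then 0 else real n / real q * (1 + ln (real u)))"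

lemma greedy_potential_nonneg: "0 \<le> greedy_potential n q u"
  by (simp add: greedy_potential_def)

lemma greedy_potential_ge_1:
  assumes "1 \<le> q" "q \<le> n" "1 \<le> u"
  shows "1 \<le> greedy_potential n q u"
proof -
  have "1 * 1 \<le> real n / real q * (1 + ln (real u))" using assms by (intro mult_mono) auto
  then show ?thesis using assms(3) by (simp add: greedy_potential_def)
qed

lemma greedy_potential_mono: "u \<le> v \<Longrightarrow> greedy_potential n q u \<le> greedy_potential n q v"
  by (auto simp: greedy_potential_def intro!: divide_right_mono mult_left_mono)

lemma greedy_potential_step:
  assumes "1 \<le> q" "q \<le> n" "1 \<le> u" "b \<le> u" "u * q \<le> n * b"
  shows "greedy_potential n q (u - b) + 1 \<le> greedy_potential n q u"
proof (cases "u = b")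
  case True
  then show ?thesis using greedy_potential_ge_1[OF assms(1-3)] by (simp add: greedy_potential_def)
next
  case False
  define v where "v = u - b"
  have v: "1 \<le> v" "real v = real u - real b" using False assms by (auto simp: v_def)
  have "real u * real q \<le> real n * real b" using assms(5) by (metis of_nat_mult of_nat_le_iff)
  then have ratio: "real q / real n \<le> real b / real u" using assms by (simp add: field_simps)
  have "ln (real v) - ln (real u) = ln (real v / real u)" using v assms by (simp add: ln_div)
  also have "\<dots> \<le> real v / real u - 1" using v assms by (intro ln_le_minus_one) auto
  also have "\<dots> = - (real b / real u)" using assms(3) unfolding v(2) by (simp add: diff_divide_distrib)
  also have "\<dots> \<le> - (real q / real n)" using ratio by simp
  finally have "ln (real v) \<le> ln (real u) - real q / real n" by simp
  then have "real n / real q * (1 + ln (real v)) \<le> real n / real q * (1 + (ln (real u) - real q / real n))"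
    by (intro mult_left_mono) auto
  also have "\<dots> = real n / real q * (1 + ln (real u)) - 1" using assms by (simp add: field_simps)
  finally show ?thesis using v assms by (simp add: greedy_potential_def flip: v_def)
qed

definition max_hitters :: "nat \<Rightarrow> nat \<Rightarrow> nat" where
  "max_hitters n q = nat \<lfloor>greedy_potential n q n\<rfloor>"

lemma le_max_hitters:
  assumes "real x + greedy_potential n q u \<le> greedy_potential n q n"
  shows "x \<le> max_hitters n q"
  using assms greedy_potential_nonneg[of n q u] by (simp add: max_hitters_def le_nat_floor)

section \<open>Memory layout\<close>

fun offset :: "('a \<Rightarrow> nat) \<Rightarrow> 'a list \<Rightarrow> 'a \<Rightarrow> nat" where
  "offset len [] A = 0"
| "offset len (B # Bs) A = (if A = B then 0 else len B + offset len Bs A)"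

lemma offset_inj:
  assumes "A \<in> set As" "B \<in> set As" "i < len A" "j < len B" "offset len As A + i = offset len As B + j"
  shows "A = B"
  using assms by (induction As) (auto split: if_splits)

lemma offset_less: "A \<in> set As \<Longrightarrow> i < len A \<Longrightarrow> offset len As A + i < sum_list (map len As)"
  by (induction As) (auto split: if_splits)

text \<open>\<open>src A\<close> is the register holding the length of \<open>A\<close>, register \<open>tmp_reg 0\<close> the next free address.\<close>

fun allocate :: "('a :: countable \<Rightarrow> nat) \<Rightarrow> 'a list \<Rightarrow> instr list" where
  "allocate src [] = []"
| "allocate src (A # As) = Move (len_reg A) (src A) # Move (base_reg A) (tmp_reg 0) #
     Bin OpAdd (tmp_reg 0) (tmp_reg 0) (src A) # allocate src As"

lemma reaches_allocate:
  fixes src :: "'a :: countable \<Rightarrow> nat"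
  assumes "distinct As" "\<And>A. A \<in> set As \<Longrightarrow> reg s (src A) = len A"
    and "reg s (tmp_reg 0) + sum_list (map len As) < 2 ^ w"
    and src: "\<And>A B :: 'a. src A \<noteq> len_reg B" "\<And>A B :: 'a. src A \<noteq> base_reg B" "\<And>A. src A \<noteq> tmp_reg 0"
  shows "\<exists>s'. reaches w (3 * length As) (allocate src As @ K, s) (K, s') \<and> mem s' = mem s \<and>
    (\<forall>A\<in>set As. reg s' (len_reg A) = len A \<and> reg s' (base_reg A) = reg s (tmp_reg 0) + offset len As A) \<and>
    (\<forall>x. x \<noteq> tmp_reg 0 \<longrightarrow> x \<notin> len_reg ` set As \<longrightarrow> x \<notin> base_reg ` set As \<longrightarrow> reg s' x = reg s x)"
  using assms(1-3)
proof (induction As arbitrary: s)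
  case Nil
  then show ?case by (auto intro: reaches_refl)
next
  case (Cons A As)
  define s1 where "s1 = set_reg (len_reg A) (len A) s"
  define s2 where "s2 = set_reg (base_reg A) (reg s (tmp_reg 0)) s1"
  define s3 where "s3 = set_reg (tmp_reg 0) (reg s (tmp_reg 0) + len A) s2"
  let ?K = "allocate src As @ K"
  have "reaches w 1 (allocate src (A # As) @ K, s)
      (Move (base_reg A) (tmp_reg 0) # Bin OpAdd (tmp_reg 0) (tmp_reg 0) (src A) # ?K, s1)"
    using Cons.prems(2)[of A] by (intro reaches_step) (simp add: s1_def)
  moreover have "reaches w 1 (Move (base_reg A) (tmp_reg 0) # Bin OpAdd (tmp_reg 0) (tmp_reg 0) (src A) # ?K, s1)
      (Bin OpAdd (tmp_reg 0) (tmp_reg 0) (src A) # ?K, s2)"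
    by (intro reaches_step) (simp add: s1_def s2_def)
  moreover have "reaches w 1 (Bin OpAdd (tmp_reg 0) (tmp_reg 0) (src A) # ?K, s2) (?K, s3)"
    using Cons.prems(2)[of A] Cons.prems(3) src by (intro reaches_step) (simp add: s1_def s2_def s3_def)
  ultimately have reaches_s3: "reaches w (1 + (1 + 1)) (allocate src (A # As) @ K, s) (?K, s3)"
    by (blast intro: reaches_trans)
  have s3: "reg s3 (tmp_reg 0) = reg s (tmp_reg 0) + len A" "reg s3 (len_reg A) = len A"
      "reg s3 (base_reg A) = reg s (tmp_reg 0)" "mem s3 = mem s"
      "\<And>x. x \<noteq> tmp_reg 0 \<Longrightarrow> x \<noteq> len_reg A \<Longrightarrow> x \<noteq> base_reg A \<Longrightarrow> reg s3 x = reg s x"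
    by (simp_all add: s1_def s2_def s3_def)
  have "reg s3 (src B) = len B" if "B \<in> set As" for B
    using Cons.prems(2)[of B] that src by (simp add: s3(5))
  then obtain s' where s': "reaches w (3 * length As) (?K, s3) (K, s')" "mem s' = mem s3"
      "\<forall>B\<in>set As. reg s' (len_reg B) = len B \<and> reg s' (base_reg B) = reg s3 (tmp_reg 0) + offset len As B"
      "\<forall>x. x \<noteq> tmp_reg 0 \<longrightarrow> x \<notin> len_reg ` set As \<longrightarrow> x \<notin> base_reg ` set As \<longrightarrow> reg s' x = reg s3 x"
    using Cons.IH[of s3] Cons.prems(1,3) s3(1) by auto
  have "reaches w (3 * length (A # As)) (allocate src (A # As) @ K, s) (K, s')"
    using reaches_trans[OF reaches_s3 s'(1)] by (simp add: One_nat_def eval_nat_numeral)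
  moreover have "len_reg A \<notin> len_reg ` set As" "len_reg A \<notin> base_reg ` set As"
    "base_reg A \<notin> len_reg ` set As" "base_reg A \<notin> base_reg ` set As"
    using Cons.prems(1) by auto
  then have "reg s' (len_reg A) = len A" "reg s' (base_reg A) = reg s (tmp_reg 0)"
    using s'(4) s3(2,3) by simp_all
  ultimately show ?case
    using s' s3 by (intro exI[of _ s']) auto
qed

datatype arr =
    Half | Prev | Head | Label | Queue | Dist | Near | Full | Count | Hit | HitDist | HitIndex | Need

datatype var =
    RowLen | Edge | Vert | Source | QHead | QTail | Cur | Nbr | Pos | MaxVert | Hitters
  | Threshold | Best | Ok | Found | Radius | Gap | Target | Reach | Lower | Upper | Fresh | Out
  | Center nat | Sol nat | Far nat | Choice nat

instance arr :: countable by countable_datatype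
instance var :: countable by countable_datatype

fun array_length :: "nat \<Rightarrow> nat \<Rightarrow> arr \<Rightarrow> nat" where
  "array_length n m Half = 2 * m"
| "array_length n m Prev = 2 * m"
| "array_length n m Dist = n * n"
| "array_length n m Near = n * n"
| "array_length n m A = n"

definition all_arrays :: "arr list" where
  "all_arrays = [Half, Prev, Head, Label, Queue, Dist, Near, Full, Count, Hit, HitDist, HitIndex, Need]"

lemma set_all_arrays: "A \<in> set all_arrays"
  by (cases A) (simp_all add: all_arrays_def)

abbreviation Size :: "(var, arr) expr" where "Size \<equiv> Len Head"

definition entry :: "(var, arr) expr \<Rightarrow> (var, arr) expr \<Rightarrow> (var, arr) expr" where
  "entry a b = a \<otimes> Size \<oplus> b"

lemma cost_entry [simp]: "cost (entry a b) = cost a + cost b + 3"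
  by (simp add: entry_def)

text \<open>For \<open>k = 1\<close> rows of length one make every vertex a member of the hitting set.\<close>

definition row_len :: "nat \<Rightarrow> nat \<Rightarrow> nat" where
  "row_len k n = (if k = 1 then 1 else LEAST q. n \<le> q * q)"

lemma row_len_bounds:
  assumes "1 \<le> n"
  shows "1 \<le> row_len k n" "row_len k n \<le> n"
    and "k \<noteq> 1 \<Longrightarrow> n \<le> row_len k n * row_len k n"
    and "k \<noteq> 1 \<Longrightarrow> p < row_len k n \<Longrightarrow> p * p < n"
proof -
  have "n \<le> n * n" using assms by simp
  then show square: "n \<le> row_len k n * row_len k n" if "k \<noteq> 1"
    unfolding row_len_def using LeastI[of "\<lambda>q. n \<le> q * q" n] that by simp
  show "1 \<le> row_len k n"
    using square assms by (cases "k = 1"; cases "row_len k n") (simp_all add: row_len_def)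
  show "row_len k n \<le> n"
    unfolding row_len_def using Least_le[of "\<lambda>q. n \<le> q * q" n] \<open>n \<le> n * n\<close> assms by simp
  show "p * p < n" if "k \<noteq> 1" "p < row_len k n"
    using that not_less_Least[of p "\<lambda>q. n \<le> q * q"] by (simp add: row_len_def)
qed

locale center_instance = finite_graph +
  fixes k :: nat and es :: "(nat \<times> nat) list" and w :: nat
  assumes k_pos: "1 \<le> k" and k_le: "k \<le> n"
    and listing: "edge_listing E es"
    and word: "100 * (n * n + n + length es + 1) \<le> 2 ^ w"
begin

abbreviation m :: nat where "m \<equiv> length es"

definition q :: nat where "q = row_len k n"

lemmas q_bounds = row_len_bounds[OF n_pos, of k, folded q_def]
lemmas q_pos = q_bounds(1) and q_le = q_bounds(2)

abbreviation len :: "arr \<Rightarrow> nat" where "len \<equiv> array_length n m"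

abbreviation WP :: "(var, arr) cmd \<Rightarrow> (nat \<Rightarrow> var store \<Rightarrow> arr arrays \<Rightarrow> bool) \<Rightarrow> nat \<Rightarrow>
    var store \<Rightarrow> arr arrays \<Rightarrow> bool" where
  "WP \<equiv> wp w len"

lemma memory_size: "sum_list (map len all_arrays) < 2 ^ w"
  using word by (simp add: all_arrays_def)

sublocale array_layout w "offset len all_arrays" len
proof
  show "A = B" if "i < len A" "j < len B" "offset len all_arrays A + i = offset len all_arrays B + j" for A B i j
    using offset_inj[OF set_all_arrays set_all_arrays that] .
  show "offset len all_arrays A + i < 2 ^ w" if "i < len A" for A i
    using offset_less[of A all_arrays i len] set_all_arrays that memory_size by (meson less_trans)
qed

lemma less_word [simp]: "1 < (2::nat) ^ w" "2 < (2::nat) ^ w" "n < 2 ^ w" "n * n < 2 ^ w" "2 * n < 2 ^ w" "2 * m < 2 ^ w"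
  using word by simp_all

lemma q_less_word [simp]: "q < 2 ^ w"
  using q_le less_word(3) by (rule le_less_trans)

definition cell :: "nat \<Rightarrow> nat \<Rightarrow> nat" where "cell u v = u * n + v"

lemma cell_less [simp]: "u < n \<Longrightarrow> v < n \<Longrightarrow> cell u v < n * n"
proof -
  assume "u < n" "v < n"
  then have "cell u v < Suc u * n" by (simp add: cell_def)
  also have "\<dots> \<le> n * n" using \<open>u < n\<close> by (intro mult_le_mono1) simp
  finally show ?thesis .
qed

lemma cell_eq_iff [simp]:
  assumes "v < n" "v' < n"
  shows "cell u v = cell u' v' \<longleftrightarrow> u = u' \<and> v = v'"
proof
  assume same_cell: "cell u v = cell u' v'"
  have "cell u v div n = u" "cell u v mod n = v" "cell u' v' div n = u'" "cell u' v' mod n = v'"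
    using assms by (simp_all add: cell_def)
  then show "u = u' \<and> v = v'" using same_cell by simp
qed simp

lemma val_entry [simp]: "val len (entry a b) \<sigma> \<mu> = cell (val len a \<sigma> \<mu>) (val len b \<sigma> \<mu>)"
  by (simp add: entry_def cell_def)

lemma safe_entry [simp]:
  assumes "safe w len a \<sigma> \<mu>" "safe w len b \<sigma> \<mu>" "val len a \<sigma> \<mu> < n" "val len b \<sigma> \<mu> < n"
  shows "safe w len (entry a b) \<sigma> \<mu>"
proof -
  have "cell (val len a \<sigma> \<mu>) (val len b \<sigma> \<mu>) < 2 ^ w" using cell_less[OF assms(3,4)] less_word(4) by (rule less_trans)
  then show ?thesis using assms by (simp add: entry_def cell_def)
qed

end

section \<open>The length of the rows\<close>

definition find_row_length :: "nat \<Rightarrow> (var, arr) cmd" where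
  "find_row_length k = RowLen ::= Lit 1 ;; (if k = 1 then Skip else
     WHILE Var RowLen \<otimes> Var RowLen \<lessdot> Size DO RowLen ::= Var RowLen \<oplus> Lit 1)"

context center_instance begin

lemma find_row_length_spec: "WP (find_row_length k) (\<lambda>_ \<sigma>' \<mu>'. \<sigma>' RowLen = q) (n * 10 + 8) \<sigma> \<mu>"
proof (cases "k = 1")
  case True
  then have "q = 1" unfolding q_def row_len_def by simp
  then show ?thesis
    using True by (auto simp: find_row_length_def intro!: wp_Seq wp_Assign wp_Skip)
next
  case False
  have "WP (WHILE Var RowLen \<otimes> Var RowLen \<lessdot> Size DO RowLen ::= Var RowLen \<oplus> Lit 1)
      (\<lambda>_ \<sigma>' \<mu>'. \<sigma>' RowLen = q) (n * 10 + 6) (\<sigma>(RowLen := 1)) \<mu>"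
  proof (rule wp_Loop[where I = "\<lambda>\<sigma>' \<mu>'. \<sigma>' RowLen \<le> q" and \<Phi> = "\<lambda>\<sigma>' \<mu>'. (n - \<sigma>' RowLen) * 10"])
    fix \<sigma>' :: "var store" and \<mu>' :: "arr arrays" assume "\<sigma>' RowLen \<le> q"
    then have row_le: "\<sigma>' RowLen \<le> n" using q_le by simp
    then have "\<sigma>' RowLen * \<sigma>' RowLen \<le> n * n" by (intro mult_le_mono)
    then show "safe w len (Var RowLen \<otimes> Var RowLen \<lessdot> Size) \<sigma>' \<mu>'" using word by simp
    assume test: "val len (Var RowLen \<otimes> Var RowLen \<lessdot> Size) \<sigma>' \<mu>' \<noteq> 0"
    have "\<sigma>' RowLen \<noteq> q" using test q_bounds(3)[OF False] by auto
    then have less: "\<sigma>' RowLen < q" using \<open>\<sigma>' RowLen \<le> q\<close> by simp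
    then have "n - \<sigma>' RowLen = Suc (n - (\<sigma>' RowLen + 1))" using q_le by simp
    then have potential: "(n - \<sigma>' RowLen) * 10 = (n - (\<sigma>' RowLen + 1)) * 10 + 10" by simp
    have "\<sigma>' RowLen + 1 < 2 ^ w" using row_le word by simp
    then show "cost (Var RowLen \<otimes> Var RowLen \<lessdot> Size :: (var, arr) expr) < (n - \<sigma>' RowLen) * 10 \<and>
        WP (RowLen ::= Var RowLen \<oplus> Lit 1) (\<lambda>t \<sigma>'' \<mu>''. \<sigma>'' RowLen \<le> q \<and> (n - \<sigma>'' RowLen) * 10 \<le> t)
          ((n - \<sigma>' RowLen) * 10 - (cost (Var RowLen \<otimes> Var RowLen \<lessdot> Size :: (var, arr) expr) + 1)) \<sigma>' \<mu>'"
      unfolding potential using less by (intro conjI wp_Assign) simp_all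
  next
    fix \<sigma>' :: "var store" and \<mu>' :: "arr arrays"
    assume "\<sigma>' RowLen \<le> q" "val len (Var RowLen \<otimes> Var RowLen \<lessdot> Size) \<sigma>' \<mu>' = 0"
    then show "\<sigma>' RowLen = q" using q_bounds(4)[OF False, of "\<sigma>' RowLen"] by (auto simp: le_less)
  qed (use q_pos in simp_all)
  then show ?thesis
    using False by (auto simp: find_row_length_def add.commute intro!: wp_Seq wp_Assign)
qed

end

section \<open>Adjacency lists\<close>

definition build_adjacency :: "(var, arr) cmd" where
  "build_adjacency = FOR Edge < Len Half DO (Vert ::= Half\<langle>Var Edge\<rangle> ;;
     Prev\<langle>Var Edge\<rangle> ::= Head\<langle>Var Vert\<rangle> ;; Head\<langle>Var Vert\<rangle> ::= Var Edge \<oplus> Lit 1)"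

lemma build_adjacency_frames [simp]:
  "writes build_adjacency = {Edge, Vert}" "stores build_adjacency = {Prev, Head}"
  by (auto simp: build_adjacency_def)

context center_instance begin

text \<open>Half-edge \<open>e\<close> leaves \<open>endpoint e\<close>; the half-edges \<open>2 * i\<close> and \<open>2 * i + 1\<close> form edge \<open>i\<close>.\<close>

definition endpoint :: "nat \<Rightarrow> nat" where
  "endpoint e = (if even e then fst (es ! (e div 2)) else snd (es ! (e div 2)))"

definition opposite :: "nat \<Rightarrow> nat" where
  "opposite e = e + 1 - 2 * (e mod 2)"

lemma opposite_less: "e < 2 * m \<Longrightarrow> opposite e < 2 * m"
  unfolding opposite_def by presburger

lemma opposite_no_overflow:
  assumes "e < 2 * m"
  shows "2 * (e mod 2) < 2 ^ w" "2 * (e mod 2) \<le> e + 1" "e + 1 < 2 ^ w"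
proof -
  have "2 * (e mod 2) \<le> 2" by simp
  then show "2 * (e mod 2) < 2 ^ w" using less_word(2) by (rule le_less_trans)
  show "2 * (e mod 2) \<le> e + 1" by presburger
  show "e + 1 < 2 ^ w" using assms word by simp
qed

lemma E_eq: "E = (\<lambda>x. {fst x, snd x}) ` set es"
  using listing by (simp add: edge_listing_def case_prod_beta)

lemma half_edge:
  assumes "e < 2 * m"
  shows "{endpoint e, endpoint (opposite e)} \<in> E"
proof -
  have "es ! (e div 2) \<in> set es" using assms by (intro nth_mem) linarith
  moreover have "{endpoint e, endpoint (opposite e)} = {fst (es ! (e div 2)), snd (es ! (e div 2))}"
  proof (cases "even e")
    case True
    then have "opposite e = e + 1" "odd (e + 1)" "(e + 1) div 2 = e div 2"
      by (auto simp: opposite_def even_iff_mod_2_eq_zero)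
    then show ?thesis using True by (simp add: endpoint_def)
  next
    case False
    then have "opposite e = e - 1" "even (e - 1)" "(e - 1) div 2 = e div 2"
      by (auto simp: opposite_def elim!: oddE)
    then show ?thesis using False by (simp add: endpoint_def insert_commute)
  qed
  ultimately show ?thesis by (simp add: E_eq)
qed

lemma half_edge_ex:
  assumes "{u, v} \<in> E"
  obtains e where "e < 2 * m" "endpoint e = u" "endpoint (opposite e) = v"
proof -
  obtain i where i: "i < m" "{u, v} = {fst (es ! i), snd (es ! i)}"
    using assms by (auto simp: E_eq in_set_conv_nth)
  have "endpoint (2 * i) = fst (es ! i)" "endpoint (2 * i + 1) = snd (es ! i)"
    "opposite (2 * i) = 2 * i + 1" "opposite (2 * i + 1) = 2 * i"
    by (auto simp: endpoint_def opposite_def)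
  then show thesis
    using i that[of "2 * i"] that[of "2 * i + 1"] by (auto simp: doubleton_eq_iff)
qed

lemma endpoint_less: "e < 2 * m \<Longrightarrow> endpoint e < n"
  using half_edge edge_less by blast

definition adjacency :: "arr arrays \<Rightarrow> bool" where
  "adjacency \<mu> \<longleftrightarrow> (\<forall>e<2 * m. \<mu> Half e = endpoint e \<and> \<mu> Prev e = last_occurrence endpoint e (endpoint e)) \<and>
     (\<forall>v<n. \<mu> Head v = last_occurrence endpoint (2 * m) v)"

lemma build_adjacency_spec:
  assumes "\<And>e. e < 2 * m \<Longrightarrow> \<mu> Half e = endpoint e" "\<And>v. v < n \<Longrightarrow> \<mu> Head v = 0"
  shows "WP build_adjacency (\<lambda>_ \<sigma>' \<mu>'. adjacency \<mu>') (2 * m * 24 + 6) \<sigma> \<mu>"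
proof -
  let ?I = "\<lambda>j (\<sigma>' :: var store) \<mu>'. (\<forall>e<2 * m. \<mu>' Half e = endpoint e) \<and>
    (\<forall>e<j. \<mu>' Prev e = last_occurrence endpoint e (endpoint e)) \<and> (\<forall>v<n. \<mu>' Head v = last_occurrence endpoint j v)"
  have "WP build_adjacency (\<lambda>_. ?I (2 * m)) (2 * m * 24 + 6) \<sigma> \<mu>"
    unfolding build_adjacency_def
  proof (rule wp_For[where I = ?I and N = "2 * m"])
    let ?body = "Vert ::= Half\<langle>Var Edge\<rangle> ;; Prev\<langle>Var Edge\<rangle> ::= Head\<langle>Var Vert\<rangle> ;; Head\<langle>Var Vert\<rangle> ::= Var Edge \<oplus> Lit 1"
    fix j \<sigma>' \<mu>' assume j: "j < 2 * m" "\<sigma>' Edge = j" and inv: "?I j \<sigma>' \<mu>'"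
    have "endpoint j < n" "j + 1 < 2 ^ w" using endpoint_less j(1) word by auto
    then show "WP ?body (\<lambda>_. ?I (Suc j)) 16 \<sigma>' \<mu>'"
      using j inv by (intro wp_Seq wp_Assign wp_Update) (auto simp: less_Suc_eq)
  qed (use assms word in auto)
  then show ?thesis by (rule wp_call) (auto simp: adjacency_def)
qed

end

section \<open>All-pairs shortest paths\<close>

definition visit_neighbor :: "(var, arr) cmd" where
  "visit_neighbor = IF Label\<langle>Var Nbr\<rangle> \<doteq> Lit 2 \<otimes> Size
     THEN (Label\<langle>Var Nbr\<rangle> ::= Label\<langle>Var Cur\<rangle> \<oplus> Lit 1 ;; Queue\<langle>Var QTail\<rangle> ::= Var Nbr ;; QTail ::= Var QTail \<oplus> Lit 1)
     ELSE Skip"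

definition scan_edge :: "(var, arr) cmd" where
  "scan_edge = Edge ::= Var Edge \<ominus> Lit 1 ;;
     Nbr ::= Half\<langle>Var Edge \<oplus> Lit 1 \<ominus> Lit 2 \<otimes> Opr OpMod (Var Edge) (Lit 2)\<rangle> ;; visit_neighbor ;;
     Edge ::= Prev\<langle>Var Edge\<rangle>"

definition scan_edges :: "(var, arr) cmd" where
  "scan_edges = WHILE Var Edge DO scan_edge"

definition init_bfs :: "(var, arr) cmd" where
  "init_bfs = FOR Vert < Size DO Label\<langle>Var Vert\<rangle> ::= Lit 2 \<otimes> Size ;; Queue\<langle>Lit 0\<rangle> ::= Var Source ;;
     Label\<langle>Var Source\<rangle> ::= Lit 0 ;; QHead ::= Lit 0 ;; QTail ::= Lit 1"

definition bfs_step :: "(var, arr) cmd" where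
  "bfs_step = Cur ::= Queue\<langle>Var QHead\<rangle> ;; Edge ::= Head\<langle>Var Cur\<rangle> ;; scan_edges ;; QHead ::= Var QHead \<oplus> Lit 1"

definition bfs :: "(var, arr) cmd" where
  "bfs = init_bfs ;; WHILE Var QHead \<lessdot> Var QTail DO bfs_step"

definition save_row :: "(var, arr) cmd" where
  "save_row = FOR Vert < Size DO (Dist\<langle>entry (Var Source) (Var Vert)\<rangle> ::= Label\<langle>Var Vert\<rangle> ;;
     Near\<langle>entry (Var Source) (Var Vert)\<rangle> ::= Queue\<langle>Var Vert\<rangle>) ;;
     Full\<langle>Var Source\<rangle> ::= (Var RowLen \<lessdot> Var QTail \<oplus> Lit 1)"

definition all_pairs :: "(var, arr) cmd" where
  "all_pairs = FOR Source < Size DO (bfs ;; save_row)"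

lemma all_pairs_frames [simp]:
  "writes visit_neighbor = {QTail}" "stores visit_neighbor = {Label, Queue}"
  "writes scan_edge = {Edge, Nbr, QTail}" "stores scan_edge = {Label, Queue}"
  "writes scan_edges = {Edge, Nbr, QTail}" "stores scan_edges = {Label, Queue}"
  "writes bfs_step = {Cur, Edge, Nbr, QTail, QHead}" "stores bfs_step = {Label, Queue}"
  "writes bfs = {Vert, QHead, QTail, Cur, Edge, Nbr}" "stores bfs = {Label, Queue}"
  "writes save_row = {Vert}" "stores save_row = {Dist, Near, Full}"
  "writes all_pairs = {Source, Vert, QHead, QTail, Cur, Edge, Nbr}"
  "stores all_pairs = {Label, Queue, Dist, Near, Full}"
proof -
  show visit: "writes visit_neighbor = {QTail}" "stores visit_neighbor = {Label, Queue}"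
    by (auto simp: visit_neighbor_def)
  show scan_edge: "writes scan_edge = {Edge, Nbr, QTail}" "stores scan_edge = {Label, Queue}"
    by (auto simp: scan_edge_def visit)
  then show scan: "writes scan_edges = {Edge, Nbr, QTail}" "stores scan_edges = {Label, Queue}"
    by (simp_all add: scan_edges_def)
  show step: "writes bfs_step = {Cur, Edge, Nbr, QTail, QHead}" "stores bfs_step = {Label, Queue}"
    by (auto simp: bfs_step_def scan)
  show bfs: "writes bfs = {Vert, QHead, QTail, Cur, Edge, Nbr}" "stores bfs = {Label, Queue}"
    by (auto simp: bfs_def init_bfs_def step)
  show save: "writes save_row = {Vert}" "stores save_row = {Dist, Near, Full}"
    by (auto simp: save_row_def)
  show "writes all_pairs = {Source, Vert, QHead, QTail, Cur, Edge, Nbr}"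
    "stores all_pairs = {Label, Queue, Dist, Near, Full}"
    by (auto simp: all_pairs_def bfs save)
qed

context center_instance begin

definition bfs_state :: "nat \<Rightarrow> nat \<Rightarrow> nat \<Rightarrow> arr arrays \<Rightarrow> bool" where
  "bfs_state s qh qt \<mu> \<longleftrightarrow> bfs_queue s qt (\<mu> Queue) (\<mu> Label) \<and> bfs_head s qh qt (\<mu> Queue) \<and> (\<forall>i<n. \<mu> Queue i < n)"

lemma visit_neighbor_spec:
  assumes "s < n" "bfs_state s qh qt \<mu>" "qh < qt" "{\<mu> Queue qh, u} \<in> E"
    and "\<sigma> QTail = qt" "\<sigma> Cur = \<mu> Queue qh" "\<sigma> Nbr = u"
  shows "WP visit_neighbor (\<lambda>_ \<sigma>' \<mu>'. bfs_state s qh (\<sigma>' QTail) \<mu>' \<and> qt \<le> \<sigma>' QTail \<and>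
     (\<forall>i<qt. \<mu>' Queue i = \<mu> Queue i) \<and> u \<in> \<mu>' Queue ` {..<\<sigma>' QTail}) 24 \<sigma> \<mu>"
proof -
  have queue: "bfs_queue s qt (\<mu> Queue) (\<mu> Label)" and head: "bfs_head s qh qt (\<mu> Queue)"
    and queue_less: "\<forall>i<n. \<mu> Queue i < n"
    using assms(2) by (auto simp: bfs_state_def)
  have vertices: "u < n" "\<mu> Queue qh < n" using assms(4) edge_less by blast+
  have "qt \<le> n" using bfs_queue_le[OF queue] .
  have "\<mu> Label (\<mu> Queue qh) \<le> 2 * n"
    using queue vertices(2) d_le_inf[OF assms(1)] by (auto simp: bfs_queue_def)
  then have label_less: "\<mu> Label (\<mu> Queue qh) + 1 < 2 ^ w" using word by simp
  have unlabelled: "\<mu> Label u = 2 * n \<longleftrightarrow> u \<notin> \<mu> Queue ` {..<qt}"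
    using queue vertices(1) by (auto simp: bfs_queue_def)
  show ?thesis
  proof (cases "u \<in> \<mu> Queue ` {..<qt}")
    case True
    then show ?thesis
      unfolding visit_neighbor_def using assms unlabelled vertices
      by (intro wp_Branch wp_Skip) auto
  next
    case False
    note push = bfs_push[OF queue head assms(3,1,4) False]
    have "qt < n" using bfs_queue_le[OF push(1)] by simp
    then show ?thesis
      unfolding visit_neighbor_def using assms(3,5-) unlabelled False vertices push queue_less label_less word
      by (intro wp_Branch wp_Seq wp_Assign wp_Update) (auto simp: bfs_state_def Suc_eq_plus1 less_Suc_eq)
  qed
qed

definition scan_invariant :: "nat \<Rightarrow> nat \<Rightarrow> (nat \<Rightarrow> nat) \<Rightarrow> var store \<Rightarrow> arr arrays \<Rightarrow> bool" where
  "scan_invariant s qh qu \<sigma> \<mu> \<longleftrightarrow> bfs_state s qh (\<sigma> QTail) \<mu> \<and> qh < \<sigma> QTail \<and> (\<forall>i\<le>qh. \<mu> Queue i = qu i) \<and>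
     \<sigma> Edge \<le> 2 * m \<and> (\<forall>e. \<sigma> Edge = Suc e \<longrightarrow> endpoint e = qu qh) \<and>
     (\<forall>e<2 * m. \<sigma> Edge \<le> e \<longrightarrow> endpoint e = qu qh \<longrightarrow> endpoint (opposite e) \<in> \<mu> Queue ` {..<\<sigma> QTail})"

lemma scan_edge_spec:
  assumes "s < n" "adjacency \<mu>" "scan_invariant s qh qu \<sigma> \<mu>" "\<sigma> Edge = Suc e" "\<sigma> Cur = qu qh"
  shows "WP scan_edge (\<lambda>_ \<sigma>' \<mu>'. scan_invariant s qh qu \<sigma>' \<mu>' \<and> \<sigma>' Edge = last_occurrence endpoint e (qu qh)) 44 \<sigma> \<mu>"
proof -
  let ?Q = "\<lambda>(_ :: nat) \<sigma>' \<mu>'. scan_invariant s qh qu \<sigma>' \<mu>' \<and> \<sigma>' Edge = last_occurrence endpoint e (qu qh)"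
  define \<sigma>1 where "\<sigma>1 = \<sigma>(Edge := e, Nbr := endpoint (opposite e))"
  have inv: "bfs_state s qh (\<sigma> QTail) \<mu>" "qh < \<sigma> QTail" "\<forall>i\<le>qh. \<mu> Queue i = qu i" "e < 2 * m" "endpoint e = qu qh"
    "\<And>e'. e' < 2 * m \<Longrightarrow> Suc e \<le> e' \<Longrightarrow> endpoint e' = qu qh \<Longrightarrow> endpoint (opposite e') \<in> \<mu> Queue ` {..<\<sigma> QTail}"
    using assms(3,4) by (auto simp: scan_invariant_def)
  have edge: "{\<mu> Queue qh, endpoint (opposite e)} \<in> E" using half_edge[OF inv(4)] inv(3,5) by simp
  have "WP (visit_neighbor ;; Edge ::= Prev\<langle>Var Edge\<rangle>) ?Q 28 \<sigma>1 \<mu>"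
  proof (rule wp_Seq, rule wp_call[OF visit_neighbor_spec[OF assms(1) inv(1,2) edge]])
    fix t :: nat and \<sigma>2 \<mu>2
    assume budget: "28 - 24 \<le> t" and frame: "\<And>x. x \<notin> writes visit_neighbor \<Longrightarrow> \<sigma>2 x = \<sigma>1 x"
      "\<And>A. A \<notin> stores visit_neighbor \<Longrightarrow> \<mu>2 A = \<mu> A"
      and visited: "bfs_state s qh (\<sigma>2 QTail) \<mu>2 \<and> \<sigma> QTail \<le> \<sigma>2 QTail \<and>
        (\<forall>i<\<sigma> QTail. \<mu>2 Queue i = \<mu> Queue i) \<and> endpoint (opposite e) \<in> \<mu>2 Queue ` {..<\<sigma>2 QTail}"
    have "\<sigma>2 Edge = e" using frame(1) by (simp add: \<sigma>1_def)
    moreover have prev: "\<mu>2 Prev e = last_occurrence endpoint e (qu qh)"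
      using frame(2)[of Prev] assms(2) inv(4,5) by (simp add: adjacency_def)
    moreover have "endpoint (opposite e') \<in> \<mu>2 Queue ` {..<\<sigma>2 QTail}"
      if e': "e' < 2 * m" "last_occurrence endpoint e (qu qh) \<le> e'" "endpoint e' = qu qh" for e'
    proof (cases "e' = e")
      case False
      then have "Suc e \<le> e'" using last_occurrence_last[OF e'(2)] e'(3) by (meson not_less_eq_eq linorder_neqE_nat less_eq_Suc_le)
      then obtain i where "i < \<sigma> QTail" "endpoint (opposite e') = \<mu> Queue i"
        using inv(6)[OF e'(1) _ e'(3)] by auto
      then show ?thesis using visited by (intro image_eqI[of _ _ i]) auto
    qed (use visited in simp)
    moreover have "qh < \<sigma>2 QTail" "\<forall>i\<le>qh. \<mu>2 Queue i = qu i" using visited inv(2,3) by auto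
    ultimately show "WP (Edge ::= Prev\<langle>Var Edge\<rangle>) ?Q t \<sigma>2 \<mu>2"
      using budget visited inv(4) last_occurrence_le[of endpoint e "qu qh"] last_occurrence_eq_Suc[of endpoint e "qu qh"]
      by (intro wp_Assign) (simp_all add: scan_invariant_def)
  qed (use inv(3) assms(5) in \<open>simp_all add: \<sigma>1_def\<close>)
  moreover have "\<mu> Half (opposite e) = endpoint (opposite e)"
    using assms(2) opposite_less[OF inv(4)] by (simp add: adjacency_def)
  ultimately show ?thesis
    using assms(4) opposite_no_overflow[OF inv(4)] opposite_less[OF inv(4)]
    unfolding scan_edge_def by (intro wp_Seq[of _ _ "Edge ::= _"] wp_Seq[of _ _ "Nbr ::= _"] wp_Assign)
      (simp_all add: \<sigma>1_def opposite_def)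
qed

lemma scan_edges_spec:
  assumes "s < n" "adjacency \<mu>" "bfs_state s qh (\<sigma> QTail) \<mu>" "qh < \<sigma> QTail"
    and "\<sigma> Cur = \<mu> Queue qh" "\<sigma> Edge = last_occurrence endpoint (2 * m) (\<mu> Queue qh)"
  shows "WP scan_edges (\<lambda>_ \<sigma>' \<mu>'. bfs_state s (Suc qh) (\<sigma>' QTail) \<mu>' \<and> qh < \<sigma>' QTail \<and>
      (\<forall>i\<le>qh. \<mu>' Queue i = \<mu> Queue i)) (46 * occurrences endpoint (2 * m) (\<mu> Queue qh) + 2) \<sigma> \<mu>"
  unfolding scan_edges_def
proof (rule wp_Loop[where I = "scan_invariant s qh (\<mu> Queue)" and
      \<Phi> = "\<lambda>\<sigma>' \<mu>'. 46 * occurrences endpoint (\<sigma>' Edge) (\<mu> Queue qh)"])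
  let ?v = "\<mu> Queue qh"
  show "scan_invariant s qh (\<mu> Queue) \<sigma> \<mu>"
    using assms by (auto simp: scan_invariant_def last_occurrence_le dest: last_occurrence_eq_Suc last_occurrence_last)
  show "46 * occurrences endpoint (\<sigma> Edge) ?v + cost (Var Edge) < 46 * occurrences endpoint (2 * m) ?v + 2"
    using assms(6) by (simp add: occurrences_last_occurrence)
  fix \<sigma>' \<mu>'
  assume frame: "\<And>x. x \<notin> writes scan_edge \<Longrightarrow> \<sigma>' x = \<sigma> x" "\<And>A. A \<notin> stores scan_edge \<Longrightarrow> \<mu>' A = \<mu> A"
    and inv: "scan_invariant s qh (\<mu> Queue) \<sigma>' \<mu>'"
  have adjacency': "adjacency \<mu>'" using assms(2) frame(2) by (simp add: adjacency_def)
  show "bfs_state s (Suc qh) (\<sigma>' QTail) \<mu>' \<and> qh < \<sigma>' QTail \<and>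
      (\<forall>i\<le>qh. \<mu>' Queue i = \<mu> Queue i)" if exit: "val len (Var Edge) \<sigma>' \<mu>' = 0"
  proof -
    have "u \<in> \<mu>' Queue ` {..<\<sigma>' QTail}" if "{\<mu>' Queue qh, u} \<in> E" for u
      using that inv exit by (auto simp: scan_invariant_def elim!: half_edge_ex)
    then have "bfs_head s (Suc qh) (\<sigma>' QTail) (\<mu>' Queue)"
      using inv assms(1) by (intro bfs_advance) (auto simp: scan_invariant_def bfs_state_def)
    then show ?thesis using inv by (auto simp: scan_invariant_def bfs_state_def)
  qed
  assume "val len (Var Edge) \<sigma>' \<mu>' \<noteq> 0"
  then obtain e where e: "\<sigma>' Edge = Suc e" by (cases "\<sigma>' Edge") auto
  then have "endpoint e = ?v" using inv by (simp add: scan_invariant_def)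
  then have potential: "46 * occurrences endpoint (\<sigma>' Edge) ?v = 46 * occurrences endpoint e ?v + 46" using e by simp
  have "\<sigma>' Cur = ?v" using frame(1) assms(5) by simp
  note body = scan_edge_spec[OF assms(1) adjacency' inv e this]
  show "cost (Var Edge) < 46 * occurrences endpoint (\<sigma>' Edge) ?v \<and>
      WP scan_edge (\<lambda>t \<sigma>'' \<mu>''. scan_invariant s qh (\<mu> Queue) \<sigma>'' \<mu>'' \<and> 46 * occurrences endpoint (\<sigma>'' Edge) ?v \<le> t)
        (46 * occurrences endpoint (\<sigma>' Edge) ?v - (cost (Var Edge) + 1)) \<sigma>' \<mu>'"
    unfolding potential by (intro conjI wp_call[OF body]) (auto simp: occurrences_last_occurrence)
qed simp

lemma init_bfs_spec:
  assumes "s < n" "\<sigma> Source = s" "\<forall>i<n. \<mu> Queue i < n"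
  shows "WP init_bfs (\<lambda>_ \<sigma>' \<mu>'. bfs_state s 0 1 \<mu>' \<and> \<sigma>' QHead = 0 \<and> \<sigma>' QTail = 1) (n * 14 + 18) \<sigma> \<mu>"
proof -
  let ?I = "\<lambda>j (\<sigma>' :: var store) \<mu>'. \<forall>u<j. \<mu>' Label u = 2 * n"
  have "WP (FOR Vert < Size DO Label\<langle>Var Vert\<rangle> ::= Lit 2 \<otimes> Size) (\<lambda>_. ?I n)
      (n * 14 + 6) \<sigma> \<mu>"
  proof (rule wp_For[where I = ?I and N = n])
    fix j and \<sigma>' :: "var store" and \<mu>' :: "arr arrays" assume "j < n" "\<sigma>' Vert = j" "?I j \<sigma>' \<mu>'"
    then show "WP (Label\<langle>Var Vert\<rangle> ::= Lit 2 \<otimes> Size) (\<lambda>_. ?I (Suc j)) 6 \<sigma>' \<mu>'"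
      by (intro wp_Update) (auto simp: less_Suc_eq)
  qed simp_all
  then show ?thesis
    unfolding init_bfs_def
  proof (rule wp_Seq[OF wp_call])
    fix t \<sigma>1 \<mu>1
    assume budget: "n * 14 + 18 - (n * 14 + 6) \<le> t" and labels: "\<forall>u<n. \<mu>1 Label u = 2 * n"
      and frame: "\<And>x. x \<notin> writes (FOR Vert < Size DO Label\<langle>Var Vert\<rangle> ::= Lit 2 \<otimes> Size) \<Longrightarrow> \<sigma>1 x = \<sigma> x"
        "\<And>A. A \<notin> stores (FOR Vert < Size DO Label\<langle>Var Vert\<rangle> ::= Lit 2 \<otimes> Size) \<Longrightarrow> \<mu>1 A = \<mu> A"
    let ?queue = "(\<mu>1 Queue)(0 := s)" and ?label = "(\<mu>1 Label)(s := 0)"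
    have "bfs_queue s 1 ?queue ?label" "bfs_head s 0 1 ?queue"
      using bfs_init[of s ?queue ?label] assms(1) labels by simp_all
    then show "WP (Queue\<langle>Lit 0\<rangle> ::= Var Source ;; Label\<langle>Var Source\<rangle> ::= Lit 0 ;; QHead ::= Lit 0 ;; QTail ::= Lit 1)
        (\<lambda>_ \<sigma>' \<mu>'. bfs_state s 0 1 \<mu>' \<and> \<sigma>' QHead = 0 \<and> \<sigma>' QTail = 1) t \<sigma>1 \<mu>1"
      using assms frame budget n_pos by (intro wp_Seq wp_Assign wp_Update) (simp_all add: bfs_state_def)
  qed simp
qed

definition bfs_invariant :: "nat \<Rightarrow> var store \<Rightarrow> arr arrays \<Rightarrow> bool" where
  "bfs_invariant s \<sigma> \<mu> \<longleftrightarrow> bfs_state s (\<sigma> QHead) (\<sigma> QTail) \<mu> \<and> \<sigma> QHead \<le> \<sigma> QTail"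

lemma bfs_step_spec:
  assumes "s < n" "adjacency \<mu>" "bfs_invariant s \<sigma> \<mu>" "\<sigma> QHead < \<sigma> QTail"
  shows "WP bfs_step (\<lambda>_ \<sigma>' \<mu>'. bfs_invariant s \<sigma>' \<mu>' \<and> \<sigma>' QHead = Suc (\<sigma> QHead) \<and> (\<forall>i\<le>\<sigma> QHead. \<mu>' Queue i = \<mu> Queue i))
    (46 * occurrences endpoint (2 * m) (\<mu> Queue (\<sigma> QHead)) + 14) \<sigma> \<mu>"
proof -
  let ?v = "\<mu> Queue (\<sigma> QHead)" and ?tail = "scan_edges ;; QHead ::= Var QHead \<oplus> Lit 1"
  let ?Q = "\<lambda>(_ :: nat) \<sigma>' \<mu>'. bfs_invariant s \<sigma>' \<mu>' \<and> \<sigma>' QHead = Suc (\<sigma> QHead) \<and>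
    (\<forall>i\<le>\<sigma> QHead. \<mu>' Queue i = \<mu> Queue i)"
  define \<sigma>1 where "\<sigma>1 = \<sigma>(Cur := ?v, Edge := last_occurrence endpoint (2 * m) ?v)"
  have state: "bfs_state s (\<sigma> QHead) (\<sigma> QTail) \<mu>" using assms(3) by (simp add: bfs_invariant_def)
  have "\<sigma> QTail \<le> n" using state bfs_queue_le by (auto simp: bfs_state_def)
  then have bounds: "\<sigma> QHead < n" "?v < n" "\<sigma> QHead + 1 < 2 ^ w"
    using state assms(4) word by (auto simp: bfs_state_def)
  have "WP ?tail ?Q (46 * occurrences endpoint (2 * m) ?v + 6) \<sigma>1 \<mu>"
  proof (rule wp_Seq, rule wp_call[OF scan_edges_spec[OF assms(1,2)]])
    fix t \<sigma>2 \<mu>2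
    assume budget: "46 * occurrences endpoint (2 * m) ?v + 6 - (46 * occurrences endpoint (2 * m) ?v + 2) \<le> t"
      and "\<And>x. x \<notin> writes scan_edges \<Longrightarrow> \<sigma>2 x = \<sigma>1 x"
      and scanned: "bfs_state s (Suc (\<sigma> QHead)) (\<sigma>2 QTail) \<mu>2 \<and> \<sigma> QHead < \<sigma>2 QTail \<and>
        (\<forall>i\<le>\<sigma> QHead. \<mu>2 Queue i = \<mu> Queue i)"
    then have "\<sigma>2 QHead = \<sigma> QHead" by (simp add: \<sigma>1_def)
    then show "WP (QHead ::= Var QHead \<oplus> Lit 1) ?Q t \<sigma>2 \<mu>2"
      using budget scanned bounds(3) by (intro wp_Assign) (simp_all add: bfs_invariant_def flip: Suc_eq_plus1)
  qed (use state assms(4) in \<open>simp_all add: \<sigma>1_def\<close>)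
  moreover have "\<mu> Head ?v = last_occurrence endpoint (2 * m) ?v"
    using assms(2) bounds(2) by (simp add: adjacency_def)
  ultimately show ?thesis
    using bounds(1,2) unfolding bfs_step_def by (intro wp_Seq[of _ _ "Cur ::= _"] wp_Seq[of _ _ "Edge ::= _"] wp_Assign)
      (simp_all add: \<sigma>1_def add.commute)
qed

lemma sum_unscanned:
  fixes f :: "nat \<Rightarrow> nat"
  assumes "bfs_queue s qt qu lab" "qh < qt"
  shows "sum f ({..<n} - qu ` {..<qh}) = f (qu qh) + sum f ({..<n} - qu ` {..<Suc qh})"
proof -
  have "qu qh < n" "qu qh \<notin> qu ` {..<qh}"
    using assms inj_on_image_mem_iff[of qu "{..<qt}" qh "{..<qh}"] by (auto simp: bfs_queue_def)
  then have unscanned: "{..<n} - qu ` {..<qh} = insert (qu qh) ({..<n} - qu ` {..<Suc qh})"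
    by (auto simp: lessThan_Suc)
  show ?thesis unfolding unscanned by (rule sum.insert) simp_all
qed

lemma bfs_spec:
  assumes "s < n" "\<sigma> Source = s" "adjacency \<mu>" "\<forall>i<n. \<mu> Queue i < n"
  shows "WP bfs (\<lambda>_ \<sigma>' \<mu>'. bfs_state s (\<sigma>' QTail) (\<sigma>' QTail) \<mu>') (92 * m + 32 * n + 22) \<sigma> \<mu>"
  unfolding bfs_def
proof (rule wp_Seq, rule wp_call[OF init_bfs_spec[of s \<sigma> \<mu>, OF assms(1,2,4)]])
  let ?f = "\<lambda>v. 46 * occurrences endpoint (2 * m) v + 18"
  let ?\<Phi> = "\<lambda>(\<sigma>' :: var store) \<mu>'. sum ?f ({..<n} - \<mu>' Queue ` {..<\<sigma>' QHead})"
  let ?test = "Var QHead \<lessdot> Var QTail"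
  have total: "sum ?f {..<n} = 92 * m + 18 * n"
    using sum_occurrences[of "2 * m" endpoint n] endpoint_less by (simp add: sum.distrib flip: sum_distrib_left)
  fix t and \<sigma>1 :: "var store" and \<mu>1
  assume budget: "92 * m + 32 * n + 22 - (n * 14 + 18) \<le> t"
    and init: "bfs_state s 0 1 \<mu>1 \<and> \<sigma>1 QHead = 0 \<and> \<sigma>1 QTail = 1"
    and frame: "\<And>A. A \<notin> stores init_bfs \<Longrightarrow> \<mu>1 A = \<mu> A"
  show "WP (WHILE ?test DO bfs_step) (\<lambda>_ \<sigma>' \<mu>'. bfs_state s (\<sigma>' QTail) (\<sigma>' QTail) \<mu>') t \<sigma>1 \<mu>1"
  proof (rule wp_Loop[where I = "bfs_invariant s" and \<Phi> = ?\<Phi>])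
    show "bfs_invariant s \<sigma>1 \<mu>1" using init by (simp add: bfs_invariant_def)
    show "?\<Phi> \<sigma>1 \<mu>1 + cost ?test < t" using budget init total by simp
    fix \<sigma>' \<mu>'
    assume frame': "\<And>A. A \<notin> stores bfs_step \<Longrightarrow> \<mu>' A = \<mu>1 A" and inv: "bfs_invariant s \<sigma>' \<mu>'"
    then show "bfs_state s (\<sigma>' QTail) (\<sigma>' QTail) \<mu>'" if "val len ?test \<sigma>' \<mu>' = 0"
      using that by (auto simp: bfs_invariant_def)
    assume "val len ?test \<sigma>' \<mu>' \<noteq> 0"
    then have less: "\<sigma>' QHead < \<sigma>' QTail" by (simp split: if_splits)
    have adjacency': "adjacency \<mu>'" using assms(3) frame frame' by (simp add: adjacency_def init_bfs_def)
    have potential: "?\<Phi> \<sigma>' \<mu>' = ?f (\<mu>' Queue (\<sigma>' QHead)) + sum ?f ({..<n} - \<mu>' Queue ` {..<Suc (\<sigma>' QHead)})"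
      using inv less by (intro sum_unscanned) (auto simp: bfs_invariant_def bfs_state_def)
    have "WP bfs_step (\<lambda>t \<sigma>'' \<mu>''. bfs_invariant s \<sigma>'' \<mu>'' \<and> ?\<Phi> \<sigma>'' \<mu>'' \<le> t) (?\<Phi> \<sigma>' \<mu>' - (cost ?test + 1)) \<sigma>' \<mu>'"
    proof (rule wp_call[OF bfs_step_spec[OF assms(1) adjacency' inv less]])
      fix t \<sigma>2 \<mu>2
      assume budget: "?\<Phi> \<sigma>' \<mu>' - (cost ?test + 1) - (46 * occurrences endpoint (2 * m) (\<mu>' Queue (\<sigma>' QHead)) + 14) \<le> t"
        and post: "bfs_invariant s \<sigma>2 \<mu>2 \<and> \<sigma>2 QHead = Suc (\<sigma>' QHead) \<and> (\<forall>i\<le>\<sigma>' QHead. \<mu>2 Queue i = \<mu>' Queue i)"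
      then have "\<mu>2 Queue ` {..<\<sigma>2 QHead} = \<mu>' Queue ` {..<Suc (\<sigma>' QHead)}" by (intro image_cong) auto
      then show "bfs_invariant s \<sigma>2 \<mu>2 \<and> ?\<Phi> \<sigma>2 \<mu>2 \<le> t" using budget post unfolding potential by simp
    qed (simp add: potential)
    then show "cost ?test < ?\<Phi> \<sigma>' \<mu>' \<and>
        WP bfs_step (\<lambda>t \<sigma>'' \<mu>''. bfs_invariant s \<sigma>'' \<mu>'' \<and> ?\<Phi> \<sigma>'' \<mu>'' \<le> t) (?\<Phi> \<sigma>' \<mu>' - (cost ?test + 1)) \<sigma>' \<mu>'"
      by (simp add: potential)
  qed simp
qed simp

definition row_saved :: "nat \<Rightarrow> arr arrays \<Rightarrow> bool" where
  "row_saved s \<mu> \<longleftrightarrow> (\<forall>u<n. \<mu> Dist (cell s u) = d s u \<and> \<mu> Near (cell s u) < n) \<and>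
     nearest_row q s (\<lambda>i. \<mu> Near (cell s i)) (\<mu> Full s \<noteq> 0)"

lemma row_saved_cong:
  assumes "\<And>u. u < n \<Longrightarrow> \<mu> Dist (cell s u) = \<mu>' Dist (cell s u) \<and> \<mu> Near (cell s u) = \<mu>' Near (cell s u)"
    and "\<mu> Full s = \<mu>' Full s"
  shows "row_saved s \<mu> \<longleftrightarrow> row_saved s \<mu>'"
proof -
  have "nearest_row q s (\<lambda>i. \<mu> Near (cell s i)) full = nearest_row q s (\<lambda>i. \<mu>' Near (cell s i)) full" for full
    using assms(1) q_pos q_le by (intro nearest_row_cong) auto
  then show ?thesis using assms by (auto simp: row_saved_def)
qed

lemma save_row_spec:
  assumes "s < n" "\<sigma> Source = s" "\<sigma> RowLen = q" and bfs: "bfs_state s (\<sigma> QTail) (\<sigma> QTail) \<mu>"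
  shows "WP save_row (\<lambda>_ \<sigma>' \<mu>'. row_saved s \<mu>' \<and> (\<forall>s'<n. s' \<noteq> s \<longrightarrow> row_saved s' \<mu>' = row_saved s' \<mu>))
    (n * 28 + 14) \<sigma> \<mu>"
proof -
  let ?body = "Dist\<langle>entry (Var Source) (Var Vert)\<rangle> ::= Label\<langle>Var Vert\<rangle> ;; Near\<langle>entry (Var Source) (Var Vert)\<rangle> ::= Queue\<langle>Var Vert\<rangle>"
  let ?I = "\<lambda>j (\<sigma>' :: var store) \<mu>'. \<forall>s'<n. \<forall>u<n.
    \<mu>' Dist (cell s' u) = (if s' = s \<and> u < j then \<mu> Label u else \<mu> Dist (cell s' u)) \<and>
    \<mu>' Near (cell s' u) = (if s' = s \<and> u < j then \<mu> Queue u else \<mu> Near (cell s' u))"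
  have "WP (FOR Vert < Size DO ?body) (\<lambda>_. ?I n) (n * 28 + 6) \<sigma> \<mu>"
  proof (rule wp_For[where I = ?I and N = n])
    fix j \<sigma>' \<mu>'
    assume j: "j < n" "\<sigma>' Vert = j" and frame: "\<And>y. y \<noteq> Vert \<Longrightarrow> y \<notin> writes ?body \<Longrightarrow> \<sigma>' y = \<sigma> y"
      "\<And>A. A \<notin> stores ?body \<Longrightarrow> \<mu>' A = \<mu> A" and inv: "?I j \<sigma>' \<mu>'"
    have "\<sigma>' Source = s" "\<mu>' Label = \<mu> Label" "\<mu>' Queue = \<mu> Queue" using frame assms(2) by simp_all
    then show "WP ?body (\<lambda>_. ?I (Suc j)) 20 \<sigma>' \<mu>'"
      using j inv assms(1) by (intro wp_Seq wp_Update) (auto simp: less_Suc_eq)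
  qed simp_all
  then show ?thesis
    unfolding save_row_def
  proof (rule wp_Seq[OF wp_call])
    fix t \<sigma>1 \<mu>1
    assume budget: "n * 28 + 14 - (n * 28 + 6) \<le> t" and copied: "?I n \<sigma>1 \<mu>1"
      and frame: "\<And>x. x \<notin> writes (FOR Vert < Size DO ?body) \<Longrightarrow> \<sigma>1 x = \<sigma> x"
        "\<And>A. A \<notin> stores (FOR Vert < Size DO ?body) \<Longrightarrow> \<mu>1 A = \<mu> A"
    define \<mu>2 where "\<mu>2 = \<mu>1(Full := (\<mu>1 Full)(s := of_bool (q < \<sigma> QTail + 1)))"
    have queue: "bfs_queue s (\<sigma> QTail) (\<mu> Queue) (\<mu> Label)" "bfs_head s (\<sigma> QTail) (\<sigma> QTail) (\<mu> Queue)"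
      and queue_less: "\<forall>i<n. \<mu> Queue i < n"
      using bfs by (auto simp: bfs_state_def)
    have "nearest_row q s (\<lambda>i. \<mu>1 Near (cell s i)) (q \<le> \<sigma> QTail)"
      using bfs_nearest_row[OF queue assms(1), of q] copied assms(1) q_pos q_le
      by (subst nearest_row_cong[where rw' = "\<mu> Queue"]) auto
    then have "row_saved s \<mu>2"
      using copied assms(1) bfs_labels[OF queue assms(1)] queue_less
      by (auto simp: row_saved_def \<mu>2_def less_Suc_eq_le simp flip: Suc_eq_plus1)
    moreover have "row_saved s' \<mu>2 = row_saved s' \<mu>" if "s' < n" "s' \<noteq> s" for s'
      using copied that frame(2) by (intro row_saved_cong) (auto simp: \<mu>2_def)
    moreover have "\<sigma> QTail + 1 < 2 ^ w" using bfs_queue_le[OF queue(1)] word by simp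
    ultimately show "WP (Full\<langle>Var Source\<rangle> ::= (Var RowLen \<lessdot> Var QTail \<oplus> Lit 1))
       (\<lambda>_ \<sigma>' \<mu>'. row_saved s \<mu>' \<and> (\<forall>s'<n. s' \<noteq> s \<longrightarrow> row_saved s' \<mu>' = row_saved s' \<mu>)) t \<sigma>1 \<mu>1"
      using assms(1-3) frame budget by (intro wp_Update) (auto simp: \<mu>2_def)
  qed simp
qed

lemma all_pairs_spec:
  assumes "\<sigma> RowLen = q" "adjacency \<mu>" "\<forall>i<n. \<mu> Queue i < n"
  shows "WP all_pairs (\<lambda>_ \<sigma>' \<mu>'. \<forall>s<n. row_saved s \<mu>') (n * (92 * m + 60 * n + 44) + 6) \<sigma> \<mu>"
proof -
  let ?I = "\<lambda>j (\<sigma>' :: var store) \<mu>'. (\<forall>s<j. row_saved s \<mu>') \<and> (\<forall>i<n. \<mu>' Queue i < n)"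
  have "WP all_pairs (\<lambda>_. ?I n) (n * (92 * m + 60 * n + 44) + 6) \<sigma> \<mu>"
    unfolding all_pairs_def
  proof (rule wp_For[where I = ?I and N = n])
    fix j \<sigma>' \<mu>'
    assume j: "j < n" "\<sigma>' Source = j" and frame: "\<And>y. y \<noteq> Source \<Longrightarrow> y \<notin> writes (bfs ;; save_row) \<Longrightarrow> \<sigma>' y = \<sigma> y"
      "\<And>A. A \<notin> stores (bfs ;; save_row) \<Longrightarrow> \<mu>' A = \<mu> A" and inv: "?I j \<sigma>' \<mu>'"
    have adjacency': "adjacency \<mu>'" using assms(2) frame(2) by (simp add: adjacency_def)
    have queue_less: "\<forall>i<n. \<mu>' Queue i < n" using inv by blast
    show "WP (bfs ;; save_row) (\<lambda>_. ?I (Suc j)) (92 * m + 60 * n + 36) \<sigma>' \<mu>'"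
    proof (rule wp_Seq, rule wp_call[OF bfs_spec[of j \<sigma>' \<mu>', OF j adjacency' queue_less]])
      fix t \<sigma>1 \<mu>1
      assume budget: "92 * m + 60 * n + 36 - (92 * m + 32 * n + 22) \<le> t"
        and frame1: "\<And>x. x \<notin> writes bfs \<Longrightarrow> \<sigma>1 x = \<sigma>' x" "\<And>A. A \<notin> stores bfs \<Longrightarrow> \<mu>1 A = \<mu>' A"
        and state: "bfs_state j (\<sigma>1 QTail) (\<sigma>1 QTail) \<mu>1"
      have saved1: "row_saved s \<mu>1 = row_saved s \<mu>'" for s
        using frame1(2) by (intro row_saved_cong) auto
      have regs: "\<sigma>1 Source = j" "\<sigma>1 RowLen = q" using j frame(1) frame1(1) assms(1) by simp_all
      show "WP save_row (\<lambda>_. ?I (Suc j)) t \<sigma>1 \<mu>1"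
        by (rule wp_call[OF save_row_spec[of j \<sigma>1 \<mu>1, OF j(1) regs state]])
          (use budget inv j(1) saved1 state in \<open>auto simp: less_Suc_eq bfs_state_def\<close>)
    qed simp
  qed (use assms in simp_all)
  then show ?thesis by (rule wp_call) (auto simp: algebra_simps)
qed

end

section \<open>Selecting the hitting set\<close>

definition count_row :: "(var, arr) cmd" where
  "count_row = FOR Pos < Var RowLen DO
     (Nbr ::= Near\<langle>entry (Var Vert) (Var Pos)\<rangle> ;; Count\<langle>Var Nbr\<rangle> ::= Count\<langle>Var Nbr\<rangle> \<oplus> Lit 1)"

definition count_hits :: "(var, arr) cmd" where
  "count_hits = FOR Vert < Size DO Count\<langle>Var Vert\<rangle> ::= Lit 0 ;;
     FOR Vert < Size DO IF Full\<langle>Var Vert\<rangle> THEN count_row ELSE Skip"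

definition find_max :: "(var, arr) cmd" where
  "find_max = MaxVert ::= Lit 0 ;; FOR Vert < Size DO
     IF Count\<langle>Var MaxVert\<rangle> \<lessdot> Count\<langle>Var Vert\<rangle> THEN MaxVert ::= Var Vert ELSE Skip"

definition count_and_max :: "(var, arr) cmd" where
  "count_and_max = count_hits ;; find_max"

definition clear_hit :: "(var, arr) cmd" where
  "clear_hit = FOR Vert < Size DO FOR Pos < Var RowLen DO
     IF Near\<langle>entry (Var Vert) (Var Pos)\<rangle> \<doteq> Var MaxVert THEN Full\<langle>Var Vert\<rangle> ::= Lit 0 ELSE Skip"

definition add_hitter :: "(var, arr) cmd" where
  "add_hitter = Hit\<langle>Var Hitters\<rangle> ::= Var MaxVert ;; Hitters ::= Var Hitters \<oplus> Lit 1 ;; clear_hit ;; count_and_max"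

definition select_hitters :: "(var, arr) cmd" where
  "select_hitters = Hitters ::= Lit 0 ;; count_and_max ;; WHILE Count\<langle>Var MaxVert\<rangle> DO add_hitter"

lemma select_hitters_frames [simp]:
  "writes count_row = {Pos, Nbr}" "stores count_row = {Count}"
  "writes count_hits = {Vert, Pos, Nbr}" "stores count_hits = {Count}"
  "writes find_max = {MaxVert, Vert}" "stores find_max = {}"
  "writes count_and_max = {Vert, Pos, Nbr, MaxVert}" "stores count_and_max = {Count}"
  "writes clear_hit = {Vert, Pos}" "stores clear_hit = {Full}"
  "writes add_hitter = {Hitters, Vert, Pos, Nbr, MaxVert}" "stores add_hitter = {Count, Hit, Full}"
  "writes select_hitters = {Hitters, Vert, Pos, Nbr, MaxVert}" "stores select_hitters = {Count, Hit, Full}"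
proof -
  show row: "writes count_row = {Pos, Nbr}" "stores count_row = {Count}"
    by (auto simp: count_row_def)
  show hits: "writes count_hits = {Vert, Pos, Nbr}" "stores count_hits = {Count}"
    by (auto simp: count_hits_def row)
  show max: "writes find_max = {MaxVert, Vert}" "stores find_max = {}"
    by (auto simp: find_max_def)
  show count: "writes count_and_max = {Vert, Pos, Nbr, MaxVert}" "stores count_and_max = {Count}"
    by (auto simp: count_and_max_def hits max)
  show clear: "writes clear_hit = {Vert, Pos}" "stores clear_hit = {Full}"
    by (auto simp: clear_hit_def)
  show hitter: "writes add_hitter = {Hitters, Vert, Pos, Nbr, MaxVert}" "stores add_hitter = {Count, Hit, Full}"
    by (auto simp: add_hitter_def count clear)
  show "writes select_hitters = {Hitters, Vert, Pos, Nbr, MaxVert}" "stores select_hitters = {Count, Hit, Full}"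
    by (auto simp: select_hitters_def count hitter)
qed

context center_instance begin

definition near_row :: "arr arrays \<Rightarrow> nat \<Rightarrow> nat \<Rightarrow> nat" where
  "near_row \<mu> v i = \<mu> Near (cell v i)"

definition unhit :: "arr arrays \<Rightarrow> nat set" where
  "unhit \<mu> = {v. v < n \<and> \<mu> Full v \<noteq> 0}"

lemma unhit_less: "v \<in> unhit \<mu> \<Longrightarrow> v < n"
  by (simp add: unhit_def)

lemma finite_unhit [simp]: "finite (unhit \<mu>)"
  by (simp add: unhit_def)

lemma card_unhit_le: "card (unhit \<mu>) \<le> n"
  using card_mono[of "{..<n}" "unhit \<mu>"] by (auto simp: unhit_def)

lemma near_row_less: "row_saved v \<mu> \<Longrightarrow> i < q \<Longrightarrow> near_row \<mu> v i < n"
  using q_le by (simp add: row_saved_def near_row_def)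

lemma near_row_inj_on: "row_saved v \<mu> \<Longrightarrow> v \<in> unhit \<mu> \<Longrightarrow> inj_on (near_row \<mu> v) {..<q}"
  unfolding near_row_def by (simp add: row_saved_def nearest_row_def unhit_def)

lemma count_row_spec:
  assumes "\<forall>v<n. \<forall>i<q. near_row \<mu> v i < n" "j < n" "\<sigma> Vert = j" "\<sigma> RowLen = q" "\<mu> Full j \<noteq> 0"
    and "\<forall>u<n. \<mu> Count u = hits (near_row \<mu>) q {v\<in>unhit \<mu>. v < j} u"
  shows "WP count_row (\<lambda>_ \<sigma>' \<mu>'. \<forall>u<n. \<mu>' Count u = hits (near_row \<mu>) q {v\<in>unhit \<mu>. v < Suc j} u) (q * 24 + 6) \<sigma> \<mu>"
proof -
  let ?U = "{v\<in>unhit \<mu>. v < j}"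
  let ?I = "\<lambda>i (\<sigma>' :: var store) \<mu>'. \<forall>u<n. \<mu>' Count u = hits (near_row \<mu>) q ?U u + occurrences (near_row \<mu> j) i u"
  let ?body = "Nbr ::= Near\<langle>entry (Var Vert) (Var Pos)\<rangle> ;; Count\<langle>Var Nbr\<rangle> ::= Count\<langle>Var Nbr\<rangle> \<oplus> Lit 1"
  have "card ?U \<le> card {..<j}" by (intro card_mono) auto
  then have "card ?U * q \<le> n * n" using assms(2) q_le by (intro mult_le_mono) auto
  then have hits_bound: "hits (near_row \<mu>) q ?U u \<le> n * n" for u
    using hits_le le_trans by blast
  have "WP count_row (\<lambda>_. ?I q) (q * 24 + 6) \<sigma> \<mu>"
    unfolding count_row_def
  proof (rule wp_For[where I = ?I and N = q])
    fix i \<sigma>' \<mu>'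
    assume i: "i < q" "\<sigma>' Pos = i" and frame: "\<And>y. y \<noteq> Pos \<Longrightarrow> y \<notin> writes ?body \<Longrightarrow> \<sigma>' y = \<sigma> y"
      "\<And>A. A \<notin> stores ?body \<Longrightarrow> \<mu>' A = \<mu> A" and inv: "?I i \<sigma>' \<mu>'"
    have "near_row \<mu> j i < n" using assms(1,2) i(1) by blast
    moreover have "\<mu>' Near (cell j i) = near_row \<mu> j i" "\<sigma>' Vert = j" using frame assms(3) by (simp_all add: near_row_def)
    moreover have "\<mu>' Count (near_row \<mu> j i) + 1 < 2 ^ w"
      using inv \<open>near_row \<mu> j i < n\<close> hits_bound[of "near_row \<mu> j i"] occurrences_le[of "near_row \<mu> j" i "near_row \<mu> j i"]
        i(1) q_le word by simp
    ultimately show "WP ?body (\<lambda>_. ?I (Suc i)) 16 \<sigma>' \<mu>'"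
      using i inv assms(2) q_le by (intro wp_Seq wp_Assign wp_Update) auto
  qed (use assms q_le in auto)
  moreover have "{v\<in>unhit \<mu>. v < Suc j} = insert j ?U" using assms(2,5) by (auto simp: unhit_def)
  ultimately show ?thesis by (elim wp_call) auto
qed

lemma count_hits_spec:
  assumes "\<forall>v<n. \<forall>i<q. near_row \<mu> v i < n" "\<sigma> RowLen = q"
  shows "WP count_hits (\<lambda>_ \<sigma>' \<mu>'. \<forall>u<n. \<mu>' Count u = hits (near_row \<mu>) q (unhit \<mu>) u) (n * (24 * q + 30) + 12) \<sigma> \<mu>"
proof -
  let ?reset = "FOR Vert < Size DO Count\<langle>Var Vert\<rangle> ::= Lit 0"
  let ?body = "IF Full\<langle>Var Vert\<rangle> THEN count_row ELSE Skip"
  let ?I = "\<lambda>j (\<sigma>' :: var store) \<mu>'. \<forall>u<n. \<mu>' Count u = hits (near_row \<mu>) q {v\<in>unhit \<mu>. v < j} u"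
  have reset: "WP ?reset (\<lambda>_ \<sigma>' \<mu>'. \<forall>u<n. \<mu>' Count u = 0) (n * 12 + 6) \<sigma> \<mu>"
    by (rule wp_For[where I = "\<lambda>j \<sigma>' \<mu>'. \<forall>u<j. \<mu>' Count u = 0" and N = n])
      (auto simp: less_Suc_eq intro!: wp_Update)
  have count: "WP (FOR Vert < Size DO ?body) (\<lambda>_. ?I n) (n * (q * 24 + 18) + 6) \<sigma>1 \<mu>1"
    if "\<forall>u<n. \<mu>1 Count u = 0" "\<sigma>1 RowLen = q" and frame1: "\<And>A. A \<noteq> Count \<Longrightarrow> \<mu>1 A = \<mu> A" for \<sigma>1 \<mu>1
  proof (rule wp_For[where I = ?I and N = n])
    fix j \<sigma>' \<mu>'
    assume j: "j < n" "\<sigma>' Vert = j" and frame: "\<And>y. y \<noteq> Vert \<Longrightarrow> y \<notin> writes ?body \<Longrightarrow> \<sigma>' y = \<sigma>1 y"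
      "\<And>A. A \<notin> stores ?body \<Longrightarrow> \<mu>' A = \<mu>1 A" and inv: "?I j \<sigma>' \<mu>'"
    have same: "near_row \<mu>' = near_row \<mu>" "unhit \<mu>' = unhit \<mu>"
      using frame(2) frame1 by (simp_all add: near_row_def unhit_def fun_eq_iff)
    have rowlen: "\<sigma>' RowLen = q" using frame(1) that(2) by simp
    show "WP ?body (\<lambda>_. ?I (Suc j)) (q * 24 + 10) \<sigma>' \<mu>'"
    proof (cases "\<mu>' Full j = 0")
      case True
      then have "{v\<in>unhit \<mu>. v < Suc j} = {v\<in>unhit \<mu>. v < j}" unfolding same(2)[symmetric] by (auto simp: unhit_def less_Suc_eq)
      then show ?thesis using True j inv by (intro wp_Branch wp_Skip) simp_all
    next
      case False
      have "WP count_row (\<lambda>_. ?I (Suc j)) (q * 24 + 6) \<sigma>' \<mu>'"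
        using count_row_spec[of \<mu>' j \<sigma>'] assms(1) j rowlen False inv unfolding same by blast
      then show ?thesis using False j by (intro wp_Branch) (simp_all add: add.commute)
    qed
  qed (use that in simp_all)
  show ?thesis
    unfolding count_hits_def
  proof (rule wp_Seq[OF wp_call[OF reset]])
    fix t \<sigma>1 \<mu>1
    assume budget: "n * (24 * q + 30) + 12 - (n * 12 + 6) \<le> t"
      and "\<And>x. x \<notin> writes ?reset \<Longrightarrow> \<sigma>1 x = \<sigma> x" "\<And>A. A \<notin> stores ?reset \<Longrightarrow> \<mu>1 A = \<mu> A" "\<forall>u<n. \<mu>1 Count u = 0"
    then show "WP (FOR Vert < Size DO ?body) (\<lambda>_ \<sigma>' \<mu>'. \<forall>u<n. \<mu>' Count u = hits (near_row \<mu>) q (unhit \<mu>) u) t \<sigma>1 \<mu>1"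
      using budget assms(2) unhit_less by (intro wp_call[OF count]) (auto simp: algebra_simps cong: conj_cong)
  qed (simp add: algebra_simps)
qed

lemma find_max_spec:
  "WP find_max (\<lambda>_ \<sigma>' \<mu>'. \<sigma>' MaxVert < n \<and> (\<forall>u<n. \<mu> Count u \<le> \<mu> Count (\<sigma>' MaxVert))) (n * 18 + 8) \<sigma> \<mu>"
proof -
  let ?body = "IF Count\<langle>Var MaxVert\<rangle> \<lessdot> Count\<langle>Var Vert\<rangle> THEN MaxVert ::= Var Vert ELSE Skip"
  let ?I = "\<lambda>j (\<sigma>' :: var store) (\<mu>' :: arr arrays). \<sigma>' MaxVert < n \<and> (\<forall>u<j. \<mu> Count u \<le> \<mu> Count (\<sigma>' MaxVert))"
  have "WP (FOR Vert < Size DO ?body) (\<lambda>_. ?I n) (n * 18 + 6) (\<sigma>(MaxVert := 0)) \<mu>"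
  proof (rule wp_For[where I = ?I and N = n])
    fix j \<sigma>' \<mu>'
    assume j: "j < n" "\<sigma>' Vert = j" and "\<And>A. A \<notin> stores ?body \<Longrightarrow> \<mu>' A = \<mu> A" and inv: "?I j \<sigma>' \<mu>'"
    then have "\<mu>' = \<mu>" by auto
    then show "WP ?body (\<lambda>_. ?I (Suc j)) 10 \<sigma>' \<mu>'"
      using j inv by (intro wp_Branch wp_Assign wp_Skip) (auto simp: less_Suc_eq intro: less_imp_le le_less_trans)
  qed (use n_pos in simp_all)
  then show ?thesis
    unfolding find_max_def by (intro wp_Seq wp_Assign) (auto simp: add.commute)
qed

definition max_counted :: "arr arrays \<Rightarrow> var store \<Rightarrow> arr arrays \<Rightarrow> bool" where
  "max_counted \<mu>\<^sub>0 \<sigma> \<mu> \<longleftrightarrow> (\<forall>u<n. \<mu> Count u = hits (near_row \<mu>\<^sub>0) q (unhit \<mu>) u) \<and>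
     \<sigma> MaxVert < n \<and> (\<forall>u<n. \<mu> Count u \<le> \<mu> Count (\<sigma> MaxVert))"

lemma count_and_max_spec:
  assumes "\<forall>v<n. \<forall>i<q. near_row \<mu> v i < n" "\<sigma> RowLen = q"
  shows "WP count_and_max (\<lambda>_. max_counted \<mu>) (n * (24 * q + 48) + 20) \<sigma> \<mu>"
  unfolding count_and_max_def
proof (rule wp_Seq, rule wp_call[OF count_hits_spec[of \<mu> \<sigma>, OF assms]])
  fix t and \<sigma>1 :: "var store" and \<mu>1
  assume budget: "n * (24 * q + 48) + 20 - (n * (24 * q + 30) + 12) \<le> t"
    and frame: "\<And>A. A \<notin> stores count_hits \<Longrightarrow> \<mu>1 A = \<mu> A"
    and counted: "\<forall>u<n. \<mu>1 Count u = hits (near_row \<mu>) q (unhit \<mu>) u"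
  show "WP find_max (\<lambda>_. max_counted \<mu>) t \<sigma>1 \<mu>1"
  proof (rule wp_call[OF find_max_spec])
    fix t and \<sigma>2 :: "var store" and \<mu>2
    assume "\<And>A. A \<notin> stores find_max \<Longrightarrow> \<mu>2 A = \<mu>1 A"
      and max: "\<sigma>2 MaxVert < n \<and> (\<forall>u<n. \<mu>1 Count u \<le> \<mu>1 Count (\<sigma>2 MaxVert))"
    then have "\<mu>2 = \<mu>1" by auto
    moreover have "unhit \<mu>1 = unhit \<mu>" using frame by (simp add: unhit_def)
    ultimately show "max_counted \<mu> \<sigma>2 \<mu>2" unfolding max_counted_def using max counted by metis
  qed (use budget in \<open>simp add: algebra_simps\<close>)
qed (simp add: algebra_simps)

lemma clear_hit_spec:
  assumes "\<sigma> RowLen = q"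
  shows "WP clear_hit (\<lambda>_ \<sigma>' \<mu>'. \<forall>v<n. \<mu>' Full v = (if \<sigma> MaxVert \<in> near_row \<mu> v ` {..<q} then 0 else \<mu> Full v))
    (n * (22 * q + 14) + 6) \<sigma> \<mu>"
proof -
  let ?test = "IF Near\<langle>entry (Var Vert) (Var Pos)\<rangle> \<doteq> Var MaxVert THEN Full\<langle>Var Vert\<rangle> ::= Lit 0 ELSE Skip"
  let ?row = "FOR Pos < Var RowLen DO ?test"
  let ?cleared = "\<lambda>j i v. v < j \<and> \<sigma> MaxVert \<in> near_row \<mu> v ` {..<q} \<or> v = j \<and> \<sigma> MaxVert \<in> near_row \<mu> v ` {..<i}"
  let ?I = "\<lambda>j i (\<sigma>' :: var store) \<mu>'. \<forall>v<n. \<mu>' Full v = (if ?cleared j i v then 0 else \<mu> Full v)"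
  have "WP clear_hit (\<lambda>_. ?I n 0) (n * (q * 22 + 14) + 6) \<sigma> \<mu>"
    unfolding clear_hit_def
  proof (rule wp_For[where I = "\<lambda>j. ?I j 0" and N = n])
    fix j \<sigma>' \<mu>'
    assume j: "j < n" "\<sigma>' Vert = j" and frame: "\<And>y. y \<noteq> Vert \<Longrightarrow> y \<notin> writes ?row \<Longrightarrow> \<sigma>' y = \<sigma> y"
      "\<And>A. A \<notin> stores ?row \<Longrightarrow> \<mu>' A = \<mu> A" and inv: "?I j 0 \<sigma>' \<mu>'"
    have "WP ?row (\<lambda>_. ?I j q) (q * 22 + 6) \<sigma>' \<mu>'"
    proof (rule wp_For[where I = "?I j" and N = q])
      fix i \<sigma>2 \<mu>2
      assume i: "i < q" "\<sigma>2 Pos = i" and frame2: "\<And>y. y \<noteq> Pos \<Longrightarrow> y \<notin> writes ?test \<Longrightarrow> \<sigma>2 y = \<sigma>' y"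
        "\<And>A. A \<notin> stores ?test \<Longrightarrow> \<mu>2 A = \<mu>' A" and inv2: "?I j i \<sigma>2 \<mu>2"
      have "\<mu>2 Near (cell j i) = near_row \<mu> j i" "\<sigma>2 Vert = j" "\<sigma>2 MaxVert = \<sigma> MaxVert"
        using frame frame2 j(2) by (simp_all add: near_row_def)
      then show "WP ?test (\<lambda>_. ?I j (Suc i)) 14 \<sigma>2 \<mu>2"
        using i j(1) inv2 q_le by (intro wp_Branch wp_Update wp_Skip) (auto simp: lessThan_Suc)
    qed (use inv frame assms q_le in auto)
    then show "WP ?row (\<lambda>_. ?I (Suc j) 0) (q * 22 + 6) \<sigma>' \<mu>'"
      by (rule wp_call) (auto simp: less_Suc_eq)
  qed simp_all
  then show ?thesis by (rule wp_call) (auto simp: algebra_simps)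
qed

definition hit_so_far :: "arr arrays \<Rightarrow> var store \<Rightarrow> arr arrays \<Rightarrow> bool" where
  "hit_so_far \<mu>\<^sub>0 \<sigma> \<mu> \<longleftrightarrow> unhit \<mu> \<subseteq> unhit \<mu>\<^sub>0 \<and> \<sigma> Hitters + card (unhit \<mu>) \<le> n \<and>
     real (\<sigma> Hitters) + greedy_potential n q (card (unhit \<mu>)) \<le> greedy_potential n q n \<and>
     (\<forall>j<\<sigma> Hitters. \<mu> Hit j < n) \<and>
     (\<forall>v\<in>unhit \<mu>\<^sub>0 - unhit \<mu>. \<exists>j<\<sigma> Hitters. \<mu> Hit j \<in> near_row \<mu>\<^sub>0 v ` {..<q})"

lemma card_unhit_mult_le:
  assumes "\<forall>s<n. row_saved s \<mu>\<^sub>0" "max_counted \<mu>\<^sub>0 \<sigma> \<mu>"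
  shows "card (unhit \<mu>) * q \<le> n * \<mu> Count (\<sigma> MaxVert)"
  using assms near_row_less unhit_less
  by (intro card_mult_le_max_hits[where rw = "near_row \<mu>\<^sub>0"]) (auto simp: max_counted_def)

lemma hit_so_far_step:
  assumes saved: "\<forall>s<n. row_saved s \<mu>\<^sub>0" and counted: "max_counted \<mu>\<^sub>0 \<sigma> \<mu>" and hit: "hit_so_far \<mu>\<^sub>0 \<sigma> \<mu>"
    and pos: "\<mu> Count (\<sigma> MaxVert) \<noteq> 0"
    and upd: "\<mu>' Hit = (\<mu> Hit)(\<sigma> Hitters := \<sigma> MaxVert)" "\<sigma>' Hitters = Suc (\<sigma> Hitters)"
      "\<forall>v<n. \<mu>' Full v = (if \<sigma> MaxVert \<in> near_row \<mu>\<^sub>0 v ` {..<q} then 0 else \<mu> Full v)"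
  shows "hit_so_far \<mu>\<^sub>0 \<sigma>' \<mu>'"
proof -
  let ?b = "\<mu> Count (\<sigma> MaxVert)" and ?hit = "{v\<in>unhit \<mu>. \<sigma> MaxVert \<in> near_row \<mu>\<^sub>0 v ` {..<q}}"
  have unhit': "unhit \<mu>' = unhit \<mu> - ?hit" using upd(3) by (auto simp: unhit_def split: if_splits)
  have "?b = card ?hit"
    using counted hit saved near_row_inj_on unhit_less
    by (subst hits_eq_card[symmetric]) (auto simp: max_counted_def hit_so_far_def)
  then have card': "card (unhit \<mu>') = card (unhit \<mu>) - ?b" and b_le: "?b \<le> card (unhit \<mu>)"
    unfolding unhit' by (auto simp: card_Diff_subset intro!: card_mono)
  have "greedy_potential n q (card (unhit \<mu>')) + 1 \<le> greedy_potential n q (card (unhit \<mu>))"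
    unfolding card' using card_unhit_mult_le[OF saved counted] b_le pos q_pos q_le
    by (intro greedy_potential_step) auto
  moreover have "\<exists>j<\<sigma>' Hitters. \<mu>' Hit j \<in> near_row \<mu>\<^sub>0 v ` {..<q}" if v: "v \<in> unhit \<mu>\<^sub>0 - unhit \<mu>'" for v
  proof (cases "v \<in> ?hit")
    case True
    then show ?thesis using upd(1,2) by (intro exI[of _ "\<sigma> Hitters"]) simp
  next
    case False
    then have "v \<in> unhit \<mu>\<^sub>0 - unhit \<mu>" using v unfolding unhit' by blast
    then obtain j where "j < \<sigma> Hitters" "\<mu> Hit j \<in> near_row \<mu>\<^sub>0 v ` {..<q}"
      using hit unfolding hit_so_far_def by blast
    then show ?thesis using upd(1,2) by (intro exI[of _ j]) simp
  qed
  ultimately show ?thesis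
    using hit counted upd(1,2) b_le pos card' unhit'
    by (auto simp: hit_so_far_def max_counted_def less_Suc_eq)
qed

lemma add_hitter_spec:
  assumes saved: "\<forall>s<n. row_saved s \<mu>\<^sub>0" and near: "\<mu> Near = \<mu>\<^sub>0 Near" and rowlen: "\<sigma> RowLen = q"
    and counted: "max_counted \<mu>\<^sub>0 \<sigma> \<mu>" and hit: "hit_so_far \<mu>\<^sub>0 \<sigma> \<mu>" and pos: "\<mu> Count (\<sigma> MaxVert) \<noteq> 0"
  shows "WP add_hitter
    (\<lambda>_ \<sigma>' \<mu>'. max_counted \<mu>\<^sub>0 \<sigma>' \<mu>' \<and> hit_so_far \<mu>\<^sub>0 \<sigma>' \<mu>' \<and> \<sigma>' Hitters = Suc (\<sigma> Hitters))
    (n * (46 * q + 62) + 34) \<sigma> \<mu>"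
proof -
  let ?Q = "\<lambda>(_ :: nat) \<sigma>' \<mu>'. max_counted \<mu>\<^sub>0 \<sigma>' \<mu>' \<and> hit_so_far \<mu>\<^sub>0 \<sigma>' \<mu>' \<and> \<sigma>' Hitters = Suc (\<sigma> Hitters)"
  define \<sigma>1 where "\<sigma>1 = \<sigma>(Hitters := \<sigma> Hitters + 1)"
  define \<mu>1 where "\<mu>1 = \<mu>(Hit := (\<mu> Hit)(\<sigma> Hitters := \<sigma> MaxVert))"
  have regs1: "\<sigma>1 RowLen = q" "\<sigma>1 MaxVert = \<sigma> MaxVert" using rowlen by (simp_all add: \<sigma>1_def)
  have "unhit \<mu> \<noteq> {}" using counted pos by (auto simp: max_counted_def)
  then have "1 \<le> card (unhit \<mu>)" by (simp add: Suc_le_eq card_gt_0_iff One_nat_def)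
  then have less: "\<sigma> Hitters < n" using hit by (simp add: hit_so_far_def)
  have "WP (clear_hit ;; count_and_max) ?Q (26 + n * (46 * q + 62)) \<sigma>1 \<mu>1"
  proof (rule wp_Seq, rule wp_call[OF clear_hit_spec[of \<sigma>1 \<mu>1, OF regs1(1)]])
    fix t \<sigma>2 \<mu>2
    assume budget: "26 + n * (46 * q + 62) - (n * (22 * q + 14) + 6) \<le> t"
      and frame2: "\<And>x. x \<notin> writes clear_hit \<Longrightarrow> \<sigma>2 x = \<sigma>1 x" "\<And>A. A \<notin> stores clear_hit \<Longrightarrow> \<mu>2 A = \<mu>1 A"
      and cleared: "\<forall>v<n. \<mu>2 Full v = (if \<sigma>1 MaxVert \<in> near_row \<mu>1 v ` {..<q} then 0 else \<mu>1 Full v)"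
    have same: "near_row \<mu>1 = near_row \<mu>\<^sub>0" "near_row \<mu>2 = near_row \<mu>\<^sub>0"
      using frame2(2) near by (simp_all add: near_row_def \<mu>1_def fun_eq_iff)
    have upd: "\<mu>2 Hit = (\<mu> Hit)(\<sigma> Hitters := \<sigma> MaxVert)" "\<sigma>2 Hitters = Suc (\<sigma> Hitters)"
      "\<forall>v<n. \<mu>2 Full v = (if \<sigma> MaxVert \<in> near_row \<mu>\<^sub>0 v ` {..<q} then 0 else \<mu> Full v)"
      using frame2 cleared unfolding same regs1 by (simp_all add: \<sigma>1_def \<mu>1_def)
    have hit2: "hit_so_far \<mu>\<^sub>0 \<sigma>2 \<mu>2" by (rule hit_so_far_step[of \<mu>\<^sub>0 \<sigma> \<mu> \<mu>2 \<sigma>2, OF saved counted hit pos upd])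
    have rows: "\<forall>v<n. \<forall>i<q. near_row \<mu>2 v i < n" using saved near_row_less unfolding same by blast
    have regs2: "\<sigma>2 RowLen = q" using frame2(1) regs1(1) by simp
    show "WP count_and_max ?Q t \<sigma>2 \<mu>2"
    proof (rule wp_call[OF count_and_max_spec[of \<mu>2 \<sigma>2, OF rows regs2]])
      fix t' \<sigma>3 \<mu>3
      assume "\<And>x. x \<notin> writes count_and_max \<Longrightarrow> \<sigma>3 x = \<sigma>2 x"
        "\<And>A. A \<notin> stores count_and_max \<Longrightarrow> \<mu>3 A = \<mu>2 A" and counted3: "max_counted \<mu>2 \<sigma>3 \<mu>3"
      then have "unhit \<mu>3 = unhit \<mu>2" "\<mu>3 Hit = \<mu>2 Hit" "\<sigma>3 Hitters = \<sigma>2 Hitters" by (simp_all add: unhit_def)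
      moreover have "max_counted \<mu>\<^sub>0 \<sigma>3 \<mu>3" using counted3 unfolding max_counted_def same .
      ultimately show "?Q t' \<sigma>3 \<mu>3" using hit2 upd(2) by (simp add: hit_so_far_def)
    qed (use budget in \<open>simp add: algebra_simps\<close>)
  qed (simp add: algebra_simps)
  moreover have "\<sigma> Hitters + 1 < 2 ^ w" using less word by simp
  ultimately show ?thesis
    using less unfolding add_hitter_def by (intro wp_Seq[of _ _ "Hit\<langle>_\<rangle> ::= _"] wp_Seq[of _ _ "Hitters ::= _"] wp_Assign wp_Update)
      (simp_all add: \<sigma>1_def \<mu>1_def add.commute)
qed

definition greedy_cost :: nat where "greedy_cost = n * (46 * q + 62) + 38"

definition all_hit :: "arr arrays \<Rightarrow> var store \<Rightarrow> arr arrays \<Rightarrow> bool" where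
  "all_hit \<mu>\<^sub>0 \<sigma> \<mu> \<longleftrightarrow> \<sigma> Hitters \<le> n \<and> \<sigma> Hitters \<le> max_hitters n q \<and> (\<forall>j<\<sigma> Hitters. \<mu> Hit j < n) \<and>
     (\<forall>v\<in>unhit \<mu>\<^sub>0. \<exists>j<\<sigma> Hitters. \<mu> Hit j \<in> near_row \<mu>\<^sub>0 v ` {..<q})"

lemma all_hit_if_no_hits:
  assumes "\<forall>s<n. row_saved s \<mu>\<^sub>0" "max_counted \<mu>\<^sub>0 \<sigma> \<mu>" "hit_so_far \<mu>\<^sub>0 \<sigma> \<mu>" "\<mu> Count (\<sigma> MaxVert) = 0"
  shows "all_hit \<mu>\<^sub>0 \<sigma> \<mu>"
proof -
  have "card (unhit \<mu>) * q = 0" using card_unhit_mult_le[OF assms(1,2)] assms(3,4) by fastforce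
  then have "unhit \<mu> = {}" using q_pos by simp
  then show ?thesis using assms(3) le_max_hitters by (auto simp: hit_so_far_def all_hit_def)
qed

lemma hitters_less_max:
  assumes "max_counted \<mu>\<^sub>0 \<sigma> \<mu>" "hit_so_far \<mu>\<^sub>0 \<sigma> \<mu>" "\<mu> Count (\<sigma> MaxVert) \<noteq> 0"
  shows "\<sigma> Hitters < max_hitters n q"
proof -
  have "0 < card (unhit \<mu>)" using assms(1,3) by (auto simp: max_counted_def card_gt_0_iff)
  then have "1 \<le> greedy_potential n q (card (unhit \<mu>))" by (intro greedy_potential_ge_1 q_pos q_le) simp
  moreover have "greedy_potential n q 0 = 0" by (simp add: greedy_potential_def)
  ultimately have "real (Suc (\<sigma> Hitters)) + greedy_potential n q 0 \<le> greedy_potential n q n"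
    using assms(2) by (simp add: hit_so_far_def)
  then show ?thesis by (intro Suc_le_lessD le_max_hitters)
qed

lemma select_hitters_loop:
  assumes saved: "\<forall>s<n. row_saved s \<mu>\<^sub>0" and near: "\<mu> Near = \<mu>\<^sub>0 Near" "\<sigma> RowLen = q" and "\<sigma> Hitters = 0"
    and start: "max_counted \<mu>\<^sub>0 \<sigma> \<mu>" "hit_so_far \<mu>\<^sub>0 \<sigma> \<mu>" and budget: "max_hitters n q * greedy_cost + 4 \<le> T"
  shows "WP (WHILE Count\<langle>Var MaxVert\<rangle> DO add_hitter)
    (\<lambda>_. all_hit \<mu>\<^sub>0) T \<sigma> \<mu>"
proof -
  let ?I = "\<lambda>\<sigma>' \<mu>'. max_counted \<mu>\<^sub>0 \<sigma>' \<mu>' \<and> hit_so_far \<mu>\<^sub>0 \<sigma>' \<mu>'"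
  let ?\<Phi> = "\<lambda>(\<sigma>' :: var store) (\<mu>' :: arr arrays). (max_hitters n q - \<sigma>' Hitters) * greedy_cost"
  show ?thesis
  proof (rule wp_Loop[where I = ?I and \<Phi> = ?\<Phi>])
    fix \<sigma>' \<mu>'
    assume frame: "\<And>x. x \<notin> writes add_hitter \<Longrightarrow> \<sigma>' x = \<sigma> x" "\<And>A. A \<notin> stores add_hitter \<Longrightarrow> \<mu>' A = \<mu> A" and inv: "?I \<sigma>' \<mu>'"
    then show "safe w len (Count\<langle>Var MaxVert\<rangle>) \<sigma>' \<mu>'" by (simp add: max_counted_def)
    show "all_hit \<mu>\<^sub>0 \<sigma>' \<mu>'" if "val len (Count\<langle>Var MaxVert\<rangle>) \<sigma>' \<mu>' = 0"
      using that inv all_hit_if_no_hits[OF saved] by simp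
    assume "val len (Count\<langle>Var MaxVert\<rangle>) \<sigma>' \<mu>' \<noteq> 0"
    then have pos: "\<mu>' Count (\<sigma>' MaxVert) \<noteq> 0" by simp
    have near': "\<mu>' Near = \<mu>\<^sub>0 Near" "\<sigma>' RowLen = q" using frame near by simp_all
    note body = add_hitter_spec[of \<mu>\<^sub>0 \<mu>' \<sigma>', OF saved near' conjunct1[OF inv] conjunct2[OF inv] pos]
    have "\<sigma>' Hitters < max_hitters n q" using hitters_less_max inv pos by blast
    then have "max_hitters n q - \<sigma>' Hitters = Suc (max_hitters n q - Suc (\<sigma>' Hitters))" by simp
    then have potential: "?\<Phi> \<sigma>' \<mu>' = (max_hitters n q - Suc (\<sigma>' Hitters)) * greedy_cost + greedy_cost" by simp
    show "cost (Count\<langle>Var MaxVert\<rangle> :: (var, arr) expr) < ?\<Phi> \<sigma>' \<mu>' \<and> WP add_hitter (\<lambda>t \<sigma>'' \<mu>''. ?I \<sigma>'' \<mu>'' \<and> ?\<Phi> \<sigma>'' \<mu>'' \<le> t)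
        (?\<Phi> \<sigma>' \<mu>' - (cost (Count\<langle>Var MaxVert\<rangle> :: (var, arr) expr) + 1)) \<sigma>' \<mu>'"
      unfolding potential by (intro conjI wp_call[OF body]) (auto simp: greedy_cost_def)
  qed (use assms in simp_all)
qed

lemma select_hitters_spec:
  assumes saved: "\<forall>s<n. row_saved s \<mu>" and rowlen: "\<sigma> RowLen = q"
  shows "WP select_hitters (\<lambda>_. all_hit \<mu>) ((max_hitters n q + 1) * greedy_cost) \<sigma> \<mu>"
proof -
  let ?loop = "WHILE Count\<langle>Var MaxVert\<rangle> DO add_hitter"
  let ?\<sigma> = "\<sigma>(Hitters := 0)"
  have rows: "\<forall>v<n. \<forall>i<q. near_row \<mu> v i < n" using saved near_row_less by blast
  have rowlen0: "?\<sigma> RowLen = q" using rowlen by simp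
  have "WP (count_and_max ;; ?loop) (\<lambda>_. all_hit \<mu>) ((max_hitters n q + 1) * greedy_cost - 2) ?\<sigma> \<mu>"
  proof (rule wp_Seq, rule wp_call[OF count_and_max_spec[of \<mu> ?\<sigma>, OF rows rowlen0]])
    fix t \<sigma>1 \<mu>1
    assume budget: "(max_hitters n q + 1) * greedy_cost - 2 - (n * (24 * q + 48) + 20) \<le> t"
      and frame: "\<And>x. x \<notin> writes count_and_max \<Longrightarrow> \<sigma>1 x = ?\<sigma> x"
        "\<And>A. A \<notin> stores count_and_max \<Longrightarrow> \<mu>1 A = \<mu> A" and counted: "max_counted \<mu> \<sigma>1 \<mu>1"
    have "unhit \<mu>1 = unhit \<mu>" using frame(2) by (simp add: unhit_def)
    then have "hit_so_far \<mu> \<sigma>1 \<mu>1" using frame(1) card_unhit_le by (simp add: hit_so_far_def greedy_potential_mono)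
    moreover have "n * (24 * q + 48) + 26 \<le> greedy_cost"
      unfolding greedy_cost_def by (intro add_mono mult_le_mono) simp_all
    then have "max_hitters n q * greedy_cost + 4 \<le> t" using budget by (simp add: algebra_simps)
    ultimately show "WP ?loop (\<lambda>_. all_hit \<mu>) t \<sigma>1 \<mu>1"
      using saved counted frame rowlen by (intro select_hitters_loop) simp_all
  qed (simp add: greedy_cost_def algebra_simps)
  moreover have "2 < (max_hitters n q + 1) * greedy_cost"
    by (rule less_le_trans[of _ greedy_cost]) (simp_all add: greedy_cost_def)
  ultimately show ?thesis
    unfolding select_hitters_def by (intro wp_Seq[of _ _ "Hitters ::= _"] wp_Assign) simp_all
qed

end

section \<open>Distances to the hitting set\<close>

definition update_nearest :: "(var, arr) cmd" where
  "update_nearest = IF Dist\<langle>entry (Var Vert) (Hit\<langle>Var Pos\<rangle>)\<rangle> \<lessdot> HitDist\<langle>Var Vert\<rangle>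
     THEN (HitDist\<langle>Var Vert\<rangle> ::= Dist\<langle>entry (Var Vert) (Hit\<langle>Var Pos\<rangle>)\<rangle> ;; HitIndex\<langle>Var Vert\<rangle> ::= Var Pos)
     ELSE Skip"

definition find_nearest :: "(var, arr) cmd" where
  "find_nearest = FOR Vert < Size DO (HitDist\<langle>Var Vert\<rangle> ::= Lit 2 \<otimes> Size ;; HitIndex\<langle>Var Vert\<rangle> ::= Lit 0 ;;
     FOR Pos < Var Hitters DO update_nearest)"

lemma find_nearest_frames [simp]:
  "writes update_nearest = {}" "stores update_nearest = {HitDist, HitIndex}"
  "writes find_nearest = {Vert, Pos}" "stores find_nearest = {HitDist, HitIndex}"
  by (auto simp: find_nearest_def update_nearest_def)

context center_instance begin

definition nearest_hitter :: "(nat \<Rightarrow> nat) \<Rightarrow> nat \<Rightarrow> nat \<Rightarrow> nat \<Rightarrow> nat \<Rightarrow> bool" where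
  "nearest_hitter hit z j r p \<longleftrightarrow> r \<le> 2 * n \<and> p < n \<and> (\<forall>i<j. r \<le> d z (hit i)) \<and> (r < 2 * n \<longrightarrow> p < j \<and> d z (hit p) = r)"

lemma nearest_hitter_Suc:
  assumes "nearest_hitter hit z j r p" "z < n" "j < n"
  shows "d z (hit j) < r \<Longrightarrow> nearest_hitter hit z (Suc j) (d z (hit j)) j"
    and "r \<le> d z (hit j) \<Longrightarrow> nearest_hitter hit z (Suc j) r p"
  using assms d_le_inf[of z "hit j"] by (auto simp: nearest_hitter_def less_Suc_eq)

lemma find_nearest_spec:
  assumes dist: "\<forall>s<n. \<forall>u<n. \<mu> Dist (cell s u) = d s u" and "\<sigma> Hitters \<le> n" and hit_less: "\<forall>j<\<sigma> Hitters. \<mu> Hit j < n"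
  shows "WP find_nearest (\<lambda>_ \<sigma>' \<mu>'. \<forall>z<n. nearest_hitter (\<mu> Hit) z (\<sigma> Hitters) (\<mu>' HitDist z) (\<mu>' HitIndex z))
    (n * (\<sigma> Hitters * 38 + 24) + 6) \<sigma> \<mu>"
proof -
  let ?sz = "\<sigma> Hitters"
  let ?I = "\<lambda>j (\<sigma>' :: var store) \<mu>'. \<forall>z<j. nearest_hitter (\<mu> Hit) z ?sz (\<mu>' HitDist z) (\<mu>' HitIndex z)"
  let ?J = "\<lambda>z i (\<sigma>' :: var store) \<mu>'. ?I z \<sigma>' \<mu>' \<and> nearest_hitter (\<mu> Hit) z i (\<mu>' HitDist z) (\<mu>' HitIndex z)"
  let ?init = "HitDist\<langle>Var Vert\<rangle> ::= Lit 2 \<otimes> Size ;; HitIndex\<langle>Var Vert\<rangle> ::= Lit 0"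
  let ?loop = "FOR Pos < Var Hitters DO update_nearest"
  have "?sz < 2 ^ w" using assms(2) less_word(3) by (rule le_less_trans)
  have loop: "WP ?loop (\<lambda>_. ?I (Suc z)) (?sz * 38 + 6) \<sigma>1 \<mu>1"
    if z: "z < n" "\<sigma>1 Vert = z" "\<sigma>1 Hitters = ?sz" and frame1: "\<mu>1 Dist = \<mu> Dist" "\<mu>1 Hit = \<mu> Hit" and "?J z 0 \<sigma>1 \<mu>1" for z \<sigma>1 \<mu>1
  proof -
    have "WP ?loop (\<lambda>_. ?J z ?sz) (?sz * 38 + 6) \<sigma>1 \<mu>1"
    proof (rule wp_For[where I = "?J z" and N = ?sz])
      fix j \<sigma>' \<mu>'
      assume j: "j < ?sz" "\<sigma>' Pos = j" and frame: "\<And>y. y \<noteq> Pos \<Longrightarrow> y \<notin> writes update_nearest \<Longrightarrow> \<sigma>' y = \<sigma>1 y"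
        "\<And>A. A \<notin> stores update_nearest \<Longrightarrow> \<mu>' A = \<mu>1 A" and inv: "?J z j \<sigma>' \<mu>'"
      have same: "\<sigma>' Vert = z" "\<mu>' Dist = \<mu> Dist" "\<mu>' Hit = \<mu> Hit" using frame z frame1 by simp_all
      have "j < n" "\<mu> Hit j < n" using j(1) assms(2) hit_less by auto
      then show "WP update_nearest (\<lambda>_. ?J z (Suc j)) 30 \<sigma>' \<mu>'"
        unfolding update_nearest_def
        using j(2) same dist z(1) inv nearest_hitter_Suc[OF conjunct2[OF inv] z(1)]
        by (intro wp_Branch wp_Seq wp_Update wp_Skip) auto
    qed (use that \<open>?sz < 2 ^ w\<close> in auto)
    then show ?thesis by (rule wp_call) (auto simp: less_Suc_eq)
  qed
  have "WP find_nearest (\<lambda>_. ?I n) (n * (?sz * 38 + 24) + 6) \<sigma> \<mu>"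
    unfolding find_nearest_def
  proof (rule wp_For[where I = ?I and N = n])
    let ?body = "HitDist\<langle>Var Vert\<rangle> ::= Lit 2 \<otimes> Size ;; HitIndex\<langle>Var Vert\<rangle> ::= Lit 0 ;; ?loop"
    fix z \<sigma>' \<mu>'
    assume z: "z < n" "\<sigma>' Vert = z" and frame: "\<And>y. y \<noteq> Vert \<Longrightarrow> y \<notin> writes ?body \<Longrightarrow> \<sigma>' y = \<sigma> y"
      "\<And>A. A \<notin> stores ?body \<Longrightarrow> \<mu>' A = \<mu> A" and inv: "?I z \<sigma>' \<mu>'"
    define \<mu>1 where "\<mu>1 = \<mu>'(HitDist := (\<mu>' HitDist)(z := 2 * n), HitIndex := (\<mu>' HitIndex)(z := 0))"
    have "WP ?loop (\<lambda>_. ?I (Suc z)) (6 + ?sz * 38) \<sigma>' \<mu>1"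
      using loop[of z \<sigma>' \<mu>1] z frame inv n_pos by (simp add: \<mu>1_def nearest_hitter_def add.commute)
    then show "WP ?body (\<lambda>_. ?I (Suc z)) (?sz * 38 + 16) \<sigma>' \<mu>'"
      using z by (intro wp_Seq[of _ _ "HitDist\<langle>_\<rangle> ::= _"] wp_Seq[of _ _ "HitIndex\<langle>_\<rangle> ::= _"] wp_Update)
        (simp_all add: \<mu>1_def add.commute)
  qed simp_all
  then show ?thesis by (rule wp_call) (auto simp: algebra_simps)
qed

end

section \<open>The search program\<close>

fun uncovered_expr :: "nat \<Rightarrow> (var, arr) expr" where
  "uncovered_expr 0 = Lit 1"
| "uncovered_expr (Suc i) =
     uncovered_expr i \<otimes> (Var Threshold \<lessdot> Dist\<langle>entry (Var (Center i)) (Var Vert)\<rangle>)"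

definition find_farthest :: "nat \<Rightarrow> (var, arr) cmd" where
  "find_farthest i = Best ::= Lit 0 ;; Far i ::= Lit 0 ;; FOR Vert < Size DO
     IF uncovered_expr i \<otimes> (Var Best \<lessdot> HitDist\<langle>Var Vert\<rangle> \<oplus> Lit 1)
     THEN (Best ::= HitDist\<langle>Var Vert\<rangle> \<oplus> Lit 1 ;; Far i ::= Var Vert) ELSE Skip"

fun copy_centers :: "nat \<Rightarrow> (var, arr) cmd" where
  "copy_centers 0 = Skip"
| "copy_centers (Suc l) = copy_centers l ;; Sol l ::= Var (Center l)"

definition record_solution :: "nat \<Rightarrow> (var, arr) cmd" where
  "record_solution k = IF Var Ok THEN (Found ::= Lit 1 ;; copy_centers k) ELSE Skip"

definition leaf_far :: "nat \<Rightarrow> (var, arr) cmd" where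
  "leaf_far i = FOR Pos < Var RowLen DO (Center i ::= Near\<langle>entry (Var (Far i)) (Var Pos)\<rangle> ;;
     Ok ::= NONE Vert < Size WITH uncovered_expr (Suc i) ;; record_solution (Suc i))"

definition mark_needed :: "nat \<Rightarrow> (var, arr) cmd" where
  "mark_needed i = FOR Pos < Var Hitters DO Need\<langle>Var Pos\<rangle> ::= Lit 0 ;;
     FOR Vert < Size DO IF uncovered_expr i THEN Need\<langle>HitIndex\<langle>Var Vert\<rangle>\<rangle> ::= Lit 1 ELSE Skip"

definition check_close :: "nat \<Rightarrow> (var, arr) cmd" where
  "check_close i = Ok ::= NONE Pos < Var Hitters WITH
     Need\<langle>Var Pos\<rangle> \<otimes> (Var Radius \<oplus> Var Reach \<lessdot> Dist\<langle>entry (Var (Center i)) (Hit\<langle>Var Pos\<rangle>)\<rangle>)"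

definition leaf_near :: "nat \<Rightarrow> (var, arr) cmd" where
  "leaf_near i = FOR Center i < Size DO (check_close i ;; record_solution (Suc i))"

definition leaf :: "nat \<Rightarrow> (var, arr) cmd" where
  "leaf i = Threshold ::= Var Target ;; find_farthest i ;;
     IF Var Reach \<oplus> Lit 1 \<lessdot> Var Best THEN leaf_far i ELSE (mark_needed i ;; leaf_near i)"

definition pick_center :: "nat \<Rightarrow> (var, arr) cmd" where
  "pick_center i = IF Var (Choice i) \<lessdot> Var Hitters THEN Center i ::= Hit\<langle>Var (Choice i)\<rangle>
     ELSE Center i ::= Near\<langle>entry (Var (Far i)) (Var (Choice i) \<ominus> Var Hitters)\<rangle>"

fun search :: "nat \<Rightarrow> nat \<Rightarrow> (var, arr) cmd" where
  "search i 0 = leaf i"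
| "search i (Suc r) = Threshold ::= Var Radius \<oplus> Lit (2 * i) \<otimes> Var Gap \<ominus> Var Gap ;; find_farthest i ;;
     FOR Choice i < Var Hitters \<oplus> Var RowLen DO (pick_center i ;; search (Suc i) r)"

declare image_iff [of _ Sol, simp]

lemma cost_uncovered_expr [simp]: "cost (uncovered_expr i) = 10 * i + 1"
  by (induction i) simp_all

lemma copy_centers_frames [simp]:
  "writes (copy_centers i) = Sol ` {..<i}" "stores (copy_centers i) = {}"
  by (induction i) (auto simp: lessThan_Suc)

lemma search_frames [simp]:
  "writes (find_farthest i) = {Best, Vert, Far i}" "stores (find_farthest i) = {}"
  "writes (record_solution i) = insert Found (Sol ` {..<i})" "stores (record_solution i) = {}"
  "writes (mark_needed i) = {Vert, Pos}" "stores (mark_needed i) = {Need}"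
  "writes (check_close i) = {Pos, Ok}" "stores (check_close i) = {}"
  "writes (pick_center i) = {Center i}" "stores (pick_center i) = {}"
  by (auto simp: find_farthest_def record_solution_def mark_needed_def check_close_def pick_center_def)

lemma leaf_frames [simp]:
  "writes (leaf_far i) = {Pos, Center i, Vert, Ok, Found} \<union> Sol ` {..i}" "stores (leaf_far i) = {}"
  "writes (leaf_near i) = {Pos, Center i, Ok, Found} \<union> Sol ` {..i}" "stores (leaf_near i) = {}"
  "writes (leaf i) = {Threshold, Best, Vert, Far i, Pos, Center i, Ok, Found} \<union> Sol ` {..i}" "stores (leaf i) = {Need}"
proof -
  show far: "writes (leaf_far i) = {Pos, Center i, Vert, Ok, Found} \<union> Sol ` {..i}" "stores (leaf_far i) = {}"
    by (auto simp: leaf_far_def lessThan_Suc_atMost)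
  show near: "writes (leaf_near i) = {Pos, Center i, Ok, Found} \<union> Sol ` {..i}" "stores (leaf_near i) = {}"
    by (auto simp: leaf_near_def lessThan_Suc_atMost)
  show "writes (leaf i) = {Threshold, Best, Vert, Far i, Pos, Center i, Ok, Found} \<union> Sol ` {..i}" "stores (leaf i) = {Need}"
    by (auto simp: leaf_def far near)
qed

lemma writes_search:
  "writes (search i r) \<subseteq> {Threshold, Best, Vert, Pos, Ok, Found} \<union> range Sol \<union> Far ` {i..} \<union> Center ` {i..} \<union> Choice ` {i..}"
proof (induction r arbitrary: i)
  case (Suc r)
  have "f ` {Suc i..} \<subseteq> f ` {i..}" for f :: "nat \<Rightarrow> var" by auto
  then show ?case using Suc.IH[of "Suc i"] by auto
qed auto

lemma stores_search [simp]: "stores (search i r) = {Need}"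
  by (induction r arbitrary: i) auto

lemma not_writes_search [simp]:
  "Hitters \<notin> writes (search i r)" "RowLen \<notin> writes (search i r)" "Radius \<notin> writes (search i r)"
  "Gap \<notin> writes (search i r)" "Target \<notin> writes (search i r)" "Reach \<notin> writes (search i r)"
  "Lower \<notin> writes (search i r)" "Upper \<notin> writes (search i r)"
  "l < i \<Longrightarrow> Center l \<notin> writes (search i r)" "l < i \<Longrightarrow> Far l \<notin> writes (search i r)"
  "l < i \<Longrightarrow> Choice l \<notin> writes (search i r)"
  using writes_search[of i r] by auto

definition centers :: "var store \<Rightarrow> nat \<Rightarrow> nat" where
  "centers \<sigma> l = \<sigma> (Center l)"

definition solution :: "var store \<Rightarrow> nat \<Rightarrow> nat" where
  "solution \<sigma> l = \<sigma> (Sol l)"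

context center_instance begin

definition covering :: "nat \<Rightarrow> (nat \<Rightarrow> nat) \<Rightarrow> bool" where
  "covering r Y \<longleftrightarrow> (\<forall>l<k. Y l < n) \<and> (\<forall>z<n. \<exists>l<k. d (Y l) z \<le> r)"

lemma covering_cong: "(\<And>l. l < k \<Longrightarrow> Y l = Y' l) \<Longrightarrow> covering r Y \<longleftrightarrow> covering r Y'"
  unfolding covering_def by (metis (no_types, lifting))

definition leaf_cost :: "nat \<Rightarrow> nat" where
  "leaf_cost H = n * (12 * k + 50) * (H + q + 2)"

lemma leaf_cost_bounds:
  assumes "i < k"
  shows "n * (10 * i + 26) + 10 + (q * (n * (10 * k + 12) + 2 * k + 28) + 6) + 8 \<le> leaf_cost H"
    and "n * (10 * i + 26) + 10 + (H * 12 + n * (10 * i + 16) + 12 + (n * (28 * H + 2 * k + 20) + 6)) + 8 \<le> leaf_cost H"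
proof -
  have "n * i \<le> n * k" using assms by simp
  moreover have "q \<le> n * q" "k * q \<le> n * (k * q)" "H \<le> n * H" using n_pos by simp_all
  ultimately show "n * (10 * i + 26) + 10 + (q * (n * (10 * k + 12) + 2 * k + 28) + 6) + 8 \<le> leaf_cost H"
    "n * (10 * i + 26) + 10 + (H * 12 + n * (10 * i + 16) + 12 + (n * (28 * H + 2 * k + 20) + 6)) + 8 \<le> leaf_cost H"
    using n_pos unfolding leaf_cost_def by (simp_all only: algebra_simps)
qed

definition search_cost :: "nat \<Rightarrow> nat \<Rightarrow> nat" where
  "search_cost H r = leaf_cost H * (H + q + 2) ^ r"

lemma search_cost_step:
  assumes "i < k"
  shows "n * (10 * i + 26) + 10 + ((H + q) * (search_cost H r + 24) + 8) + 8 \<le> search_cost H (Suc r)"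
proof -
  have "leaf_cost H * 1 \<le> search_cost H r" unfolding search_cost_def by (intro mult_le_mono2) simp
  moreover have "n * i \<le> n * k" using assms by simp
  moreover have "H \<le> n * H" "q \<le> n * q" using n_pos by simp_all
  ultimately have "24 * (H + q) + n * (10 * i + 26) + 26 \<le> 2 * search_cost H r"
    using n_pos unfolding leaf_cost_def by (simp only: algebra_simps)
  moreover have "search_cost H (Suc r) = (H + q) * search_cost H r + 2 * search_cost H r"
    by (simp add: search_cost_def algebra_simps)
  ultimately show ?thesis by (simp add: algebra_simps)
qed

end

locale search_instance = center_instance +
  fixes \<mu>\<^sub>0 :: "arr arrays" and hitters :: nat
  assumes hitters_le: "hitters \<le> n"
    and hit_less: "j < hitters \<Longrightarrow> \<mu>\<^sub>0 Hit j < n"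
    and dist: "u < n \<Longrightarrow> v < n \<Longrightarrow> \<mu>\<^sub>0 Dist (cell u v) = d u v"
    and near_less: "v < n \<Longrightarrow> i < q \<Longrightarrow> near_row \<mu>\<^sub>0 v i < n"
    and near_rows: "v < n \<Longrightarrow> \<exists>full. nearest_row q v (near_row \<mu>\<^sub>0 v) full \<and>
      (full \<longrightarrow> (\<exists>j<hitters. \<mu>\<^sub>0 Hit j \<in> near_row \<mu>\<^sub>0 v ` {..<q}))"
    and nearest: "z < n \<Longrightarrow> nearest_hitter (\<mu>\<^sub>0 Hit) z hitters (\<mu>\<^sub>0 HitDist z) (\<mu>\<^sub>0 HitIndex z)"

locale radius_guess = search_instance +
  fixes R :: nat
  assumes guess_less: "R < n"
begin

sublocale center_search n E k "\<mu>\<^sub>0 Hit ` {..<hitters}" "\<lambda>v. near_row \<mu>\<^sub>0 v ` {..<q}" "\<mu>\<^sub>0 HitDist" R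
proof
  show "\<mu>\<^sub>0 HitDist v \<le> d v s" if "v < n" "s \<in> \<mu>\<^sub>0 Hit ` {..<hitters}" for v s
    using nearest[OF that(1)] that(2) by (auto simp: nearest_hitter_def)
  show "\<mu>\<^sub>0 HitDist v \<le> 2 * n" if "v < n" for v
    using nearest[OF that] by (simp add: nearest_hitter_def)
  show "\<exists>s\<in>\<mu>\<^sub>0 Hit ` {..<hitters}. d v s = \<mu>\<^sub>0 HitDist v" if "v < n" "\<mu>\<^sub>0 HitDist v < 2 * n" for v
    using nearest[OF that(1)] that(2) by (auto simp: nearest_hitter_def)
  show "x \<in> near_row \<mu>\<^sub>0 v ` {..<q}"
    if v: "v < n" and "r < 2 * n" "r < \<mu>\<^sub>0 HitDist v" "x < n" "d v x \<le> r" for v r x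
  proof -
    obtain full where full: "nearest_row q v (near_row \<mu>\<^sub>0 v) full"
        "full \<Longrightarrow> \<exists>j<hitters. \<mu>\<^sub>0 Hit j \<in> near_row \<mu>\<^sub>0 v ` {..<q}"
      using near_rows[OF v] by blast
    have "r < d v (\<mu>\<^sub>0 Hit j)" if "j < hitters" for j
      using nearest[OF v] that \<open>r < \<mu>\<^sub>0 HitDist v\<close> by (auto simp: nearest_hitter_def)
    then have "\<exists>i<q. r < d v (near_row \<mu>\<^sub>0 v i)" if full using full(2)[OF that] by force
    then show ?thesis using that by (intro ball_subset_nearest_row[OF full(1)]) auto
  qed
  show "\<mu>\<^sub>0 HitDist v = 0" if v: "v < n" and single: "k = 1" for v
  proof -
    have "q = 1" using single unfolding q_def row_len_def by simp
    obtain full where full: "nearest_row q v (near_row \<mu>\<^sub>0 v) full"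
        "full \<Longrightarrow> \<exists>j<hitters. \<mu>\<^sub>0 Hit j \<in> near_row \<mu>\<^sub>0 v ` {..<q}"
      using near_rows[OF v] by blast
    then have "\<exists>j<hitters. \<mu>\<^sub>0 Hit j = v" using \<open>q = 1\<close> by (auto simp: nearest_row_def lessThan_Suc One_nat_def)
    then show ?thesis using nearest[OF v] by (fastforce simp: nearest_hitter_def)
  qed
qed (use k_pos guess_less q_pos in \<open>auto simp: lessThan_empty_iff bot_nat_def\<close>)

definition ready :: "nat \<Rightarrow> var store \<Rightarrow> arr arrays \<Rightarrow> bool" where
  "ready i \<sigma> \<mu> \<longleftrightarrow> \<sigma> Hitters = hitters \<and> \<sigma> RowLen = q \<and> \<sigma> Radius = R \<and> \<sigma> Gap = gap \<and> \<sigma> Target = target \<and>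
     \<sigma> Reach = reach \<and> (\<forall>l<i. \<sigma> (Center l) < n) \<and> (\<forall>A. A \<noteq> Need \<longrightarrow> \<mu> A = \<mu>\<^sub>0 A)"

lemma readyD:
  assumes "ready i \<sigma> \<mu>"
  shows "\<sigma> Hitters = hitters" "\<sigma> RowLen = q" "\<sigma> Radius = R" "\<sigma> Gap = gap" "\<sigma> Target = target" "\<sigma> Reach = reach"
    and "l < i \<Longrightarrow> \<sigma> (Center l) < n" and "A \<noteq> Need \<Longrightarrow> \<mu> A = \<mu>\<^sub>0 A"
  using assms by (auto simp: ready_def)

lemma ready_Suc: "ready (Suc i) \<sigma> \<mu> \<longleftrightarrow> ready i \<sigma> \<mu> \<and> \<sigma> (Center i) < n"
  by (auto simp: ready_def less_Suc_eq)

definition improves :: "var store \<Rightarrow> var store \<Rightarrow> bool" where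
  "improves \<sigma> \<sigma>' \<longleftrightarrow> \<sigma>' Found = \<sigma> Found \<and> (\<forall>l<k. solution \<sigma>' l = solution \<sigma> l) \<or>
     \<sigma>' Found = 1 \<and> covering target (solution \<sigma>')"

lemma improves_trans: "improves \<sigma> \<sigma>' \<Longrightarrow> improves \<sigma>' \<sigma>'' \<Longrightarrow> improves \<sigma> \<sigma>''"
  using covering_cong[of "solution \<sigma>''" "solution \<sigma>'" target] by (auto simp: improves_def)

lemma improves_found: "improves \<sigma> \<sigma>' \<Longrightarrow> \<sigma> Found \<noteq> 0 \<Longrightarrow> \<sigma>' Found \<noteq> 0"
  by (auto simp: improves_def)

lemma uncovered_expr_eval:
  assumes "ready i \<sigma> \<mu>" "\<sigma> Vert < n"
  shows "safe w len (uncovered_expr i) \<sigma> \<mu> \<and>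
    val len (uncovered_expr i) \<sigma> \<mu> = of_bool (uncovered (\<sigma> Threshold) i (centers \<sigma>) (\<sigma> Vert))"
  using assms(1)
proof (induction i)
  case (Suc i)
  then have "\<sigma> (Center i) < n" by (simp add: ready_Suc)
  then have "\<mu> Dist (cell (\<sigma> (Center i)) (\<sigma> Vert)) = d (\<sigma> (Center i)) (\<sigma> Vert)"
    using readyD(8)[OF Suc.prems] dist assms(2) by simp
  then show ?case
    using Suc \<open>\<sigma> (Center i) < n\<close> assms(2) by (auto simp: ready_Suc uncovered_Suc centers_def)
qed (simp add: uncovered_def)

lemma find_farthest_spec:
  assumes "ready i \<sigma> \<mu>"
  shows "WP (find_farthest i) (\<lambda>_ \<sigma>' \<mu>'. farthest (\<sigma> Threshold) i (centers \<sigma>) (\<sigma>' Best) (\<sigma>' (Far i)))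
    (n * (10 * i + 26) + 10) \<sigma> \<mu>"
proof -
  let ?body = "IF uncovered_expr i \<otimes> (Var Best \<lessdot> HitDist\<langle>Var Vert\<rangle> \<oplus> Lit 1)
     THEN (Best ::= HitDist\<langle>Var Vert\<rangle> \<oplus> Lit 1 ;; Far i ::= Var Vert) ELSE Skip"
  let ?U = "uncovered (\<sigma> Threshold) i (centers \<sigma>)"
  let ?I = "\<lambda>j \<sigma>' (\<mu>' :: arr arrays). \<sigma>' (Far i) < n \<and> (\<forall>z<j. ?U z \<longrightarrow> \<mu>\<^sub>0 HitDist z < \<sigma>' Best) \<and>
    (\<sigma>' Best \<noteq> 0 \<longrightarrow> \<sigma>' Best = Suc (\<mu>\<^sub>0 HitDist (\<sigma>' (Far i))) \<and> ?U (\<sigma>' (Far i)))"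
  let ?\<sigma> = "\<sigma>(Best := 0, Far i := 0)"
  have "WP (FOR Vert < Size DO ?body) (\<lambda>_. ?I n) (n * (10 * i + 26) + 6) ?\<sigma> \<mu>"
  proof (rule wp_For[where I = ?I and N = n])
    fix j \<sigma>' \<mu>'
    assume j: "j < n" "\<sigma>' Vert = j" and frame: "\<And>y. y \<noteq> Vert \<Longrightarrow> y \<notin> writes ?body \<Longrightarrow> \<sigma>' y = ?\<sigma> y"
      "\<And>A. A \<notin> stores ?body \<Longrightarrow> \<mu>' A = \<mu> A" and inv: "?I j \<sigma>' \<mu>'"
    have "ready i \<sigma>' \<mu>'" using assms frame by (simp add: ready_def)
    moreover have "centers \<sigma>' = centers \<sigma>" using frame(1) by (simp add: centers_def fun_eq_iff)
    ultimately have test: "safe w len (uncovered_expr i) \<sigma>' \<mu>'" "val len (uncovered_expr i) \<sigma>' \<mu>' = of_bool (?U j)"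
      using uncovered_expr_eval[of i \<sigma>' \<mu>'] j frame(1) by simp_all
    have raise: "\<forall>z<j. ?U z \<longrightarrow> \<mu>\<^sub>0 HitDist z < b" if "\<sigma>' Best \<le> b" for b
      using inv that by (blast intro: less_le_trans)
    have dS: "\<mu>' HitDist j = \<mu>\<^sub>0 HitDist j" using \<open>ready i \<sigma>' \<mu>'\<close> by (simp add: readyD)
    moreover have "\<mu>\<^sub>0 HitDist j + 1 < 2 ^ w" using dS_le_inf[OF j(1)] word by simp
    ultimately show "WP ?body (\<lambda>_. ?I (Suc j)) (10 * i + 18) \<sigma>' \<mu>'"
      using test j inv raise[of "\<mu>\<^sub>0 HitDist j + 1"]
      by (intro wp_Branch wp_Seq wp_Assign wp_Skip) (auto simp: All_less_Suc)
  qed (use n_pos in simp_all)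
  then show ?thesis
    unfolding find_farthest_def by (intro wp_Seq wp_Assign) (auto simp: farthest_def algebra_simps)
qed

lemma copy_centers_spec: "WP (copy_centers i) (\<lambda>_ \<sigma>' \<mu>'. \<forall>l<i. solution \<sigma>' l = centers \<sigma> l) (2 * i) \<sigma> \<mu>"
proof (induction i)
  case (Suc i)
  show ?case
    unfolding copy_centers.simps
    by (rule wp_Seq, rule wp_call[OF Suc.IH]) (auto simp: less_Suc_eq centers_def solution_def intro!: wp_Assign)
qed (simp add: wp_Skip)

lemma record_solution_spec:
  assumes "\<sigma> Ok \<noteq> 0 \<Longrightarrow> covering target (centers \<sigma>)"
  shows "WP (record_solution k) (\<lambda>_ \<sigma>' \<mu>'. improves \<sigma> \<sigma>' \<and> (\<sigma> Ok \<noteq> 0 \<longrightarrow> \<sigma>' Found \<noteq> 0)) (2 * k + 4) \<sigma> \<mu>"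
  unfolding record_solution_def
proof (intro wp_Branch wp_Seq[of _ _ "Found ::= _"] wp_Assign)
  let ?\<sigma> = "\<sigma>(Found := val len (Lit 1) \<sigma> \<mu>)"
  let ?Q = "\<lambda>(_ :: nat) \<sigma>' (\<mu>' :: arr arrays). improves \<sigma> \<sigma>' \<and> (\<sigma> Ok \<noteq> 0 \<longrightarrow> \<sigma>' Found \<noteq> 0)"
  assume "val len (Var Ok) \<sigma> \<mu> \<noteq> 0"
  then have sound: "covering target (centers \<sigma>)" using assms by simp
  show "WP (copy_centers k) ?Q (2 * k + 4 - (cost (Var Ok :: (var, arr) expr) + 1) - (cost (Lit 1 :: (var, arr) expr) + 1)) ?\<sigma> \<mu>"
    by (rule wp_call[OF copy_centers_spec]) (use sound in \<open>auto simp: improves_def centers_def cong: covering_cong\<close>)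
qed (auto simp: improves_def intro: wp_Skip)

lemma covering_iff_none_uncovered:
  "ready k \<sigma> \<mu> \<Longrightarrow> covering target (centers \<sigma>) \<longleftrightarrow> (\<forall>z<n. \<not> uncovered target k (centers \<sigma>) z)"
  by (auto simp: covering_def uncovered_def ready_def centers_def not_less)

lemma covering_last_iff:
  assumes "Suc i = k" "ready i \<sigma> \<mu>" "u < n"
  shows "covering target ((centers \<sigma>)(i := u)) \<longleftrightarrow> (\<forall>z<n. uncovered target i (centers \<sigma>) z \<longrightarrow> d u z \<le> target)"
proof -
  have "(\<exists>l<Suc i. d (((centers \<sigma>)(i := u)) l) z \<le> target) \<longleftrightarrow> (uncovered target i (centers \<sigma>) z \<longrightarrow> d u z \<le> target)" for z
    unfolding uncovered_def less_Suc_eq by (metis fun_upd_apply less_irrefl not_less)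
  moreover have "\<forall>l<Suc i. ((centers \<sigma>)(i := u)) l < n"
    using assms(2,3) by (simp add: ready_def centers_def less_Suc_eq)
  ultimately show ?thesis by (simp add: covering_def assms(1))
qed

definition tried :: "(nat \<Rightarrow> bool) \<Rightarrow> nat \<Rightarrow> var store \<Rightarrow> var store \<Rightarrow> bool" where
  "tried P j \<sigma> \<sigma>' \<longleftrightarrow> improves \<sigma> \<sigma>' \<and> ((\<exists>i<j. P i) \<longrightarrow> \<sigma>' Found \<noteq> 0)"

lemma tried_upd [simp]:
  "tried P j \<sigma> (\<sigma>'(Pos := a)) = tried P j \<sigma> \<sigma>'" "tried P j \<sigma> (\<sigma>'(Center i := a)) = tried P j \<sigma> \<sigma>'"
  "tried P j \<sigma> (\<sigma>'(Choice i := a)) = tried P j \<sigma> \<sigma>'"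
  by (simp_all add: tried_def improves_def solution_def cong: covering_cong)

lemma tried_0: "tried P 0 \<sigma> \<sigma>"
  by (simp add: tried_def improves_def)

lemma tried_Suc: "tried P j \<sigma> \<sigma>' \<Longrightarrow> improves \<sigma>' \<sigma>'' \<Longrightarrow> (P j \<Longrightarrow> \<sigma>'' Found \<noteq> 0) \<Longrightarrow> tried P (Suc j) \<sigma> \<sigma>''"
  using improves_trans improves_found unfolding tried_def less_Suc_eq by blast

lemma check_and_record_spec:
  assumes check: "WP c (\<lambda>_ \<sigma>' \<mu>'. \<sigma>' Ok = of_bool ok) C \<sigma> \<mu>" and "writes c \<subseteq> {Vert, Pos, Ok}"
    and sound: "ok \<Longrightarrow> covering target (centers \<sigma>)"
  shows "WP (c ;; record_solution k) (\<lambda>_ \<sigma>' \<mu>'. improves \<sigma> \<sigma>' \<and> (ok \<longrightarrow> \<sigma>' Found \<noteq> 0)) (C + 2 * k + 4) \<sigma> \<mu>"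
proof (rule wp_Seq, rule wp_call[OF check])
  fix t \<sigma>1 and \<mu>1 :: "arr arrays"
  assume budget: "C + 2 * k + 4 - C \<le> t" and frame: "\<And>x. x \<notin> writes c \<Longrightarrow> \<sigma>1 x = \<sigma> x" and ok: "\<sigma>1 Ok = of_bool ok"
  have same: "centers \<sigma>1 = centers \<sigma>" "\<sigma>1 Found = \<sigma> Found" "\<forall>l<k. solution \<sigma>1 l = solution \<sigma> l"
    using frame assms(2) by (auto simp: centers_def solution_def fun_eq_iff)
  have "covering target (centers \<sigma>1)" if "\<sigma>1 Ok \<noteq> 0" using sound that ok unfolding same by simp
  then show "WP (record_solution k) (\<lambda>_ \<sigma>' \<mu>'. improves \<sigma> \<sigma>' \<and> (ok \<longrightarrow> \<sigma>' Found \<noteq> 0)) t \<sigma>1 \<mu>1"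
    by (rule wp_call[OF record_solution_spec]) (use budget ok same in \<open>auto simp: improves_def\<close>)
qed simp

lemma check_covering_spec:
  assumes "ready k \<sigma> \<mu>" "\<sigma> Threshold = target"
  shows "WP (Ok ::= NONE Vert < Size WITH uncovered_expr k)
    (\<lambda>_ \<sigma>' \<mu>'. \<sigma>' Ok = of_bool (covering target (centers \<sigma>))) (n * (10 * k + 12) + 8) \<sigma> \<mu>"
proof -
  have "WP (Ok ::= NONE Vert < Size WITH uncovered_expr k)
      (\<lambda>_ \<sigma>' \<mu>'. \<sigma>' Ok = of_bool (\<forall>z<n. \<not> uncovered target k (centers \<sigma>) z))
      (n * (10 * k + 12) + 8) \<sigma> \<mu>"
  proof (rule wp_Check)
    fix z \<sigma>' assume z: "z < n" "\<sigma>' Vert = z" and frame: "\<And>y. y \<noteq> Vert \<Longrightarrow> y \<noteq> Ok \<Longrightarrow> \<sigma>' y = \<sigma> y"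
    have "ready k \<sigma>' \<mu>" "centers \<sigma>' = centers \<sigma>"
      using assms(1) frame by (simp_all add: ready_def centers_def fun_eq_iff)
    then show "safe w len (uncovered_expr k) \<sigma>' \<mu> \<and>
        (val len (uncovered_expr k) \<sigma>' \<mu> = 0 \<longleftrightarrow> \<not> uncovered target k (centers \<sigma>) z)"
      using uncovered_expr_eval[of k \<sigma>' \<mu>] z frame assms(2) by simp
  qed simp_all
  then show ?thesis unfolding covering_iff_none_uncovered[OF assms(1)] .
qed

lemma leaf_far_spec:
  assumes ready: "ready i \<sigma> \<mu>" and i: "Suc i = k" and "\<sigma> Threshold = target" "\<sigma> (Far i) = v" "v < n"
  shows "WP (leaf_far i) (\<lambda>_ \<sigma>' \<mu>'. improves \<sigma> \<sigma>' \<and>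
      ((\<exists>u\<in>near_row \<mu>\<^sub>0 v ` {..<q}. covering target ((centers \<sigma>)(i := u))) \<longrightarrow> \<sigma>' Found \<noteq> 0))
    (q * (n * (10 * k + 12) + 2 * k + 28) + 6) \<sigma> \<mu>"
proof -
  let ?check = "Ok ::= NONE Vert < Size WITH uncovered_expr k ;; record_solution k"
  let ?body = "Center i ::= Near\<langle>entry (Var (Far i)) (Var Pos)\<rangle> ;; ?check"
  let ?pass = "\<lambda>j. covering target ((centers \<sigma>)(i := near_row \<mu>\<^sub>0 v j))"
  have "WP (leaf_far i) (\<lambda>_ \<sigma>' \<mu>'. tried ?pass q \<sigma> \<sigma>') (q * (n * (10 * k + 12) + 2 * k + 28) + 6) \<sigma> \<mu>"
    unfolding leaf_far_def i
  proof (rule wp_For[where I = "\<lambda>j \<sigma>' \<mu>'. tried ?pass j \<sigma> \<sigma>'" and N = q])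
    fix j \<sigma>' \<mu>'
    assume j: "j < q" "\<sigma>' Pos = j" and frame: "\<And>y. y \<noteq> Pos \<Longrightarrow> y \<notin> writes ?body \<Longrightarrow> \<sigma>' y = \<sigma> y"
      "\<And>A. A \<notin> stores ?body \<Longrightarrow> \<mu>' A = \<mu> A" and inv: "tried ?pass j \<sigma> \<sigma>'"
    define \<sigma>1 where "\<sigma>1 = \<sigma>'(Center i := near_row \<mu>\<^sub>0 v j)"
    have "ready (Suc i) \<sigma>1 \<mu>'"
      unfolding ready_Suc using ready frame near_less[OF assms(5) j(1)] by (simp add: ready_def \<sigma>1_def)
    moreover have "\<sigma>1 Threshold = target" using frame(1) assms(3) by (simp add: \<sigma>1_def)
    moreover have "centers \<sigma>1 = (centers \<sigma>)(i := near_row \<mu>\<^sub>0 v j)"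
      using frame(1) by (simp add: centers_def fun_eq_iff \<sigma>1_def)
    ultimately have "WP (Ok ::= NONE Vert < Size WITH uncovered_expr k)
        (\<lambda>_ \<sigma>'' \<mu>''. \<sigma>'' Ok = of_bool (?pass j)) (n * (10 * k + 12) + 8) \<sigma>1 \<mu>'"
      using check_covering_spec[of \<sigma>1 \<mu>'] by (simp add: i)
    then have "WP ?check (\<lambda>_ \<sigma>'' \<mu>''. improves \<sigma>1 \<sigma>'' \<and> (?pass j \<longrightarrow> \<sigma>'' Found \<noteq> 0)) (n * (10 * k + 12) + 8 + 2 * k + 4) \<sigma>1 \<mu>'"
      by (rule check_and_record_spec) (simp_all add: \<open>centers \<sigma>1 = _\<close>)
    then have "WP ?check (\<lambda>_ \<sigma>'' \<mu>''. tried ?pass (Suc j) \<sigma> \<sigma>'') (12 + n * (10 * k + 12) + 2 * k) \<sigma>1 \<mu>'"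
      by (rule wp_call) (use tried_Suc[of ?pass j \<sigma> \<sigma>1] inv in \<open>auto simp: \<sigma>1_def\<close>)
    moreover have "\<sigma>' (Far i) = v" "\<mu>' Near (cell v j) = near_row \<mu>\<^sub>0 v j"
      using frame ready assms(4) by (simp_all add: ready_def near_row_def)
    ultimately show "WP ?body (\<lambda>_ \<sigma>'' \<mu>''. tried ?pass (Suc j) \<sigma> \<sigma>'') (n * (10 * k + 12) + 2 * k + 20) \<sigma>' \<mu>'"
      using j q_le assms(5) by (intro wp_Seq[of _ _ "Center i ::= _"] wp_Assign) (simp_all add: \<sigma>1_def algebra_simps)
  qed (use ready in \<open>auto simp: ready_def tried_0\<close>)
  then show ?thesis by (rule wp_call) (auto simp: tried_def algebra_simps)
qed

definition needed :: "nat \<Rightarrow> (nat \<Rightarrow> nat) \<Rightarrow> nat \<Rightarrow> bool" where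
  "needed i X j \<longleftrightarrow> (\<exists>z<n. uncovered target i X z \<and> \<mu>\<^sub>0 HitIndex z = j)"

lemma mark_needed_spec:
  assumes ready: "ready i \<sigma> \<mu>" and "\<sigma> Threshold = target"
  shows "WP (mark_needed i) (\<lambda>_ \<sigma>' \<mu>'. \<forall>j<hitters. \<mu>' Need j = of_bool (needed i (centers \<sigma>) j))
    (hitters * 12 + n * (10 * i + 16) + 12) \<sigma> \<mu>"
proof -
  let ?reset = "FOR Pos < Var Hitters DO Need\<langle>Var Pos\<rangle> ::= Lit 0"
  let ?body = "IF uncovered_expr i THEN Need\<langle>HitIndex\<langle>Var Vert\<rangle>\<rangle> ::= Lit 1 ELSE Skip"
  let ?U = "uncovered target i (centers \<sigma>)"
  let ?I = "\<lambda>z (\<sigma>' :: var store) \<mu>'. \<forall>j<hitters. \<mu>' Need j = of_bool (\<exists>y<z. ?U y \<and> \<mu>\<^sub>0 HitIndex y = j)"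
  have hitters_less: "hitters < 2 ^ w" using hitters_le less_word(3) by (rule le_less_trans)
  have reset: "WP ?reset (\<lambda>_ \<sigma>' \<mu>'. \<forall>j<hitters. \<mu>' Need j = 0) (hitters * 12 + 6) \<sigma> \<mu>"
    by (rule wp_For[where I = "\<lambda>j \<sigma>' \<mu>'. \<forall>j'<j. \<mu>' Need j' = 0" and N = hitters])
      (use ready hitters_less hitters_le in \<open>auto simp: ready_def less_Suc_eq intro!: wp_Update\<close>)
  show ?thesis
    unfolding mark_needed_def
  proof (rule wp_Seq[OF wp_call[OF reset]])
    fix t \<sigma>1 \<mu>1
    assume budget: "hitters * 12 + n * (10 * i + 16) + 12 - (hitters * 12 + 6) \<le> t" and frame1: "\<And>x. x \<notin> writes ?reset \<Longrightarrow> \<sigma>1 x = \<sigma> x"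
      "\<And>A. A \<notin> stores ?reset \<Longrightarrow> \<mu>1 A = \<mu> A" and unmarked: "\<forall>j<hitters. \<mu>1 Need j = 0"
    have "WP (FOR Vert < Size DO ?body) (\<lambda>_. ?I n) (n * (10 * i + 16) + 6) \<sigma>1 \<mu>1"
    proof (rule wp_For[where I = ?I and N = n])
      fix z \<sigma>' \<mu>'
      assume z: "z < n" "\<sigma>' Vert = z" and frame: "\<And>y. y \<noteq> Vert \<Longrightarrow> y \<notin> writes ?body \<Longrightarrow> \<sigma>' y = \<sigma>1 y"
        "\<And>A. A \<notin> stores ?body \<Longrightarrow> \<mu>' A = \<mu>1 A" and inv: "?I z \<sigma>' \<mu>'"
      have "ready i \<sigma>' \<mu>'" "centers \<sigma>' = centers \<sigma>" "\<sigma>' Threshold = target"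
        using assms frame frame1 by (simp_all add: ready_def centers_def fun_eq_iff)
      then show "WP ?body (\<lambda>_. ?I (Suc z)) (10 * i + 8) \<sigma>' \<mu>'"
        using uncovered_expr_eval[of i \<sigma>' \<mu>'] nearest[OF z(1)] z inv
        by (intro wp_Branch wp_Update wp_Skip) (auto simp: ready_def nearest_hitter_def less_Suc_eq)
    qed (use unmarked in simp_all)
    then show "WP (FOR Vert < Size DO ?body) (\<lambda>_ \<sigma>' \<mu>'. \<forall>j<hitters. \<mu>' Need j = of_bool (needed i (centers \<sigma>) j)) t \<sigma>1 \<mu>1"
      by (rule wp_call) (use budget in \<open>auto simp: needed_def algebra_simps\<close>)
  qed simp
qed

definition close_to_needed :: "nat \<Rightarrow> (nat \<Rightarrow> nat) \<Rightarrow> nat \<Rightarrow> bool" where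
  "close_to_needed i X u \<longleftrightarrow> (\<forall>j<hitters. needed i X j \<longrightarrow> d u (\<mu>\<^sub>0 Hit j) \<le> R + reach)"

lemma near_hitter:
  assumes "z < n" "\<mu>\<^sub>0 HitDist z \<le> reach"
  shows "\<mu>\<^sub>0 HitIndex z < hitters" "d z (\<mu>\<^sub>0 Hit (\<mu>\<^sub>0 HitIndex z)) = \<mu>\<^sub>0 HitDist z"
  using nearest[OF assms(1)] assms(2) reach_le R_less by (auto simp: nearest_hitter_def)

lemma covering_if_close_to_needed:
  assumes "close_to_needed i (centers \<sigma>) u" "Suc i = k" "ready i \<sigma> \<mu>" "u < n"
    and near: "\<And>z. z < n \<Longrightarrow> uncovered target i (centers \<sigma>) z \<Longrightarrow> \<mu>\<^sub>0 HitDist z \<le> reach"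
  shows "covering target ((centers \<sigma>)(i := u))"
  unfolding covering_last_iff[OF assms(2-4)]
proof (intro allI impI)
  fix z assume z: "z < n" "uncovered target i (centers \<sigma>) z"
  note hitter = near_hitter[OF z(1) near[OF z]]
  have "needed i (centers \<sigma>) (\<mu>\<^sub>0 HitIndex z)" using z by (auto simp: needed_def)
  then have "d u (\<mu>\<^sub>0 Hit (\<mu>\<^sub>0 HitIndex z)) \<le> R + reach" using assms(1) hitter(1) by (simp add: close_to_needed_def)
  then show "d u z \<le> target" using leaf_near_sound[OF z(1), of "\<mu>\<^sub>0 Hit (\<mu>\<^sub>0 HitIndex z)" u] hitter(2) near[OF z] by simp
qed

lemma close_to_needed_if_center:
  assumes "c < n" "\<forall>v<n. uncovered target i X v \<longrightarrow> d v c \<le> R"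
    and near: "\<And>z. z < n \<Longrightarrow> uncovered target i X z \<Longrightarrow> \<mu>\<^sub>0 HitDist z \<le> reach"
  shows "close_to_needed i X c"
  unfolding close_to_needed_def needed_def
  using leaf_near_complete[OF assms(1,2)] near_hitter near by fastforce

lemma check_close_spec:
  assumes "ready i \<sigma> \<mu>" "\<sigma> (Center i) = u" "u < n" "\<forall>j<hitters. \<mu> Need j = of_bool (needed i X j)"
  shows "WP (check_close i) (\<lambda>_ \<sigma>' \<mu>'. \<sigma>' Ok = of_bool (close_to_needed i X u)) (28 * hitters + 8) \<sigma> \<mu>"
proof -
  let ?test = "Need\<langle>Var Pos\<rangle> \<otimes> (Var Radius \<oplus> Var Reach \<lessdot> Dist\<langle>entry (Var (Center i)) (Hit\<langle>Var Pos\<rangle>)\<rangle>)"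
  have "WP (check_close i) (\<lambda>_ \<sigma>' \<mu>'. \<sigma>' Ok = of_bool (\<forall>j<hitters. \<not> (needed i X j \<and> R + reach < d u (\<mu>\<^sub>0 Hit j))))
      (28 * hitters + 8) \<sigma> \<mu>"
    unfolding check_close_def
  proof (rule wp_Check)
    fix j \<sigma>' assume j: "j < hitters" "\<sigma>' Pos = j" and frame: "\<And>y. y \<noteq> Pos \<Longrightarrow> y \<noteq> Ok \<Longrightarrow> \<sigma>' y = \<sigma> y"
    have "\<sigma>' Radius = R" "\<sigma>' Reach = reach" "\<sigma>' (Center i) = u" "\<mu> Hit j = \<mu>\<^sub>0 Hit j" "\<mu> Dist = \<mu>\<^sub>0 Dist"
      using assms(1,2) frame by (simp_all add: ready_def)
    moreover have "j < n" "R + reach < 2 ^ w" using j(1) hitters_le reach_le R_less word by simp_all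
    ultimately show "safe w len ?test \<sigma>' \<mu> \<and>
        (val len ?test \<sigma>' \<mu> = 0 \<longleftrightarrow> \<not> (needed i X j \<and> R + reach < d u (\<mu>\<^sub>0 Hit j)))"
      using j assms(3,4) hit_less[OF j(1)] dist[OF assms(3)] by simp
  qed (use assms(1) hitters_le less_word(3) in \<open>auto simp: ready_def le_less_trans\<close>)
  moreover have "(\<forall>j<hitters. \<not> (needed i X j \<and> R + reach < d u (\<mu>\<^sub>0 Hit j))) \<longleftrightarrow> close_to_needed i X u"
    by (auto simp: close_to_needed_def not_less)
  ultimately show ?thesis by (simp only:)
qed

lemma leaf_near_spec:
  assumes ready: "ready i \<sigma> \<mu>" and i: "Suc i = k"
    and need: "\<forall>j<hitters. \<mu> Need j = of_bool (needed i (centers \<sigma>) j)"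
    and near: "\<And>z. z < n \<Longrightarrow> uncovered target i (centers \<sigma>) z \<Longrightarrow> \<mu>\<^sub>0 HitDist z \<le> reach"
  shows "WP (leaf_near i) (\<lambda>_ \<sigma>' \<mu>'. improves \<sigma> \<sigma>' \<and> ((\<exists>u<n. close_to_needed i (centers \<sigma>) u) \<longrightarrow> \<sigma>' Found \<noteq> 0))
    (n * (28 * hitters + 2 * k + 20) + 6) \<sigma> \<mu>"
proof -
  let ?body = "check_close i ;; record_solution k"
  let ?pass = "close_to_needed i (centers \<sigma>)"
  have "WP (leaf_near i) (\<lambda>_ \<sigma>' \<mu>'. tried ?pass n \<sigma> \<sigma>')
      (n * (28 * hitters + 2 * k + 20) + 6) \<sigma> \<mu>"
    unfolding leaf_near_def i
  proof (rule wp_For[where I = "\<lambda>j \<sigma>' \<mu>'. tried ?pass j \<sigma> \<sigma>'" and N = n])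
    fix u \<sigma>' \<mu>'
    assume u: "u < n" "\<sigma>' (Center i) = u" and frame: "\<And>y. y \<noteq> Center i \<Longrightarrow> y \<notin> writes ?body \<Longrightarrow> \<sigma>' y = \<sigma> y"
      "\<And>A. A \<notin> stores ?body \<Longrightarrow> \<mu>' A = \<mu> A" and inv: "tried ?pass u \<sigma> \<sigma>'"
    have "\<mu>' = \<mu>" using frame(2) by auto
    have "ready i \<sigma>' \<mu>" using ready frame(1) by (simp add: ready_def)
    from check_close_spec[OF this u(2,1) need]
    have check: "WP (check_close i) (\<lambda>_ \<sigma>'' \<mu>''. \<sigma>'' Ok = of_bool (?pass u)) (28 * hitters + 8) \<sigma>' \<mu>" .
    have "centers \<sigma>' = (centers \<sigma>)(i := u)" using frame(1) u(2) by (auto simp: centers_def fun_eq_iff)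
    then have "covering target (centers \<sigma>')" if "?pass u"
      using covering_if_close_to_needed[OF that i ready u(1) near] by simp
    with check have "WP ?body (\<lambda>_ \<sigma>'' \<mu>''. improves \<sigma>' \<sigma>'' \<and> (?pass u \<longrightarrow> \<sigma>'' Found \<noteq> 0))
        (28 * hitters + 8 + 2 * k + 4) \<sigma>' \<mu>'"
      unfolding \<open>\<mu>' = \<mu>\<close> by (intro check_and_record_spec) simp_all
    then show "WP ?body (\<lambda>_ \<sigma>'' \<mu>''. tried ?pass (Suc u) \<sigma> \<sigma>'') (28 * hitters + 2 * k + 12) \<sigma>' \<mu>'"
      by (rule wp_call) (use tried_Suc[of ?pass u \<sigma> \<sigma>'] inv in auto)
  qed (simp_all add: tried_0)
  then show ?thesis by (rule wp_call) (auto simp: tried_def algebra_simps)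
qed

lemma covering_in_near_row:
  assumes "completable i (centers \<sigma>)" "Suc i = k" "ready i \<sigma> \<mu>"
    and v: "v < n" "uncovered target i (centers \<sigma>) v" "reach < \<mu>\<^sub>0 HitDist v"
  shows "\<exists>u\<in>near_row \<mu>\<^sub>0 v ` {..<q}. covering target ((centers \<sigma>)(i := u))"
proof -
  obtain c where "\<forall>z<n. uncovered target i (centers \<sigma>) z \<longrightarrow> d z c \<le> R"
    using completable_leaf[OF assms(1,2)] by blast
  from leaf_far_complete[OF this v] obtain u where u: "u \<in> near_row \<mu>\<^sub>0 v ` {..<q}"
      "\<forall>z<n. uncovered target i (centers \<sigma>) z \<longrightarrow> d u z \<le> target" by blast
  have "u < n" using u(1) near_less[OF v(1)] by auto
  from u covering_last_iff[OF assms(2,3) this] show ?thesis by blast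
qed

lemma near_branch_spec:
  assumes ready: "ready i \<sigma> \<mu>" and i: "Suc i = k" and threshold: "\<sigma> Threshold = target"
    and near: "\<And>z. z < n \<Longrightarrow> uncovered target i (centers \<sigma>) z \<Longrightarrow> \<mu>\<^sub>0 HitDist z \<le> reach"
  shows "WP (mark_needed i ;; leaf_near i) (\<lambda>_ \<sigma>' \<mu>'. improves \<sigma> \<sigma>' \<and> (completable i (centers \<sigma>) \<longrightarrow> \<sigma>' Found \<noteq> 0))
    (hitters * 12 + n * (10 * i + 16) + 12 + (n * (28 * hitters + 2 * k + 20) + 6)) \<sigma> \<mu>"
proof (rule wp_Seq, rule wp_call[OF mark_needed_spec[OF ready threshold]])
  fix t \<sigma>1 \<mu>1
  assume budget: "hitters * 12 + n * (10 * i + 16) + 12 + (n * (28 * hitters + 2 * k + 20) + 6) -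
      (hitters * 12 + n * (10 * i + 16) + 12) \<le> t" and frame: "\<And>x. x \<notin> writes (mark_needed i) \<Longrightarrow> \<sigma>1 x = \<sigma> x"
    "\<And>A. A \<notin> stores (mark_needed i) \<Longrightarrow> \<mu>1 A = \<mu> A"
    and marked: "\<forall>j<hitters. \<mu>1 Need j = of_bool (needed i (centers \<sigma>) j)"
  have ready1: "ready i \<sigma>1 \<mu>1" "centers \<sigma>1 = centers \<sigma>" "improves \<sigma>1 = improves \<sigma>"
    using ready frame by (auto simp: ready_def centers_def fun_eq_iff improves_def solution_def)
  have "\<exists>u<n. close_to_needed i (centers \<sigma>) u" if "completable i (centers \<sigma>)"
    using completable_leaf[OF that i] close_to_needed_if_center near by blast
  then show "WP (leaf_near i) (\<lambda>_ \<sigma>' \<mu>'. improves \<sigma> \<sigma>' \<and> (completable i (centers \<sigma>) \<longrightarrow> \<sigma>' Found \<noteq> 0)) t \<sigma>1 \<mu>1"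
    using budget marked near ready1 by (intro wp_call[OF leaf_near_spec[OF ready1(1) i]]) auto
qed simp

lemma leaf_spec:
  assumes ready: "ready i \<sigma> \<mu>" and i: "Suc i = k"
  shows "WP (leaf i) (\<lambda>_ \<sigma>' \<mu>'. improves \<sigma> \<sigma>' \<and> (completable i (centers \<sigma>) \<longrightarrow> \<sigma>' Found \<noteq> 0)) (leaf_cost hitters) \<sigma> \<mu>"
proof -
  let ?Q = "\<lambda>(_ :: nat) \<sigma>' (\<mu>' :: arr arrays). improves \<sigma> \<sigma>' \<and> (completable i (centers \<sigma>) \<longrightarrow> \<sigma>' Found \<noteq> 0)"
  let ?test = "Var Reach \<oplus> Lit 1 \<lessdot> Var Best"
  let ?split = "IF ?test THEN leaf_far i ELSE (mark_needed i ;; leaf_near i)"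
  have "i < k" using i by simp
  note cost_far = leaf_cost_bounds(1)[where H = hitters, OF this] and cost_near = leaf_cost_bounds(2)[where H = hitters, OF this]
  define \<sigma>1 where "\<sigma>1 = \<sigma>(Threshold := target)"
  have ready1: "ready i \<sigma>1 \<mu>" "centers \<sigma>1 = centers \<sigma>" "\<sigma>1 Threshold = target"
    using ready by (simp_all add: ready_def \<sigma>1_def centers_def fun_eq_iff)
  have "WP (find_farthest i ;; ?split) ?Q (leaf_cost hitters - 2) \<sigma>1 \<mu>"
  proof (rule wp_Seq, rule wp_call[OF find_farthest_spec[OF ready1(1)]])
    fix t \<sigma>2 \<mu>2
    assume budget: "leaf_cost hitters - 2 - (n * (10 * i + 26) + 10) \<le> t"
      and frame: "\<And>x. x \<notin> writes (find_farthest i) \<Longrightarrow> \<sigma>2 x = \<sigma>1 x" "\<And>A. A \<notin> stores (find_farthest i) \<Longrightarrow> \<mu>2 A = \<mu> A"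
      and "farthest (\<sigma>1 Threshold) i (centers \<sigma>1) (\<sigma>2 Best) (\<sigma>2 (Far i))"
    then have far: "farthest target i (centers \<sigma>) (\<sigma>2 Best) (\<sigma>2 (Far i))" using ready1 by simp
    have ready2: "ready i \<sigma>2 \<mu>2" "centers \<sigma>2 = centers \<sigma>" "\<sigma>2 Threshold = target" "improves \<sigma>2 = improves \<sigma>"
      using ready1 frame by (auto simp: ready_def centers_def fun_eq_iff improves_def solution_def \<sigma>1_def)
    show "WP ?split ?Q t \<sigma>2 \<mu>2"
    proof (rule wp_Branch)
      assume "val len ?test \<sigma>2 \<mu>2 \<noteq> 0"
      then have v: "\<sigma>2 (Far i) < n" "uncovered target i (centers \<sigma>2) (\<sigma>2 (Far i))" "reach < \<mu>\<^sub>0 HitDist (\<sigma>2 (Far i))"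
        using far ready2 by (auto simp: farthest_def ready_def split: if_splits)
      show "WP (leaf_far i) ?Q (t - (cost (?test :: (var, arr) expr) + 1)) \<sigma>2 \<mu>2"
        using covering_in_near_row[OF _ i ready2(1) v] budget cost_far ready2
        by (intro wp_call[OF leaf_far_spec[OF ready2(1) i ready2(3) refl v(1)]]) auto
    next
      assume "val len ?test \<sigma>2 \<mu>2 = 0"
      then have near: "\<mu>\<^sub>0 HitDist z \<le> reach" if "z < n" "uncovered target i (centers \<sigma>2) z" for z
        using far ready2 that by (fastforce simp: farthest_def ready_def split: if_splits)
      show "WP (mark_needed i ;; leaf_near i) ?Q (t - (cost (?test :: (var, arr) expr) + 1)) \<sigma>2 \<mu>2"
        using budget cost_near ready2 by (intro wp_call[OF near_branch_spec[OF ready2(1) i ready2(3) near]]) auto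
    qed (use ready2(1) budget cost_far reach_le R_less word in \<open>simp_all add: ready_def\<close>)
  qed (use cost_far in simp)
  then show ?thesis
    unfolding leaf_def using ready cost_far
    by (intro wp_Seq[of _ _ "Threshold ::= _"] wp_Assign) (simp_all add: \<sigma>1_def ready_def)
qed

definition candidate :: "nat \<Rightarrow> nat \<Rightarrow> nat" where
  "candidate v j = (if j < hitters then \<mu>\<^sub>0 Hit j else near_row \<mu>\<^sub>0 v (j - hitters))"

lemma candidate_less: "v < n \<Longrightarrow> j < hitters + q \<Longrightarrow> candidate v j < n"
  using hit_less near_less by (simp add: candidate_def)

lemma candidate_image:
  "\<mu>\<^sub>0 Hit ` {..<hitters} \<union> near_row \<mu>\<^sub>0 v ` {..<q} \<subseteq> candidate v ` {..<hitters + q}"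
proof (intro subsetI, elim UnE imageE)
  fix x j assume "j \<in> {..<q}" "x = near_row \<mu>\<^sub>0 v j"
  then show "x \<in> candidate v ` {..<hitters + q}"
    by (intro image_eqI[of _ _ "hitters + j"]) (simp_all add: candidate_def)
qed (auto simp: candidate_def)

lemma pick_center_spec:
  assumes "ready i \<sigma> \<mu>" "\<sigma> (Far i) = v" "v < n" "\<sigma> (Choice i) = j" "j < hitters + q"
  shows "WP (pick_center i) (\<lambda>_ \<sigma>' \<mu>'. \<sigma>' (Center i) = candidate v j) 14 \<sigma> \<mu>"
proof -
  have "j < 2 ^ w" using assms(5) hitters_le q_le word by simp
  then show ?thesis
    unfolding pick_center_def using assms hitters_le q_le
    by (intro wp_Branch wp_Assign) (auto simp: ready_def candidate_def near_row_def)
qed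

lemma search_children_spec:
  assumes ready: "ready i \<sigma> \<mu>" and v: "\<sigma> (Far i) = v" "v < n"
    and search: "\<And>\<sigma>' \<mu>'. ready (Suc i) \<sigma>' \<mu>' \<Longrightarrow> WP (search (Suc i) r)
      (\<lambda>_ \<sigma>'' \<mu>''. improves \<sigma>' \<sigma>'' \<and> (completable (Suc i) (centers \<sigma>') \<longrightarrow> \<sigma>'' Found \<noteq> 0)) C \<sigma>' \<mu>'"
  shows "WP (FOR Choice i < Var Hitters \<oplus> Var RowLen DO (pick_center i ;; search (Suc i) r))
    (\<lambda>_ \<sigma>' \<mu>'. improves \<sigma> \<sigma>' \<and> ((\<exists>x\<in>\<mu>\<^sub>0 Hit ` {..<hitters} \<union> near_row \<mu>\<^sub>0 v ` {..<q}.
      completable (Suc i) ((centers \<sigma>)(i := x))) \<longrightarrow> \<sigma>' Found \<noteq> 0)) ((hitters + q) * (C + 24) + 8) \<sigma> \<mu>"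
proof -
  let ?body = "pick_center i ;; search (Suc i) r" and ?bound = "Var Hitters \<oplus> Var RowLen :: (var, arr) expr"
  let ?pass = "\<lambda>j. completable (Suc i) ((centers \<sigma>)(i := candidate v j))"
  have bound_less: "hitters + q < 2 ^ w" using hitters_le q_le word by simp
  have "WP (FOR Choice i < ?bound DO ?body) (\<lambda>_ \<sigma>' \<mu>'. tried ?pass (hitters + q) \<sigma> \<sigma>')
      ((hitters + q) * (C + 24) + 8) \<sigma> \<mu>"
  proof (rule wp_For[where I = "\<lambda>j \<sigma>' \<mu>'. tried ?pass j \<sigma> \<sigma>'" and N = "hitters + q"])
    fix j \<sigma>' \<mu>'
    assume j: "j < hitters + q" "\<sigma>' (Choice i) = j" and frame: "\<And>y. y \<noteq> Choice i \<Longrightarrow> y \<notin> writes ?body \<Longrightarrow> \<sigma>' y = \<sigma> y"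
      "\<And>A. A \<notin> stores ?body \<Longrightarrow> \<mu>' A = \<mu> A" and inv: "tried ?pass j \<sigma> \<sigma>'"
    have ready1: "ready i \<sigma>' \<mu>'" "\<sigma>' (Far i) = v" using ready frame v(1) by (simp_all add: ready_def)
    show "WP ?body (\<lambda>_ \<sigma>'' \<mu>''. tried ?pass (Suc j) \<sigma> \<sigma>'') (C + 14) \<sigma>' \<mu>'"
    proof (rule wp_Seq, rule wp_call[OF pick_center_spec[OF ready1 v(2) j(2,1)]])
      fix t \<sigma>1 \<mu>1
      assume budget: "C + 14 - 14 \<le> t" and frame1: "\<And>x. x \<notin> writes (pick_center i) \<Longrightarrow> \<sigma>1 x = \<sigma>' x"
        "\<And>A. A \<notin> stores (pick_center i) \<Longrightarrow> \<mu>1 A = \<mu>' A" and picked: "\<sigma>1 (Center i) = candidate v j"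
      have ready2: "ready (Suc i) \<sigma>1 \<mu>1"
        unfolding ready_Suc using ready1(1) frame1 picked candidate_less[OF v(2) j(1)] by (simp add: ready_def)
      have "centers \<sigma>1 l = ((centers \<sigma>)(i := candidate v j)) l" if "l < Suc i" for l
        using that frame(1) frame1(1) picked by (auto simp: centers_def)
      then have "completable (Suc i) (centers \<sigma>1) \<longleftrightarrow> ?pass j" by (rule completable_cong)
      moreover have "solution \<sigma>1 = solution \<sigma>'" using frame1(1) by (simp add: solution_def fun_eq_iff)
      then have "tried ?pass j \<sigma> \<sigma>1" using inv frame1(1) by (simp add: tried_def improves_def)
      ultimately show "WP (search (Suc i) r) (\<lambda>_ \<sigma>'' \<mu>''. tried ?pass (Suc j) \<sigma> \<sigma>'') t \<sigma>1 \<mu>1"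
        using budget tried_Suc[of ?pass j \<sigma> \<sigma>1] by (intro wp_call[OF search[OF ready2]]) auto
    qed simp
  qed (use ready bound_less in \<open>simp_all add: ready_def tried_0\<close>)
  then show ?thesis using candidate_image[of v] by (elim wp_call) (auto simp: tried_def algebra_simps)
qed

lemma search_spec:
  assumes "ready i \<sigma> \<mu>" "Suc (i + r) = k"
  shows "WP (search i r) (\<lambda>_ \<sigma>' \<mu>'. improves \<sigma> \<sigma>' \<and> (completable i (centers \<sigma>) \<longrightarrow> \<sigma>' Found \<noteq> 0))
    (search_cost hitters r) \<sigma> \<mu>"
  using assms
proof (induction r arbitrary: i \<sigma> \<mu>)
  case 0
  then show ?case using leaf_spec by (simp add: search_cost_def)
next
  case (Suc r)
  let ?Q = "\<lambda>(_ :: nat) \<sigma>' (\<mu>' :: arr arrays). improves \<sigma> \<sigma>' \<and> (completable i (centers \<sigma>) \<longrightarrow> \<sigma>' Found \<noteq> 0)"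
  let ?children = "FOR Choice i < Var Hitters \<oplus> Var RowLen DO (pick_center i ;; search (Suc i) r)"
  have i: "i < k" "Suc i < k" using Suc.prems(2) by simp_all
  note cost_le = search_cost_step[OF i(1), of hitters r]
  define \<sigma>1 where "\<sigma>1 = \<sigma>(Threshold := threshold i)"
  have ready1: "ready i \<sigma>1 \<mu>" "centers \<sigma>1 = centers \<sigma>" "\<sigma>1 Threshold = threshold i"
    using Suc.prems(1) by (simp_all add: ready_def \<sigma>1_def centers_def fun_eq_iff)
  have "WP (find_farthest i ;; ?children) ?Q (search_cost hitters (Suc r) - 8) \<sigma>1 \<mu>"
  proof (rule wp_Seq, rule wp_call[OF find_farthest_spec[OF ready1(1)]])
    fix t \<sigma>2 \<mu>2
    assume budget: "search_cost hitters (Suc r) - 8 - (n * (10 * i + 26) + 10) \<le> t"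
      and frame: "\<And>x. x \<notin> writes (find_farthest i) \<Longrightarrow> \<sigma>2 x = \<sigma>1 x" "\<And>A. A \<notin> stores (find_farthest i) \<Longrightarrow> \<mu>2 A = \<mu> A"
      and "farthest (\<sigma>1 Threshold) i (centers \<sigma>1) (\<sigma>2 Best) (\<sigma>2 (Far i))"
    then have far: "farthest (threshold i) i (centers \<sigma>) (\<sigma>2 Best) (\<sigma>2 (Far i))" using ready1 by simp
    have ready2: "ready i \<sigma>2 \<mu>2" "centers \<sigma>2 = centers \<sigma>" "improves \<sigma>2 = improves \<sigma>"
      using ready1 frame by (auto simp: ready_def centers_def fun_eq_iff improves_def solution_def \<sigma>1_def)
    have "\<sigma>2 (Far i) < n" using far by (simp add: farthest_def)
    have "Suc (Suc i + r) = k" using Suc.prems(2) by simp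
    note children = search_children_spec[OF ready2(1) refl \<open>\<sigma>2 (Far i) < n\<close> Suc.IH[OF _ this]]
    show "WP ?children ?Q t \<sigma>2 \<mu>2"
      using budget cost_le ready2 completable_step[OF _ i(2) far] Suc.prems(1)
      by (intro wp_call[OF children]) (auto simp: ready_def centers_def)
  qed (use cost_le in simp)
  moreover have "2 * i < 2 ^ w" "R + 2 * i * gap < 2 ^ w" "gap \<le> R + 2 * i * gap"
    using i(1) k_le gap_bound[OF i(1)] R_less gap_le word by simp_all
  ultimately show ?case
    using Suc.prems(1) cost_le by (auto intro!: wp_Seq[of _ _ "Threshold ::= _"] wp_Assign simp: \<sigma>1_def ready_def threshold_def)
qed

end

section \<open>Binary search for the radius\<close>

definition search_round :: "nat \<Rightarrow> (var, arr) cmd" where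
  "search_round k = Gap ::= Var Radius \<oslash> Lit (2 * k - 1) ;; Target ::= Lit 2 \<otimes> Var Radius \<ominus> Var Gap ;;
     Reach ::= (Var Radius \<ominus> Var Gap) \<oslash> Lit 2 ;; Found ::= Lit 0 ;; search 0 (k - 1)"

definition halve_bracket :: "nat \<Rightarrow> (var, arr) cmd" where
  "halve_bracket k = Radius ::= (Var Lower \<oplus> Var Upper) \<oslash> Lit 2 ;; search_round k ;;
     IF Var Found THEN Upper ::= Var Radius ELSE Lower ::= Var Radius \<oplus> Lit 1"

definition binary_search :: "nat \<Rightarrow> (var, arr) cmd" where
  "binary_search k = Lower ::= Lit 0 ;; Upper ::= Size ;; WHILE Var Lower \<lessdot> Var Upper DO halve_bracket k"

lemma stores_search_round [simp]: "stores (search_round k) = {Need}" "stores (halve_bracket k) = {Need}"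
  by (auto simp: search_round_def halve_bracket_def)

lemma not_writes_search_round [simp]:
  "Hitters \<notin> writes (search_round k)" "RowLen \<notin> writes (search_round k)" "Radius \<notin> writes (search_round k)"
  "Lower \<notin> writes (search_round k)" "Upper \<notin> writes (search_round k)"
  by (simp_all add: search_round_def)

lemma not_writes_halve_bracket [simp]: "Hitters \<notin> writes (halve_bracket k)" "RowLen \<notin> writes (halve_bracket k)"
  by (simp_all add: halve_bracket_def)

definition approx_radius :: "nat \<Rightarrow> nat \<Rightarrow> nat" where
  "approx_radius k R = 2 * R - R div (2 * k - 1)"

context radius_guess begin

lemma target_eq_approx_radius: "target = approx_radius k R"
  by (simp add: target_def gap_def approx_radius_def)

lemma search_round_spec:
  assumes "\<sigma> Hitters = hitters" "\<sigma> RowLen = q" "\<sigma> Radius = R" "\<And>A. A \<noteq> Need \<Longrightarrow> \<mu> A = \<mu>\<^sub>0 A"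
  shows "WP (search_round k) (\<lambda>_ \<sigma>' \<mu>'.
      \<sigma>' Found = 0 \<and> (\<forall>l<k. solution \<sigma>' l = solution \<sigma> l) \<and> \<not> k_radius n E k \<le> enat R \<or>
      \<sigma>' Found \<noteq> 0 \<and> covering (approx_radius k R) (solution \<sigma>')) (search_cost hitters (k - 1) + 18) \<sigma> \<mu>"
proof -
  let ?Q = "\<lambda>(_ :: nat) \<sigma>' (\<mu>' :: arr arrays).
    \<sigma>' Found = 0 \<and> (\<forall>l<k. solution \<sigma>' l = solution \<sigma> l) \<and> \<not> k_radius n E k \<le> enat R \<or>
    \<sigma>' Found \<noteq> 0 \<and> covering (approx_radius k R) (solution \<sigma>')"
  define \<sigma>1 where "\<sigma>1 = \<sigma>(Gap := gap, Target := target, Reach := reach, Found := 0)"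
  have ready: "ready 0 \<sigma>1 \<mu>" using assms by (simp add: ready_def \<sigma>1_def)
  have "Suc (0 + (k - 1)) = k" using k_pos by simp
  from search_spec[OF ready this]
  have search: "WP (search 0 (k - 1)) ?Q (search_cost hitters (k - 1)) \<sigma>1 \<mu>"
    by (rule wp_call) (auto simp: improves_def \<sigma>1_def solution_def target_eq_approx_radius dest: completable_0)
  have "2 * k - 1 < 2 ^ w" "2 * R < 2 ^ w" "gap \<le> 2 * R" "R < 2 ^ w" using k_le R_less gap_le word by simp_all
  then show ?thesis
    unfolding search_round_def using search assms gap_le
    by (intro wp_Seq[of _ _ "_ ::= _"] wp_Assign) (simp_all add: \<sigma>1_def gap_def target_def reach_def)
qed

end

context center_instance begin

definition round_cost :: "nat \<Rightarrow> nat" where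
  "round_cost H = search_cost H (k - 1) + 34"

definition bracketed :: "var store \<Rightarrow> bool" where
  "bracketed \<sigma> \<longleftrightarrow> (\<forall>l<k. solution \<sigma> l < n) \<and> \<sigma> Lower \<le> \<sigma> Upper \<and> \<sigma> Upper \<le> n \<and>
     (\<forall>R<\<sigma> Lower. \<not> k_radius n E k \<le> enat R) \<and>
     (\<sigma> Upper < n \<longrightarrow> covering (approx_radius k (\<sigma> Upper)) (solution \<sigma>))"

lemma bracketed_raise_Lower:
  assumes "bracketed \<sigma>" "R < \<sigma> Upper" "\<not> k_radius n E k \<le> enat R"
    and "\<forall>l<k. solution \<sigma>' l = solution \<sigma> l" "\<sigma>' Upper = \<sigma> Upper" "\<sigma>' Lower = R + 1"
  shows "bracketed \<sigma>'"
proof -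
  have "\<not> k_radius n E k \<le> enat R'" if "R' < R + 1" for R'
    using that assms(3) order_trans[of "k_radius n E k" "enat R'" "enat R"] by auto
  moreover have "covering r (solution \<sigma>') \<longleftrightarrow> covering r (solution \<sigma>)" for r
    using assms(4) by (intro covering_cong) simp
  ultimately show ?thesis using assms by (simp add: bracketed_def)
qed

end

context search_instance begin

lemma halve_bracket_spec:
  assumes regs: "\<sigma> Hitters = hitters" "\<sigma> RowLen = q" and data: "\<And>A. A \<noteq> Need \<Longrightarrow> \<mu> A = \<mu>\<^sub>0 A"
    and inv: "bracketed \<sigma>" and less: "\<sigma> Lower < \<sigma> Upper"
  shows "WP (halve_bracket k)
    (\<lambda>_ \<sigma>' \<mu>'. bracketed \<sigma>' \<and> \<sigma>' Upper - \<sigma>' Lower \<le> (\<sigma> Upper - \<sigma> Lower) div 2)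
    (search_cost hitters (k - 1) + 30) \<sigma> \<mu>"
proof -
  let ?Q = "\<lambda>(_ :: nat) \<sigma>' (\<mu>' :: arr arrays). bracketed \<sigma>' \<and> \<sigma>' Upper - \<sigma>' Lower \<le> (\<sigma> Upper - \<sigma> Lower) div 2"
  let ?update = "IF Var Found THEN Upper ::= Var Radius ELSE Lower ::= Var Radius \<oplus> Lit 1"
  define R where "R = (\<sigma> Lower + \<sigma> Upper) div 2"
  have R: "\<sigma> Lower \<le> R" "R < \<sigma> Upper" "R - \<sigma> Lower \<le> (\<sigma> Upper - \<sigma> Lower) div 2"
    "\<sigma> Upper - (R + 1) \<le> (\<sigma> Upper - \<sigma> Lower) div 2"
    using less by (auto simp: R_def)
  then have "R < n" using inv by (simp add: bracketed_def)
  then interpret radius_guess n E k es w \<mu>\<^sub>0 hitters R by unfold_locales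
  define \<sigma>1 where "\<sigma>1 = \<sigma>(Radius := R)"
  have regs1: "\<sigma>1 Hitters = hitters" "\<sigma>1 RowLen = q" "\<sigma>1 Radius = R" using regs by (simp_all add: \<sigma>1_def)
  have "WP (search_round k ;; ?update) ?Q (search_cost hitters (k - 1) + 24) \<sigma>1 \<mu>"
  proof (rule wp_Seq, rule wp_call[OF search_round_spec[of \<sigma>1 \<mu>, OF regs1 data]])
    fix t \<sigma>2 \<mu>2
    assume budget: "search_cost hitters (k - 1) + 24 - (search_cost hitters (k - 1) + 18) \<le> t"
      and frame: "\<And>x. x \<notin> writes (search_round k) \<Longrightarrow> \<sigma>2 x = \<sigma>1 x"
      and result: "\<sigma>2 Found = 0 \<and> (\<forall>l<k. solution \<sigma>2 l = solution \<sigma>1 l) \<and> \<not> k_radius n E k \<le> enat R \<or>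
        \<sigma>2 Found \<noteq> 0 \<and> covering (approx_radius k R) (solution \<sigma>2)"
    have regs2: "\<sigma>2 Radius = R" "\<sigma>2 Lower = \<sigma> Lower" "\<sigma>2 Upper = \<sigma> Upper" using frame by (simp_all add: \<sigma>1_def)
    show "WP ?update ?Q t \<sigma>2 \<mu>2"
    proof (cases "\<sigma>2 Found = 0")
      case True
      then have "\<forall>l<k. solution (\<sigma>2(Lower := R + 1)) l = solution \<sigma> l" "\<not> k_radius n E k \<le> enat R"
        using result by (auto simp: \<sigma>1_def solution_def)
      then have "bracketed (\<sigma>2(Lower := R + 1))"
        using R(2) regs2 by (intro bracketed_raise_Lower[OF inv]) simp_all
      then show ?thesis
        using True R regs2 budget \<open>R < n\<close> word by (intro wp_Branch wp_Assign) simp_all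
    next
      case False
      then have cover: "covering (approx_radius k R) (solution (\<sigma>2(Upper := R)))"
        using result by (simp add: solution_def[abs_def])
      then have "bracketed (\<sigma>2(Upper := R))"
        using inv R regs2 by (auto simp: bracketed_def covering_def)
      then show ?thesis
        using False R regs2 budget by (intro wp_Branch wp_Assign) simp_all
    qed
  qed simp_all
  moreover have "\<sigma> Lower + \<sigma> Upper < 2 ^ w" using inv word by (simp add: bracketed_def)
  ultimately show ?thesis
    unfolding halve_bracket_def by (intro wp_Seq[of _ _ "Radius ::= _"] wp_Assign) (simp_all add: \<sigma>1_def R_def add.commute)
qed

lemma binary_search_spec:
  assumes regs: "\<sigma> Hitters = hitters" "\<sigma> RowLen = q" and data: "\<And>A. A \<noteq> Need \<Longrightarrow> \<mu> A = \<mu>\<^sub>0 A"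
    and "\<forall>l<k. solution \<sigma> l < n"
  shows "WP (binary_search k) (\<lambda>_ \<sigma>' \<mu>'. bracketed \<sigma>' \<and> \<sigma>' Lower = \<sigma>' Upper)
    (floorlog 2 n * round_cost hitters + 8) \<sigma> \<mu>"
proof -
  let ?test = "Var Lower \<lessdot> Var Upper" and ?C = "round_cost hitters"
  let ?\<sigma> = "\<sigma>(Lower := 0, Upper := n)"
  have round_cost: "search_cost hitters (k - 1) = ?C - 34" "34 \<le> ?C" by (simp_all add: round_cost_def)
  let ?\<Phi> = "\<lambda>(\<sigma>' :: var store) (\<mu>' :: arr arrays). floorlog 2 (\<sigma>' Upper - \<sigma>' Lower) * ?C"
  have "WP (WHILE ?test DO (halve_bracket k)) (\<lambda>_ \<sigma>' \<mu>'. bracketed \<sigma>' \<and> \<sigma>' Lower = \<sigma>' Upper) (floorlog 2 n * ?C + 4) ?\<sigma> \<mu>"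
  proof (rule wp_Loop[where I = "\<lambda>\<sigma>' \<mu>'. bracketed \<sigma>'" and \<Phi> = ?\<Phi>])
    fix \<sigma>' \<mu>'
    assume frame: "\<And>x. x \<notin> writes (halve_bracket k) \<Longrightarrow> \<sigma>' x = ?\<sigma> x" "\<And>A. A \<notin> stores (halve_bracket k) \<Longrightarrow> \<mu>' A = \<mu> A"
      and inv: "bracketed \<sigma>'"
    then show "bracketed \<sigma>' \<and> \<sigma>' Lower = \<sigma>' Upper" if "val len ?test \<sigma>' \<mu>' = 0"
      using that by (simp add: bracketed_def)
    assume "val len ?test \<sigma>' \<mu>' \<noteq> 0"
    then have less: "\<sigma>' Lower < \<sigma>' Upper" by simp
    let ?half = "(\<sigma>' Upper - \<sigma>' Lower) div 2"
    have "floorlog 2 (\<sigma>' Upper - \<sigma>' Lower) = Suc (floorlog 2 ?half)"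
      using less by (subst compute_floorlog) simp
    then have potential: "?\<Phi> \<sigma>' \<mu>' = floorlog 2 ?half * ?C + ?C" by simp
    have descend: "floorlog 2 x * ?C \<le> floorlog 2 ?half * ?C" if "x \<le> ?half" for x
      using that by (intro mult_le_mono1 floorlog_mono)
    have regs': "\<sigma>' Hitters = hitters" "\<sigma>' RowLen = q" "\<And>A. A \<noteq> Need \<Longrightarrow> \<mu>' A = \<mu>\<^sub>0 A"
      using frame regs data by simp_all
    note body = halve_bracket_spec[of \<sigma>' \<mu>', OF regs' inv less]
    show "cost ?test < ?\<Phi> \<sigma>' \<mu>' \<and> WP (halve_bracket k) (\<lambda>t \<sigma>'' \<mu>''. bracketed \<sigma>'' \<and> ?\<Phi> \<sigma>'' \<mu>'' \<le> t) (?\<Phi> \<sigma>' \<mu>' - (cost ?test + 1)) \<sigma>' \<mu>'"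
      unfolding potential
    proof (intro conjI wp_call[OF body])
      fix t \<sigma>'' and \<mu>'' :: "arr arrays"
      assume "floorlog 2 ?half * ?C + ?C - (cost ?test + 1) - (search_cost hitters (k - 1) + 30) \<le> t"
        and "bracketed \<sigma>'' \<and> \<sigma>'' Upper - \<sigma>'' Lower \<le> ?half"
      moreover from this have "floorlog 2 ?half * ?C \<le> t" using round_cost by simp
      ultimately show "bracketed \<sigma>''" "?\<Phi> \<sigma>'' \<mu>'' \<le> t" using order_trans[OF descend] by blast+
    qed (use round_cost in simp_all)
  qed (use assms in \<open>auto simp: bracketed_def solution_def\<close>)
  then show ?thesis
    unfolding binary_search_def by (intro wp_Seq[of _ _ "_ ::= _"] wp_Assign) (simp_all add: add.commute)
qed

end

section \<open>Making the centers distinct\<close>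

fun duplicates :: "nat \<Rightarrow> (var, arr) expr \<Rightarrow> (var, arr) expr" where
  "duplicates 0 e = Lit 0"
| "duplicates (Suc j) e = duplicates j e \<oplus> (e \<doteq> Var (Sol j))"

definition make_fresh :: "nat \<Rightarrow> (var, arr) cmd" where
  "make_fresh i = Fresh ::= Lit 0 ;; WHILE duplicates i (Var (Sol i)) DO
     (Sol i ::= Var Fresh ;; Fresh ::= Var Fresh \<oplus> Lit 1)"

fun make_distinct :: "nat \<Rightarrow> (var, arr) cmd" where
  "make_distinct 0 = Skip"
| "make_distinct (Suc i) = make_distinct i ;; make_fresh i"

lemma cost_duplicates [simp]: "cost (duplicates i (Var x)) = 4 * i + 1"
  by (induction i) simp_all

lemma make_distinct_frames [simp]:
  "writes (make_fresh i) = {Fresh, Sol i}" "stores (make_fresh i) = {}" "stores (make_distinct i) = {}"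
proof -
  show fresh: "writes (make_fresh i) = {Fresh, Sol i}" "stores (make_fresh i) = {}" for i
    by (auto simp: make_fresh_def)
  show "stores (make_distinct i) = {}" by (induction i) (simp_all add: fresh)
qed

lemma writes_make_distinct: "writes (make_distinct i) \<subseteq> insert Fresh (Sol ` {..<i})"
  by (induction i) auto

context center_instance begin

lemma duplicates_eval:
  assumes "safe w len e \<sigma> \<mu>" "i \<le> n"
  shows "safe w len (duplicates i e) \<sigma> \<mu> \<and> val len (duplicates i e) \<sigma> \<mu> \<le> i \<and>
    (val len (duplicates i e) \<sigma> \<mu> = 0 \<longleftrightarrow> val len e \<sigma> \<mu> \<notin> solution \<sigma> ` {..<i})"
  using assms(2)
proof (induction i)
  case (Suc i)
  have "Suc i < 2 ^ w" using Suc.prems word by simp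
  then show ?case using Suc assms(1) by (auto simp: lessThan_Suc solution_def)
qed simp

lemma make_fresh_spec:
  assumes i: "i < k" and "solution \<sigma> i < n"
  shows "WP (make_fresh i) (\<lambda>_ \<sigma>' \<mu>'. solution \<sigma>' i < n \<and> solution \<sigma>' i \<notin> solution \<sigma> ` {..<i} \<and>
      solution \<sigma> i \<in> insert (solution \<sigma>' i) (solution \<sigma> ` {..<i})) (4 * k * (k + 2)) \<sigma> \<mu>"
proof -
  let ?Z = "solution \<sigma> ` {..<i}" and ?c = "4 * i + 8"
  let ?test = "duplicates i (Var (Sol i))" and ?body = "Sol i ::= Var Fresh ;; Fresh ::= Var Fresh \<oplus> Lit 1"
  let ?I = "\<lambda>\<sigma>' (\<mu>' :: arr arrays). \<sigma>' Fresh \<le> Suc i \<and> solution \<sigma>' i < n \<and>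
    (\<forall>s<\<sigma>' Fresh. s \<noteq> solution \<sigma>' i \<longrightarrow> s \<in> ?Z) \<and> solution \<sigma> i \<in> insert (solution \<sigma>' i) ?Z"
  let ?\<Phi> = "\<lambda>\<sigma>' (\<mu>' :: arr arrays). (Suc i - \<sigma>' Fresh) * ?c"
  have "WP (WHILE ?test DO ?body) (\<lambda>_ \<sigma>' \<mu>'. solution \<sigma>' i < n \<and> solution \<sigma>' i \<notin> ?Z \<and>
      solution \<sigma> i \<in> insert (solution \<sigma>' i) ?Z) (4 * k * (k + 2) - 2) (\<sigma>(Fresh := 0)) \<mu>"
  proof (rule wp_Loop[where I = ?I and \<Phi> = ?\<Phi>])
    have "(i + 1) * ?c \<le> k * (4 * k + 4)" using i by (intro mult_le_mono) linarith+
    then show "?\<Phi> (\<sigma>(Fresh := 0)) \<mu> + cost ?test < 4 * k * (k + 2) - 2" using i by (simp add: algebra_simps)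
    fix \<sigma>' \<mu>'
    assume frame: "\<And>x. x \<notin> writes ?body \<Longrightarrow> \<sigma>' x = (\<sigma>(Fresh := 0)) x" and inv: "?I \<sigma>' \<mu>'"
    have "solution \<sigma>' ` {..<i} = ?Z" using frame by (intro image_cong) (auto simp: solution_def)
    then have test: "safe w len ?test \<sigma>' \<mu>'" "val len ?test \<sigma>' \<mu>' = 0 \<longleftrightarrow> solution \<sigma>' i \<notin> ?Z"
      using duplicates_eval[of "Var (Sol i)" \<sigma>' \<mu>' i] i k_le by (simp_all add: solution_def)
    then show "safe w len ?test \<sigma>' \<mu>'" by simp
    show "solution \<sigma>' i < n \<and> solution \<sigma>' i \<notin> ?Z \<and> solution \<sigma> i \<in> insert (solution \<sigma>' i) ?Z"
      if "val len ?test \<sigma>' \<mu>' = 0" using that test(2) inv by blast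
    assume "val len ?test \<sigma>' \<mu>' \<noteq> 0"
    then have old: "solution \<sigma>' i \<in> ?Z" using test(2) by simp
    then have used: "{..<\<sigma>' Fresh} \<subseteq> ?Z" using inv by blast
    then have "\<sigma>' Fresh \<le> card ?Z" using card_mono[OF _ used] by simp
    also have "\<dots> \<le> i" using card_image_le[of "{..<i}" "solution \<sigma>"] by simp
    finally have fresh_le: "\<sigma>' Fresh \<le> i" .
    then have potential: "?\<Phi> \<sigma>' \<mu>' = (i - \<sigma>' Fresh) * ?c + ?c" by (simp add: Suc_diff_le)
    have "\<sigma>' Fresh < n" "\<sigma>' Fresh + 1 < 2 ^ w" using fresh_le i k_le word by simp_all
    then show "cost ?test < ?\<Phi> \<sigma>' \<mu>' \<and> WP ?body (\<lambda>t \<sigma>'' \<mu>''. ?I \<sigma>'' \<mu>'' \<and> ?\<Phi> \<sigma>'' \<mu>'' \<le> t) (?\<Phi> \<sigma>' \<mu>' - (cost ?test + 1)) \<sigma>' \<mu>'"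
      unfolding potential using fresh_le old used inv
      by (intro conjI wp_Seq wp_Assign) (auto simp: solution_def simp flip: Suc_eq_plus1)
  qed (use assms(2) in \<open>simp_all add: solution_def\<close>)
  then show ?thesis
    unfolding make_fresh_def by (intro wp_Seq[of _ _ "Fresh ::= _"] wp_Assign) (use i in simp_all)
qed

lemma make_distinct_spec:
  assumes "i \<le> k" and less: "\<forall>l<k. solution \<sigma> l < n"
  shows "WP (make_distinct i) (\<lambda>_ \<sigma>' \<mu>'. inj_on (solution \<sigma>') {..<i} \<and> (\<forall>l<i. solution \<sigma>' l < n) \<and>
      solution \<sigma> ` {..<i} \<subseteq> solution \<sigma>' ` {..<i}) (i * (4 * k * (k + 2))) \<sigma> \<mu>"
  using assms(1)
proof (induction i)
  case (Suc i)
  let ?Q = "\<lambda>(_ :: nat) \<sigma>' (\<mu>' :: arr arrays). inj_on (solution \<sigma>') {..<Suc i} \<and> (\<forall>l<Suc i. solution \<sigma>' l < n) \<and>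
    solution \<sigma> ` {..<Suc i} \<subseteq> solution \<sigma>' ` {..<Suc i}"
  have "i < k" "i \<le> k" using Suc.prems by simp_all
  show ?case
    unfolding make_distinct.simps
  proof (rule wp_Seq, rule wp_call[OF Suc.IH[OF \<open>i \<le> k\<close>]])
    fix t \<sigma>1 \<mu>1
    assume budget: "Suc i * (4 * k * (k + 2)) - i * (4 * k * (k + 2)) \<le> t"
      and frame: "\<And>x. x \<notin> writes (make_distinct i) \<Longrightarrow> \<sigma>1 x = \<sigma> x"
      and distinct: "inj_on (solution \<sigma>1) {..<i} \<and> (\<forall>l<i. solution \<sigma>1 l < n) \<and> solution \<sigma> ` {..<i} \<subseteq> solution \<sigma>1 ` {..<i}"
    have "Sol i \<notin> writes (make_distinct i)" using writes_make_distinct[of i] by auto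
    then have "solution \<sigma>1 i = solution \<sigma> i" using frame by (simp add: solution_def)
    moreover from this have "solution \<sigma>1 i < n" using less \<open>i < k\<close> by simp
    ultimately show "WP (make_fresh i) ?Q t \<sigma>1 \<mu>1"
    proof (intro wp_call[OF make_fresh_spec[OF \<open>i < k\<close>]])
      fix t \<sigma>2 and \<mu>2 :: "arr arrays"
      assume "solution \<sigma>1 i = solution \<sigma> i" and frame2: "\<And>x. x \<notin> writes (make_fresh i) \<Longrightarrow> \<sigma>2 x = \<sigma>1 x"
        and fresh: "solution \<sigma>2 i < n \<and> solution \<sigma>2 i \<notin> solution \<sigma>1 ` {..<i} \<and>
          solution \<sigma>1 i \<in> insert (solution \<sigma>2 i) (solution \<sigma>1 ` {..<i})"
      have same: "solution \<sigma>2 l = solution \<sigma>1 l" if "l < i" for l using frame2 that by (simp add: solution_def)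
      then have "solution \<sigma>2 ` {..<i} = solution \<sigma>1 ` {..<i}" "inj_on (solution \<sigma>2) {..<i} = inj_on (solution \<sigma>1) {..<i}"
        by (auto intro!: image_cong inj_on_cong)
      then show "?Q t \<sigma>2 \<mu>2"
        using distinct fresh same \<open>solution \<sigma>1 i = solution \<sigma> i\<close> by (auto simp: lessThan_Suc less_Suc_eq)
    qed (use budget in simp_all)
  qed simp
qed (simp add: wp_Skip)

end

section \<open>Value and centers of the output\<close>

definition write_value :: "nat \<Rightarrow> (var, arr) cmd" where
  "write_value k = IF Var Upper \<lessdot> Size
     THEN Out ::= Lit 2 \<otimes> Var Upper \<ominus> Var Upper \<oslash> Lit (2 * k - 1) \<oplus> Lit 1 ELSE Out ::= Lit 0"

lemma approx_radius_le:
  assumes "1 \<le> k" "R \<le> r"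
  shows "real (approx_radius k R) \<le> (2 - 1 / (2 * real k - 1)) * real r + (1 - 1 / (2 * real k - 1))"
proof -
  define p where "p = 2 * k - 1"
  have p: "1 \<le> p" "real p = 2 * real k - 1" using assms(1) by (auto simp: p_def)
  have "R + 1 \<le> p * (R div p) + p" using p mult_div_mod_eq[of p R] mod_less_divisor[of p R] by linarith
  then have "real (R + 1) \<le> real (p * (R div p) + p)" by (simp only: of_nat_le_iff)
  then have quotient: "(real R + 1) / real p \<le> real (R div p) + 1" using p(1) by (simp add: field_simps)
  have "R div p \<le> 2 * R" using div_le_dividend[of R p] by linarith
  then have "real (approx_radius k R) = 2 * real R - real (R div p)"
    by (simp add: approx_radius_def p_def)
  also have "\<dots> \<le> (2 - 1 / real p) * real R + (1 - 1 / real p)" using quotient by (simp add: algebra_simps add_divide_distrib)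
  also have "\<dots> \<le> (2 - 1 / real p) * real r + (1 - 1 / real p)"
    using p assms(2) by (intro add_right_mono mult_left_mono) (auto simp: field_simps)
  finally show ?thesis by (simp add: p(2))
qed

definition radius_code :: "nat \<Rightarrow> nat \<Rightarrow> nat \<Rightarrow> nat" where
  "radius_code k n hi = (if hi < n then Suc (approx_radius k hi) else 0)"

context center_instance begin

lemma write_value_spec:
  assumes "\<sigma> Upper \<le> n"
  shows "WP (write_value k) (\<lambda>_ \<sigma>' \<mu>'. \<sigma>' Out = radius_code k n (\<sigma> Upper)) 14 \<sigma> \<mu>"
proof -
  have "\<sigma> Upper div (2 * k - 1) \<le> 2 * \<sigma> Upper" using div_le_dividend[of "\<sigma> Upper" "2 * k - 1"] by linarith
  moreover have "2 * k - 1 < 2 ^ w" "2 * \<sigma> Upper + 1 < 2 ^ w" using assms k_le word by simp_all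
  ultimately show ?thesis
    unfolding write_value_def
    by (intro wp_Branch wp_Assign) (auto simp: radius_code_def approx_radius_def)
qed

lemma approx_from_bracket:
  assumes C: "C \<subseteq> {..<n}" "card C = k" and "hi \<le> n"
    and lower: "\<forall>R<hi. \<not> k_radius n E k \<le> enat R"
    and cover: "hi < n \<Longrightarrow> \<forall>z<n. \<exists>c\<in>C. d c z \<le> approx_radius k hi"
  shows "k_center_approx (2 - 1 / (2 * real k - 1)) (1 - 1 / (2 * real k - 1)) n E k
    (case radius_code k n hi of 0 \<Rightarrow> \<infinity> | Suc r \<Rightarrow> enat r) C"
proof (cases "hi < n")
  case True
  let ?r = "approx_radius k hi"
  have r_less: "?r < 2 * n" using True by (simp add: approx_radius_def)
  then have cover': "\<forall>v<n. \<exists>c\<in>C. d v c \<le> ?r" using cover[OF True] by (metis d_commute)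
  then have radius: "k_radius n E k \<le> enat ?r" using k_radius_le_iff[OF r_less] C by blast
  then obtain r where r: "k_radius n E k = enat r" by (cases "k_radius n E k") auto
  then have "hi \<le> r" using lower by (auto simp: not_le[symmetric])
  from approx_radius_le[OF k_pos this] have "ereal_of_enat (enat ?r) \<le>
      ereal (2 - 1 / (2 * real k - 1)) * ereal_of_enat (k_radius n E k) + ereal (1 - 1 / (2 * real k - 1))"
    by (simp add: r)
  moreover have "\<forall>v<n. set_gdist E v C \<le> enat ?r"
    using cover' set_gdist_le_iff[OF r_less] finite_subset[OF C(1)] by blast
  ultimately show ?thesis using True C radius by (simp add: k_center_approx_def radius_code_def)
next
  case False
  then have "\<not> k_radius n E k \<le> enat (n - 1)" using lower assms(3) n_pos by simp
  then have "k_radius n E k = \<infinity>" using k_radius_less_or_inf[of k] by blast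
  moreover have "0 < 2 - 1 / (2 * real k - 1)" using k_pos by (simp add: field_simps)
  ultimately show ?thesis using False C by (simp add: k_center_approx_def radius_code_def)
qed

end

section \<open>The whole program\<close>

definition preprocess :: "nat \<Rightarrow> (var, arr) cmd" where
  "preprocess k = find_row_length k ;; build_adjacency ;; all_pairs ;; select_hitters ;; find_nearest"

definition solve :: "nat \<Rightarrow> (var, arr) cmd" where
  "solve k = binary_search k ;; make_distinct k ;; write_value k"

lemma find_row_length_frames [simp]:
  "writes (find_row_length k) = {RowLen}" "stores (find_row_length k) = {}"
  by (auto simp: find_row_length_def)

lemma Sol_notin_writes_preprocess: "Sol l \<notin> writes (preprocess k)"
  by (simp add: preprocess_def)

context center_instance begin

definition output_correct :: "nat \<Rightarrow> nat set \<Rightarrow> bool" where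
  "output_correct a C \<longleftrightarrow> k_center_approx (2 - 1 / (2 * real k - 1)) (1 - 1 / (2 * real k - 1)) n E k
     (case a of 0 \<Rightarrow> \<infinity> | Suc r \<Rightarrow> enat r) C"

definition select_cost :: nat where
  "select_cost = (max_hitters n q + 1) * greedy_cost + (n * (max_hitters n q * 38 + 24) + 6)"

definition preprocess_cost :: nat where
  "preprocess_cost = (n * 10 + 8) + (2 * m * 24 + 6) + (n * (92 * m + 60 * n + 44) + 6) + select_cost"

definition solve_cost :: "nat \<Rightarrow> nat" where
  "solve_cost H = (floorlog 2 n * round_cost H + 8) + k * (4 * k * (k + 2)) + 14"

lemma search_instanceI:
  assumes "h \<le> n" "\<forall>j<h. \<mu> Hit j < n" and saved: "\<forall>s<n. row_saved s \<mu>'" and same: "\<mu> Dist = \<mu>' Dist" "\<mu> Near = \<mu>' Near"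
    and hit: "\<forall>v\<in>unhit \<mu>'. \<exists>j<h. \<mu> Hit j \<in> near_row \<mu>' v ` {..<q}"
    and nearest: "\<forall>z<n. nearest_hitter (\<mu> Hit) z h (\<mu> HitDist z) (\<mu> HitIndex z)"
  shows "search_instance n E k es w \<mu> h"
proof
  have rows: "near_row \<mu> = near_row \<mu>'" by (simp add: near_row_def fun_eq_iff same)
  show "\<mu> Dist (cell u v) = d u v" if "u < n" "v < n" for u v
    using saved that by (simp add: row_saved_def same)
  show "near_row \<mu> v i < n" if "v < n" "i < q" for v i
    using near_row_less saved that by (simp add: rows)
  show "\<exists>full. nearest_row q v (near_row \<mu> v) full \<and> (full \<longrightarrow> (\<exists>j<h. \<mu> Hit j \<in> near_row \<mu> v ` {..<q}))"
    if "v < n" for v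
    using saved hit that unfolding rows
    by (intro exI[of _ "\<mu>' Full v \<noteq> 0"]) (simp add: row_saved_def near_row_def[abs_def] unhit_def)
qed (use assms in auto)

lemma select_spec:
  assumes saved: "\<forall>s<n. row_saved s \<mu>" and rowlen: "\<sigma> RowLen = q"
  shows "WP (select_hitters ;; find_nearest) (\<lambda>_ \<sigma>' \<mu>'. \<sigma>' RowLen = q \<and> \<sigma>' Hitters \<le> max_hitters n q \<and>
      search_instance n E k es w \<mu>' (\<sigma>' Hitters)) select_cost \<sigma> \<mu>"
proof (rule wp_Seq, rule wp_call[OF select_hitters_spec[of \<mu> \<sigma>, OF assms]])
  fix t \<sigma>1 \<mu>1
  assume budget: "select_cost - (max_hitters n q + 1) * greedy_cost \<le> t"
    and frame1: "\<And>x. x \<notin> writes select_hitters \<Longrightarrow> \<sigma>1 x = \<sigma> x" "\<And>A. A \<notin> stores select_hitters \<Longrightarrow> \<mu>1 A = \<mu> A"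
    and "all_hit \<mu> \<sigma>1 \<mu>1"
  then have hit: "\<sigma>1 Hitters \<le> n" "\<sigma>1 Hitters \<le> max_hitters n q" "\<forall>j<\<sigma>1 Hitters. \<mu>1 Hit j < n"
    "\<forall>v\<in>unhit \<mu>. \<exists>j<\<sigma>1 Hitters. \<mu>1 Hit j \<in> near_row \<mu> v ` {..<q}"
    by (simp_all add: all_hit_def)
  have dist: "\<forall>s<n. \<forall>u<n. \<mu>1 Dist (cell s u) = d s u" using saved frame1(2) by (simp add: row_saved_def)
  show "WP find_nearest (\<lambda>_ \<sigma>' \<mu>'. \<sigma>' RowLen = q \<and> \<sigma>' Hitters \<le> max_hitters n q \<and>
      search_instance n E k es w \<mu>' (\<sigma>' Hitters)) t \<sigma>1 \<mu>1"
  proof (rule wp_call[OF find_nearest_spec[of \<mu>1 \<sigma>1]])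
    have "n * (\<sigma>1 Hitters * 38 + 24) \<le> n * (max_hitters n q * 38 + 24)" using hit by (intro mult_le_mono2) simp
    then show "n * (\<sigma>1 Hitters * 38 + 24) + 6 \<le> t"
      by (rule order_trans[OF add_right_mono]) (use budget in \<open>simp add: select_cost_def\<close>)
    fix t' \<sigma>2 \<mu>2
    assume frame2: "\<And>x. x \<notin> writes find_nearest \<Longrightarrow> \<sigma>2 x = \<sigma>1 x" "\<And>A. A \<notin> stores find_nearest \<Longrightarrow> \<mu>2 A = \<mu>1 A"
      and "\<forall>z<n. nearest_hitter (\<mu>1 Hit) z (\<sigma>1 Hitters) (\<mu>2 HitDist z) (\<mu>2 HitIndex z)"
    then have "search_instance n E k es w \<mu>2 (\<sigma>2 Hitters)"
      using hit saved frame1(2) by (intro search_instanceI[of _ _ \<mu>]) simp_all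
    then show "\<sigma>2 RowLen = q \<and> \<sigma>2 Hitters \<le> max_hitters n q \<and> search_instance n E k es w \<mu>2 (\<sigma>2 Hitters)"
      using frame1(1) frame2(1) hit rowlen by simp
  qed (use dist hit in simp_all)
qed (simp add: select_cost_def)

lemma preprocess_spec:
  assumes "\<And>e. e < 2 * m \<Longrightarrow> \<mu> Half e = endpoint e" "\<And>v. v < n \<Longrightarrow> \<mu> Head v = 0" "\<forall>i<n. \<mu> Queue i < n"
  shows "WP (preprocess k) (\<lambda>_ \<sigma>' \<mu>'. \<sigma>' RowLen = q \<and> \<sigma>' Hitters \<le> max_hitters n q \<and>
      search_instance n E k es w \<mu>' (\<sigma>' Hitters)) preprocess_cost \<sigma> \<mu>"
proof -
  let ?Q = "\<lambda>(_ :: nat) \<sigma>' \<mu>'. \<sigma>' RowLen = q \<and> \<sigma>' Hitters \<le> max_hitters n q \<and> search_instance n E k es w \<mu>' (\<sigma>' Hitters)"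
  have from_adjacency: "WP (all_pairs ;; (select_hitters ;; find_nearest)) ?Q t \<sigma>1 \<mu>1"
    if "adjacency \<mu>1" "\<forall>i<n. \<mu>1 Queue i < n" "\<sigma>1 RowLen = q" and budget: "n * (92 * m + 60 * n + 44) + 6 + select_cost \<le> t"
    for t \<sigma>1 \<mu>1
  proof (rule wp_Seq, rule wp_call[OF all_pairs_spec[of \<sigma>1 \<mu>1, OF that(3,1,2)]])
    fix t' \<sigma>2 \<mu>2
    assume budget': "t - (n * (92 * m + 60 * n + 44) + 6) \<le> t'" and frame: "\<And>x. x \<notin> writes all_pairs \<Longrightarrow> \<sigma>2 x = \<sigma>1 x"
      and saved: "\<forall>s<n. row_saved s \<mu>2"
    have "\<sigma>2 RowLen = q" using frame that(3) by simp
    from select_spec[of \<mu>2 \<sigma>2, OF saved this] show "WP (select_hitters ;; find_nearest) ?Q t' \<sigma>2 \<mu>2"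
      by (rule wp_call) (use budget budget' in simp_all)
  qed (use budget in simp)
  show ?thesis
    unfolding preprocess_def
  proof (rule wp_Seq, rule wp_call[OF find_row_length_spec])
    fix t \<sigma>1 \<mu>1
    assume budget: "preprocess_cost - (n * 10 + 8) \<le> t" and "\<And>A. A \<notin> stores (find_row_length k) \<Longrightarrow> \<mu>1 A = \<mu> A"
      and rowlen: "\<sigma>1 RowLen = q"
    then have "\<mu>1 = \<mu>" by auto
    show "WP (build_adjacency ;; (all_pairs ;; (select_hitters ;; find_nearest))) ?Q t \<sigma>1 \<mu>1"
      unfolding \<open>\<mu>1 = \<mu>\<close>
    proof (rule wp_Seq, rule wp_call[OF build_adjacency_spec[of \<mu>]])
      fix t' \<sigma>2 \<mu>2
      assume "t - (2 * m * 24 + 6) \<le> t'" "\<And>x. x \<notin> writes build_adjacency \<Longrightarrow> \<sigma>2 x = \<sigma>1 x"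
        "\<And>A. A \<notin> stores build_adjacency \<Longrightarrow> \<mu>2 A = \<mu> A" "adjacency \<mu>2"
      then show "WP (all_pairs ;; (select_hitters ;; find_nearest)) ?Q t' \<sigma>2 \<mu>2"
        using budget rowlen assms(3) by (intro from_adjacency) (simp_all add: preprocess_cost_def)
    qed (use assms budget in \<open>simp_all add: preprocess_cost_def\<close>)
  qed (simp add: preprocess_cost_def)
qed

end

context search_instance begin

lemma solve_spec:
  assumes "\<sigma> Hitters = hitters" "\<sigma> RowLen = q" "\<forall>l<k. solution \<sigma> l < n"
  shows "WP (solve k) (\<lambda>_ \<sigma>' \<mu>'. output_correct (\<sigma>' Out) (solution \<sigma>' ` {..<k})) (solve_cost hitters) \<sigma> \<mu>\<^sub>0"
proof -
  let ?Q = "\<lambda>(_ :: nat) \<sigma>' (\<mu>' :: arr arrays). output_correct (\<sigma>' Out) (solution \<sigma>' ` {..<k})"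
  show ?thesis
    unfolding solve_def
  proof (rule wp_Seq, rule wp_call[OF binary_search_spec[of \<sigma> \<mu>\<^sub>0, OF assms(1,2) refl assms(3)]])
    fix t \<sigma>1 \<mu>1
    assume budget: "solve_cost hitters - (floorlog 2 n * round_cost hitters + 8) \<le> t"
      and found: "bracketed \<sigma>1 \<and> \<sigma>1 Lower = \<sigma>1 Upper"
    then have less: "\<forall>l<k. solution \<sigma>1 l < n" by (simp add: bracketed_def)
    show "WP (make_distinct k ;; write_value k) ?Q t \<sigma>1 \<mu>1"
    proof (rule wp_Seq, rule wp_call[OF make_distinct_spec[OF order_refl less]])
      fix t' \<sigma>2 and \<mu>2 :: "arr arrays"
      assume budget': "t - k * (4 * k * (k + 2)) \<le> t'" and frame: "\<And>x. x \<notin> writes (make_distinct k) \<Longrightarrow> \<sigma>2 x = \<sigma>1 x"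
        and distinct: "inj_on (solution \<sigma>2) {..<k} \<and> (\<forall>l<k. solution \<sigma>2 l < n) \<and>
          solution \<sigma>1 ` {..<k} \<subseteq> solution \<sigma>2 ` {..<k}"
      let ?C = "solution \<sigma>2 ` {..<k}"
      have "Upper \<notin> writes (make_distinct k)" using writes_make_distinct[of k] by auto
      then have upper: "\<sigma>2 Upper = \<sigma>1 Upper" using frame by blast
      have "?C \<subseteq> {..<n}" "card ?C = k" using distinct by (auto simp: card_image)
      moreover have "\<forall>z<n. \<exists>c\<in>?C. d c z \<le> approx_radius k (\<sigma>1 Upper)" if "\<sigma>1 Upper < n"
      proof -
        have "\<forall>z<n. \<exists>l<k. d (solution \<sigma>1 l) z \<le> approx_radius k (\<sigma>1 Upper)"
          using found that by (simp add: bracketed_def covering_def)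
        moreover have "\<forall>l<k. solution \<sigma>1 l \<in> ?C" using distinct by auto
        ultimately show ?thesis by meson
      qed
      ultimately have correct: "output_correct (radius_code k n (\<sigma>2 Upper)) ?C"
        using found unfolding output_correct_def upper by (intro approx_from_bracket) (auto simp: bracketed_def)
      have "\<sigma>2 Upper \<le> n" using found upper by (simp add: bracketed_def)
      then show "WP (write_value k) ?Q t' \<sigma>2 \<mu>2"
      proof (rule wp_call[OF write_value_spec])
        fix t'' \<sigma>3 and \<mu>3 :: "arr arrays"
        assume "\<And>x. x \<notin> writes (write_value k) \<Longrightarrow> \<sigma>3 x = \<sigma>2 x" and out: "\<sigma>3 Out = radius_code k n (\<sigma>2 Upper)"
        then have "solution \<sigma>3 = solution \<sigma>2" by (simp add: solution_def fun_eq_iff write_value_def)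
        then show "?Q t'' \<sigma>3 \<mu>3" using correct out by simp
      qed (use budget budget' in \<open>simp add: solve_cost_def\<close>)
    qed (use budget in \<open>simp add: solve_cost_def\<close>)
  qed (simp_all add: solve_cost_def)
qed

end

section \<open>Input and output\<close>

definition length_source :: "arr \<Rightarrow> nat" where
  "length_source A = (if A = Half \<or> A = Prev then tmp_reg 1 else if A = Dist \<or> A = Near then tmp_reg 2 else 0)"

lemma length_source_neq:
  "length_source A \<noteq> len_reg (B :: arr)" "length_source A \<noteq> base_reg (B :: arr)" "length_source A \<noteq> tmp_reg 0"
  unfolding length_source_def reg_defs by (auto; presburger)+

definition prologue :: "instr list" where
  "prologue = Bin OpAdd (tmp_reg 1) 1 1 # Bin OpMul (tmp_reg 2) 0 0 # allocate length_source all_arrays"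

fun store_centers :: "nat \<Rightarrow> instr list" where
  "store_centers 0 = []"
| "store_centers (Suc l) = store_centers l @ [Const (tmp_reg 0) l, Store (tmp_reg 0) (var_reg (Sol l))]"

definition k_center_program :: "nat \<Rightarrow> instr list" where
  "k_center_program k = prologue @ compile (preprocess k ;; solve k) @ store_centers k @ [Move 0 (var_reg Out)]"

lemma reaches_store_centers:
  assumes "i < 2 ^ w"
  shows "\<exists>s'. reaches w (2 * i) (store_centers i @ K, s) (K, s') \<and> (\<forall>l<i. mem s' l = reg s (var_reg (Sol l))) \<and>
    (\<forall>x :: var. reg s' (var_reg x) = reg s (var_reg x))"
  using assms
proof (induction i arbitrary: K)
  case (Suc i)
  let ?r = "tmp_reg 0" and ?K = "Const (tmp_reg 0) i # Store (tmp_reg 0) (var_reg (Sol i)) # K"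
  have "i < 2 ^ w" using Suc.prems by simp
  from Suc.IH[OF this, of ?K] obtain s1 where s1: "reaches w (2 * i) (store_centers i @ ?K, s) (?K, s1)"
      "\<forall>l<i. mem s1 l = reg s (var_reg (Sol l))" "\<forall>x :: var. reg s1 (var_reg x) = reg s (var_reg x)"
    by blast
  define s2 where "s2 = set_reg ?r i s1"
  define s3 where "s3 = set_mem i (reg s (var_reg (Sol i))) s2"
  have "reaches w 1 (?K, s1) (Store ?r (var_reg (Sol i)) # K, s2)"
    using Suc.prems by (intro reaches_step) (simp add: s2_def)
  moreover have "reaches w 1 (Store ?r (var_reg (Sol i)) # K, s2) (K, s3)"
    using s1(3) by (intro reaches_step) (simp add: s2_def s3_def)
  ultimately have "reaches w (2 * i + (1 + 1)) (store_centers i @ ?K, s) (K, s3)"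
    using s1(1) by (blast intro: reaches_trans)
  then show ?case using s1(2,3) by (intro exI[of _ s3]) (auto simp: s2_def s3_def less_Suc_eq)
qed (auto intro: reaches_refl)

context center_instance begin

definition input_arrays :: "arr arrays" where
  "input_arrays A i = mem (input_state n es) (offset len all_arrays A + i)"

lemma input_arrays_simps:
  "e < 2 * m \<Longrightarrow> input_arrays Half e = endpoint e" "input_arrays Head v = 0" "input_arrays Queue v = 0"
  by (auto simp: input_arrays_def all_arrays_def input_state_def endpoint_def)

lemma reaches_prologue:
  "\<exists>s. reaches w 41 (prologue @ K, input_state n es) (K, s) \<and> represents s (\<lambda>_ :: var. 0) input_arrays"
proof -
  let ?s = "input_state n es" and ?K = "allocate length_source all_arrays @ K"
  define s1 where "s1 = set_reg (tmp_reg 1) (2 * m) ?s"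
  define s2 where "s2 = set_reg (tmp_reg 2) (n * n) s1"
  have input: "reg ?s 0 = n" "reg ?s 1 = m" "\<And>x. x \<noteq> 0 \<Longrightarrow> x \<noteq> 1 \<Longrightarrow> reg ?s x = 0"
    by (simp_all add: input_state_def)
  have "reaches w 1 (prologue @ K, ?s) (Bin OpMul (tmp_reg 2) 0 0 # ?K, s1)"
    using input by (intro reaches_step) (simp add: prologue_def s1_def flip: mult_2)
  moreover have "reaches w 1 (Bin OpMul (tmp_reg 2) 0 0 # ?K, s1) (?K, s2)"
    using input by (intro reaches_step) (simp add: s1_def s2_def tmp_reg_def)
  ultimately have start: "reaches w (1 + 1) (prologue @ K, ?s) (?K, s2)" by (rule reaches_trans)
  have "\<exists>s. reaches w (3 * length all_arrays) (?K, s2) (K, s) \<and> mem s = mem s2 \<and>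
    (\<forall>A\<in>set all_arrays. reg s (len_reg A) = len A \<and> reg s (base_reg A) = reg s2 (tmp_reg 0) + offset len all_arrays A) \<and>
    (\<forall>x. x \<noteq> tmp_reg 0 \<longrightarrow> x \<notin> len_reg ` set all_arrays \<longrightarrow> x \<notin> base_reg ` set all_arrays \<longrightarrow> reg s x = reg s2 x)"
  proof (rule reaches_allocate)
    show "reg s2 (length_source A) = len A" for A
      using input(1) by (cases A) (simp_all add: length_source_def s1_def s2_def tmp_reg_def)
    show "reg s2 (tmp_reg 0) + sum_list (map len all_arrays) < 2 ^ w"
      using memory_size input(3) by (simp add: s1_def s2_def tmp_reg_def)
  qed (simp_all add: length_source_neq, simp add: all_arrays_def)
  then obtain s where s: "reaches w (3 * length all_arrays) (?K, s2) (K, s)" "mem s = mem s2"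
      "\<And>A. reg s (len_reg A) = len A \<and> reg s (base_reg A) = reg s2 (tmp_reg 0) + offset len all_arrays A"
      "\<And>x. x \<noteq> tmp_reg 0 \<Longrightarrow> x \<notin> len_reg ` set all_arrays \<Longrightarrow> x \<notin> base_reg ` set all_arrays \<Longrightarrow> reg s x = reg s2 x"
    using set_all_arrays by blast
  have "reg s2 (tmp_reg 0) = 0" "mem s2 = mem ?s" using input(3) by (simp_all add: s1_def s2_def tmp_reg_def)
  moreover have "var_reg x \<noteq> 0" "var_reg x \<noteq> 1" for x :: var unfolding var_reg_def by presburger+
  then have "reg s2 (var_reg x) = 0" for x :: var using input(3) by (simp add: s1_def s2_def)
  moreover have "reg s (var_reg x) = reg s2 (var_reg x)" for x :: var by (rule s(4)) auto
  ultimately have "represents s (\<lambda>_ :: var. 0) input_arrays"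
    using s(2,3) by (simp add: represents_def input_arrays_def)
  then show ?thesis using reaches_trans[OF start s(1)] by (intro exI[of _ s]) (simp add: all_arrays_def)
qed

definition main_cost :: nat where
  "main_cost = 41 + (preprocess_cost + solve_cost (max_hitters n q)) + (2 * k + 1)"

lemma solve_cost_mono: "h \<le> h' \<Longrightarrow> solve_cost h \<le> solve_cost h'"
  unfolding solve_cost_def round_cost_def search_cost_def leaf_cost_def
  by (intro add_mono mult_le_mono power_mono) simp_all

lemma preprocess_solve_spec:
  "WP (preprocess k ;; solve k) (\<lambda>_ \<sigma>' \<mu>'. output_correct (\<sigma>' Out) (solution \<sigma>' ` {..<k}))
    (preprocess_cost + solve_cost (max_hitters n q)) (\<lambda>_. 0) input_arrays"
proof (rule wp_Seq, rule wp_call[OF preprocess_spec])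
  fix t and \<sigma> :: "var store" and \<mu>
  assume budget: "preprocess_cost + solve_cost (max_hitters n q) - preprocess_cost \<le> t"
    and frame: "\<And>x. x \<notin> writes (preprocess k) \<Longrightarrow> \<sigma> x = 0"
    and data: "\<sigma> RowLen = q \<and> \<sigma> Hitters \<le> max_hitters n q \<and> search_instance n E k es w \<mu> (\<sigma> Hitters)"
  interpret search_instance n E k es w \<mu> "\<sigma> Hitters" using data by simp
  have "\<forall>l<k. solution \<sigma> l < n" using frame Sol_notin_writes_preprocess n_pos by (simp add: solution_def)
  moreover have "solve_cost (\<sigma> Hitters) \<le> t" using data solve_cost_mono[of "\<sigma> Hitters" "max_hitters n q"] budget by simp
  ultimately show "WP (solve k) (\<lambda>_ \<sigma>' \<mu>'. output_correct (\<sigma>' Out) (solution \<sigma>' ` {..<k})) t \<sigma> \<mu>"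
    using data by (intro wp_call[OF solve_spec]) simp_all
qed (use n_pos in \<open>simp_all add: input_arrays_simps\<close>)

theorem run_k_center_program:
  assumes "main_cost \<le> T"
  shows "\<exists>s. run w T (k_center_program k, input_state n es) = return_pmf ([], s) \<and>
    output_correct (reg s 0) (output_centers k ([], s))"
proof -
  let ?K = "store_centers k @ [Move 0 (var_reg Out)]"
  obtain t \<sigma> \<mu> where exec: "exec w len (preprocess k ;; solve k) (\<lambda>_. 0) input_arrays t \<sigma> \<mu>"
      "t \<le> preprocess_cost + solve_cost (max_hitters n q)" "output_correct (\<sigma> Out) (solution \<sigma> ` {..<k})"
    using preprocess_solve_spec unfolding wp_def by blast
  obtain s1 where s1: "reaches w 41 (k_center_program k, input_state n es) (compile (preprocess k ;; solve k) @ ?K, s1)"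
      "represents s1 (\<lambda>_ :: var. 0) input_arrays"
    using reaches_prologue unfolding k_center_program_def by blast
  obtain s2 where s2: "reaches w t (compile (preprocess k ;; solve k) @ ?K, s1) (?K, s2)" "represents s2 \<sigma> \<mu>"
    using reaches_compile[OF exec(1) s1(2)] by blast
  have "k < 2 ^ w" using k_le less_word(3) by (rule le_less_trans)
  from reaches_store_centers[OF this, of "[Move 0 (var_reg Out)]" s2] obtain s3
    where s3: "reaches w (2 * k) (?K, s2) ([Move 0 (var_reg Out)], s3)"
      "\<forall>l<k. mem s3 l = solution \<sigma> l" "reg s3 (var_reg Out) = \<sigma> Out"
    using s2(2) by (auto simp: represents_def solution_def)
  define s4 where "s4 = set_reg 0 (\<sigma> Out) s3"
  have "reaches w 1 ([Move 0 (var_reg Out)], s3) ([], s4)" using s3(3) by (intro reaches_step) (simp add: s4_def)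
  then have "reaches w (41 + (t + (2 * k + 1))) (k_center_program k, input_state n es) ([], s4)"
    using s1(1) s2(1) s3(1) by (blast intro: reaches_trans)
  then have "run w T (k_center_program k, input_state n es) = return_pmf ([], s4)"
    by (rule run_reaches_halted) (use exec(2) assms in \<open>simp add: main_cost_def\<close>)
  moreover have "output_centers k ([], s4) = solution \<sigma> ` {..<k}" "reg s4 0 = \<sigma> Out"
    using s3(2) by (auto simp: output_centers_def s4_def)
  ultimately show ?thesis using exec(3) by auto
qed

end

section \<open>Running time\<close>

definition edge_and_center_term :: "nat \<Rightarrow> nat \<Rightarrow> nat \<Rightarrow> real" where
  "edge_and_center_term k n m = real m * real n + real n powr (real k / 2 + 1)"

definition log_factor :: "nat \<Rightarrow> real" where
  "log_factor n = 1 + log 2 (real n)"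

lemma log_factor_ge_1: "1 \<le> n \<Longrightarrow> 1 \<le> log_factor n"
  by (simp add: log_factor_def)

lemma floorlog_le_log_factor: "1 \<le> n \<Longrightarrow> real (floorlog 2 n) \<le> log_factor n"
  by (simp add: floorlog_def log_factor_def)

lemma ln_le_log2:
  assumes "1 \<le> (x :: real)"
  shows "ln x \<le> log 2 x"
proof -
  have "0 < ln (2 :: real)" "ln 2 \<le> (1 :: real)" using ln_le_minus_one[of 2] by simp_all
  then have "ln x * ln 2 \<le> ln x" using assms by (simp add: mult_left_le)
  then show ?thesis by (simp add: log_def field_simps)
qed

lemma sqrt_power_eq_powr:
  assumes "1 \<le> n"
  shows "real n * sqrt (real n) ^ k = real n powr (real k / 2 + 1)"
proof -
  have "sqrt (real n) ^ k = (real n powr (1 / 2)) powr real k"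
    using assms by (simp add: powr_half_sqrt powr_realpow)
  also have "\<dots> = real n powr (real k / 2)" by (simp add: powr_powr)
  finally show ?thesis using assms by (simp add: powr_add)
qed

context center_instance begin

abbreviation F :: real where "F \<equiv> edge_and_center_term k n m"
abbreviation L :: real where "L \<equiv> log_factor n"
abbreviation H :: real where "H \<equiv> real (max_hitters n q)"

lemma L_ge_1: "1 \<le> L"
  using n_pos by (rule log_factor_ge_1)

lemma square_le_F:
  assumes "n \<le> m + 1"
  shows "real n * real n \<le> F"
proof -
  have "real n * real n \<le> (real m + 1) * real n" using assms by (intro mult_right_mono) auto
  also have "real n \<le> real n powr (real k / 2 + 1)" using n_pos powr_mono[of 1 "real k / 2 + 1" "real n"] by simp
  then have "(real m + 1) * real n \<le> F" by (simp add: edge_and_center_term_def algebra_simps)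
  finally show ?thesis .
qed

lemma F_ge_1: "n \<le> m + 1 \<Longrightarrow> 1 \<le> F"
  using square_le_F n_pos mult_mono[of 1 "real n" 1 "real n"] by simp

lemma max_hitters_le: "H \<le> real n / real q * L"
proof -
  have "H \<le> greedy_potential n q n" using greedy_potential_nonneg by (simp add: max_hitters_def)
  also have "\<dots> \<le> real n / real q * L"
    using n_pos ln_le_log2[of "real n"] by (auto simp: greedy_potential_def log_factor_def intro!: divide_right_mono mult_left_mono)
  finally show ?thesis .
qed

lemma max_hitters_mult_le: "H * real q \<le> real n * L" "H \<le> real n * L"
proof -
  show mult: "H * real q \<le> real n * L" using max_hitters_le q_pos by (simp add: field_simps)
  have "H * 1 \<le> H * real q" using q_pos by (intro mult_left_mono) auto
  then show "H \<le> real n * L" using mult by simp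
qed

lemma preprocess_cost_le:
  assumes "n \<le> m + 1"
  shows "real preprocess_cost \<le> 634 * (F * L)"
proof -
  have sizes: "1 \<le> real n" "1 \<le> real q" "real q \<le> real n" "1 \<le> real n * real q"
    using n_pos q_pos q_le mult_mono[of 1 "real n" 1 "real q"] by auto
  have "real n * real n * L \<le> F * L" using square_le_F[OF assms] L_ge_1 by (intro mult_right_mono) auto
  then have square_log: "real n * (real n * L) \<le> F * L" by (simp add: mult.assoc)
  have scan: "real n * (H * real q) \<le> F * L" "real n * H \<le> F * L"
    using order_trans[OF mult_left_mono[OF max_hitters_mult_le(1)] square_log]
      order_trans[OF mult_left_mono[OF max_hitters_mult_le(2)] square_log] by simp_all
  have F_le: "F \<le> F * L" using F_ge_1[OF assms] L_ge_1 by (simp add: mult_le_cancel_left1)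
  have products: "real n * real q \<le> real n * real n" "real n \<le> real n * real q" "real m \<le> real m * real n" "real m * real n \<le> F"
    using sizes by (auto simp: edge_and_center_term_def mult_le_cancel_left1)
  then have terms: "real n \<le> F * L" "real n * real n \<le> F * L" "real n * real q \<le> F * L"
    "real m * real n \<le> F * L" "real m \<le> F * L" "1 \<le> F * L"
    using square_le_F[OF assms] F_le sizes by linarith+
  have "real greedy_cost = 46 * (real n * real q) + 62 * real n + 38" by (simp add: greedy_cost_def algebra_simps)
  also have "\<dots> \<le> 146 * (real n * real q)" using sizes products by linarith
  finally have "(H + 1) * real greedy_cost \<le> (H + 1) * (146 * (real n * real q))" by (intro mult_left_mono) simp_all
  then have "(H + 1) * real greedy_cost \<le> 292 * (F * L)" using scan(1) terms(3) by (simp add: algebra_simps)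
  moreover have "real preprocess_cost = 78 * real n + 26 + 48 * real m + 92 * (real m * real n) + 60 * (real n * real n) +
      (H + 1) * real greedy_cost + 38 * (real n * H)"
    by (simp add: preprocess_cost_def select_cost_def algebra_simps)
  ultimately show ?thesis using scan(2) terms by linarith
qed

text \<open>For \<open>k = 1\<close> the rows have length one, so there are up to \<open>n\<close> hitters; otherwise about \<open>sqrt n\<close>.\<close>

definition branching :: real where
  "branching = (if k = 1 then real n else sqrt (real n))"

lemma branching_ge_1: "1 \<le> branching"
  using n_pos by (simp add: branching_def)

lemma row_length_le: "real q \<le> 2 * branching"
proof (cases "k = 1")
  case False
  have "(q - 1) * (q - 1) < n" using q_bounds(4)[OF False, of "q - 1"] q_pos by simp
  then have "real (q - 1) ^ 2 \<le> real n" by (metis of_nat_le_iff of_nat_mult less_imp_le power2_eq_square)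
  then have "real (q - 1) \<le> sqrt (real n)" by (rule real_le_rsqrt)
  then have "real q \<le> sqrt (real n) + 1" using q_pos by simp
  also have "\<dots> \<le> 2 * sqrt (real n)" using n_pos by simp
  finally show ?thesis using False by (simp add: branching_def)
qed (unfold branching_def, use q_le in simp)

lemma hitters_le_branching: "H \<le> branching * L"
proof -
  have "real n / real q \<le> branching"
  proof (cases "k = 1")
    case True
    then show ?thesis unfolding branching_def using q_pos by (simp add: divide_le_eq mult_le_cancel_left1)
  next
    case False
    have "n \<le> q * q" using q_bounds(3)[OF False] .
    then have "real n \<le> real q ^ 2" by (metis of_nat_le_iff of_nat_mult power2_eq_square)
    then have "sqrt (real n) \<le> real q" by (intro real_le_lsqrt) auto
    then have "sqrt (real n) * sqrt (real n) \<le> sqrt (real n) * real q" by (intro mult_left_mono) auto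
    then show ?thesis using False q_pos by (simp add: branching_def divide_le_eq)
  qed
  then have "real n / real q * L \<le> branching * L" using L_ge_1 by (intro mult_right_mono) auto
  then show ?thesis using max_hitters_le by linarith
qed

lemma branching_power_le:
  assumes "n \<le> m + 1"
  shows "real n * branching ^ k \<le> F"
  using square_le_F[OF assms] sqrt_power_eq_powr[OF n_pos, of k]
  unfolding branching_def edge_and_center_term_def by (cases "k = 1") simp_all

lemma search_cost_le:
  assumes "n \<le> m + 1"
  shows "real (search_cost (max_hitters n q) (k - 1)) \<le> real ((12 * k + 50) * 5 ^ k) * (F * L ^ k)"
proof -
  have "branching \<le> branching * L" using branching_ge_1 L_ge_1 by (simp add: mult_le_cancel_left1)
  then have base: "H + real q + 2 \<le> 5 * branching * L"
    using hitters_le_branching row_length_le branching_ge_1 by linarith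
  have "search_cost (max_hitters n q) (k - 1) = n * (12 * k + 50) * (max_hitters n q + q + 2) ^ Suc (k - 1)"
    by (simp only: search_cost_def leaf_cost_def power_Suc mult.assoc)
  also have "Suc (k - 1) = k" using k_pos by simp
  finally have "real (search_cost (max_hitters n q) (k - 1)) = real (12 * k + 50) * (real n * (H + real q + 2) ^ k)"
    by (simp add: algebra_simps)
  also have "\<dots> \<le> real (12 * k + 50) * (real n * (5 * branching * L) ^ k)"
    using base by (intro mult_left_mono power_mono) auto
  also have "\<dots> = real ((12 * k + 50) * 5 ^ k) * (real n * branching ^ k * L ^ k)"
    by (simp add: algebra_simps)
  also have "\<dots> \<le> real ((12 * k + 50) * 5 ^ k) * (F * L ^ k)"
    using branching_power_le[OF assms] L_ge_1 by (intro mult_left_mono mult_right_mono) auto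
  finally show ?thesis .
qed

end

definition cost_factor :: "nat \<Rightarrow> nat" where
  "cost_factor k = 1000 + (12 * k + 50) * 5 ^ k + k * (4 * k * (k + 2)) + 2 * k"

lemma (in center_instance) main_cost_le:
  assumes "n \<le> m + 1"
  shows "real main_cost \<le> real (cost_factor k) * F * L ^ (k + 1)"
proof -
  define P where "P = F * L ^ (k + 1)"
  have ge_1: "1 \<le> F * L ^ k"
    using F_ge_1[OF assms] L_ge_1 mult_mono[of 1 F 1 "L ^ k"] by simp
  have P_eq: "P = L * (F * L ^ k)" by (simp only: P_def power_add power_one_right mult_ac)
  have "1 \<le> P" unfolding P_eq using ge_1 L_ge_1 mult_mono[of 1 L 1 "F * L ^ k"] by simp
  have "F * L \<le> P"
    unfolding P_def using F_ge_1[OF assms] L_ge_1 power_increasing[of 1 "k + 1" L] by (intro mult_left_mono) simp_all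
  then have preprocess: "real preprocess_cost \<le> 634 * P" using preprocess_cost_le[OF assms] by simp
  let ?c = "real ((12 * k + 50) * 5 ^ k)"
  have "real (round_cost (max_hitters n q)) \<le> ?c * (F * L ^ k) + 34 * (F * L ^ k)"
    using search_cost_le[OF assms] ge_1 by (simp add: round_cost_def)
  then have "real (floorlog 2 n) * real (round_cost (max_hitters n q)) \<le> L * (?c * (F * L ^ k) + 34 * (F * L ^ k))"
    using L_ge_1 by (intro mult_mono floorlog_le_log_factor n_pos) auto
  then have rounds: "real (floorlog 2 n * round_cost (max_hitters n q)) \<le> ?c * P + 34 * P" by (simp add: P_eq algebra_simps)
  have "real (k * (4 * k * (k + 2)) + 2 * k + 64) \<le> real (k * (4 * k * (k + 2)) + 2 * k + 64) * P"
    using \<open>1 \<le> P\<close> mult_left_mono[of 1 P "real (k * (4 * k * (k + 2)) + 2 * k + 64)"] by simp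
  then have "real main_cost \<le> 634 * P + (?c * P + 34 * P) + real (k * (4 * k * (k + 2)) + 2 * k + 64) * P"
    using preprocess rounds by (simp add: main_cost_def solve_cost_def)
  also have "\<dots> \<le> real (cost_factor k) * P" using \<open>1 \<le> P\<close> by (simp add: cost_factor_def algebra_simps)
  finally show ?thesis by (simp add: P_def mult.assoc)
qed

definition time_limit :: "nat \<Rightarrow> nat \<Rightarrow> nat \<Rightarrow> nat" where
  "time_limit k n m = nat \<lfloor>real (cost_factor k) * edge_and_center_term k n m * log_factor n ^ (k + 1)\<rfloor>"

lemma time_limit_soft_O: "time_limit k \<in> soft_O (edge_and_center_term k)"
  unfolding soft_O_def
proof (intro CollectI exI allI impI)
  fix n m :: nat
  assume "1 \<le> n"
  then have "0 \<le> real (cost_factor k) * edge_and_center_term k n m * log_factor n ^ (k + 1)"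
    using log_factor_ge_1[of n] by (intro mult_nonneg_nonneg zero_le_power) (auto simp: edge_and_center_term_def)
  then show "real (time_limit k n m) \<le> real (cost_factor k) * edge_and_center_term k n m * (1 + log 2 (real n)) ^ (k + 1)"
    by (simp add: time_limit_def log_factor_def)
qed

section \<open>The word length\<close>

lemma card_edges_le:
  assumes "simple_graph n E"
  shows "card E \<le> n * n"
proof -
  have "E \<subseteq> (\<lambda>(u, v). {u, v}) ` ({..<n} \<times> {..<n})"
    using assms by (fastforce simp: simple_graph_def)
  then have "card E \<le> card ({..<n} \<times> {..<n})" by (rule surj_card_le[rotated]) simp
  then show ?thesis by (simp add: card_cartesian_product)
qed

lemma length_edge_listing: "edge_listing E es \<Longrightarrow> length es = card E"
  using distinct_card[of "map (\<lambda>(u, v). {u, v}) es"] by (simp add: edge_listing_def)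

lemma word_length_sufficient:
  assumes "1 \<le> n"
  shows "400 * (n * n) \<le> 2 ^ (12 * floorlog 2 n)"
proof -
  define b where "b = (2::nat) ^ floorlog 2 n"
  have "n < b" unfolding b_def using floorlog_bounds[of n 2] assms by simp
  then have "n * n \<le> b ^ 2" "2 \<le> b" using assms by (auto simp: power2_eq_square intro!: mult_le_mono)
  moreover have "2 ^ 10 \<le> b ^ 10" using \<open>2 \<le> b\<close> by (intro power_mono) auto
  ultimately have "2 ^ 10 * (n * n) \<le> b ^ 10 * b ^ 2" by (intro mult_le_mono)
  also have "\<dots> = 2 ^ (12 * floorlog 2 n)"
    unfolding b_def by (simp add: power_mult[symmetric] power_add[symmetric] mult.commute)
  finally show ?thesis by simp
qed

lemma center_instanceI:
  assumes "simple_graph n E" "1 \<le> k" "k \<le> n" "edge_listing E es"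
  shows "center_instance n E k es (12 * floorlog 2 n)"
proof
  have "n \<le> n * n" "length es \<le> n * n" "1 \<le> n"
    using assms card_edges_le[OF assms(1)] by (auto simp: length_edge_listing)
  then have "100 * (n * n + n + length es + 1) \<le> 400 * (n * n)" unfolding distrib_left by linarith
  also have "\<dots> \<le> 2 ^ (12 * floorlog 2 n)" using assms by (intro word_length_sufficient) simp
  finally show "100 * (n * n + n + length es + 1) \<le> 2 ^ (12 * floorlog 2 n)" .
qed (use assms in simp_all)

lemma k_center_program_solves:
  assumes "1 \<le> k"
  shows "solves_k_center_whp (k_center_program k) 12 (time_limit k) 1 k (2 - 1 / (2 * real k - 1)) (1 - 1 / (2 * real k - 1))"
  unfolding solves_k_center_whp_def
proof (intro allI impI)
  fix n E es
  assume input: "simple_graph n E \<and> k \<le> n \<and> n \<le> card E + 1 \<and> edge_listing E es"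
  then interpret center_instance n E k es "12 * floorlog 2 n" using assms by (intro center_instanceI) simp_all
  have m: "m = card E" using input by (simp add: length_edge_listing)
  have "main_cost \<le> time_limit k n m"
    unfolding time_limit_def using main_cost_le input m by (intro le_nat_floor) simp
  from run_k_center_program[OF this] obtain s
    where "run (12 * floorlog 2 n) (time_limit k n (card E)) (k_center_program k, input_state n es) = return_pmf ([], s)"
      "output_correct (reg s 0) (output_centers k ([], s))"
    unfolding m by blast
  then show "let D = run (12 * floorlog 2 n) (time_limit k n (card E)) (k_center_program k, input_state n es) in
      (\<forall>cf\<in>set_pmf D. halted cf) \<and>
      measure_pmf.prob D {cf. k_center_approx (2 - 1 / (2 * real k - 1)) (1 - 1 / (2 * real k - 1)) n E k
        (output_value cf) (output_centers k cf)} \<ge> 1 - 1 / real n powr 1"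
    by (simp add: halted_def output_correct_def output_value_def)
qed

theorem mainTheorem9:
  fixes k :: nat
  assumes "k \<ge> 1"
  shows "\<exists>(P :: instr list) (\<kappa> :: nat) (T :: nat \<Rightarrow> nat \<Rightarrow> nat) (c :: real).
    \<kappa> \<ge> 2 \<and> c > 0 \<and>
    T \<in> soft_O (\<lambda>n m. real m * real n + real n powr (real k / 2 + 1)) \<and>
    solves_k_center_whp P \<kappa> T c k
      (2 - 1 / (2 * real k - 1)) (1 - 1 / (2 * real k - 1))"
proof (intro exI conjI)
  show "time_limit k \<in> soft_O (\<lambda>n m. real m * real n + real n powr (real k / 2 + 1))"
    using time_limit_soft_O by (simp add: edge_and_center_term_def[abs_def])
  show "solves_k_center_whp (k_center_program k) 12 (time_limit k) 1 k (2 - 1 / (2 * real k - 1)) (1 - 1 / (2 * real k - 1))"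
    using assms by (rule k_center_program_solves)
qed simp_all

end
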